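(* Let $G$ be a Lie group with Lie algebra $\mathfrak g$, let $\mathfrak g$ carry a $G$-invariant inner product, let $0\neq\mu\in\mathfrak g^*$, and let $\mathfrak g_\mu^\perp$ be the orthogonal complement of $\mathfrak g_\mu$. Let $U\subset \mathfrak g_\mu^*\times\mathfrak g_\mu^\perp$ be a connected open neighbourhood of $(0,0)$ (possibly everything), and let $Y=\{(g,\nu,\operatorname{ad}^*_\eta\mu): g\in G,\ (\nu,\eta)\in U\}\subset G\times\mathfrak g_\mu^*\times T_\mu\mathcal O_\mu$. Let $\Phi:Y\to G\times\mathfrak g^*$ be a smooth $G$-equivariant local diffeomorphism with $\Phi(e,0,0)=(e,\mu)$. Then $\Phi^*\Omega_c=\Omega_Y$ if and only if $$\Phi(g,\nu,\operatorname{ad}^*_\eta\mu)=\Big(gF(\nu,\eta)^{-1},\ \operatorname{Ad}^*_{F(\nu,\eta)^{-1}}(\mu+\nu)\Big)$$ for some smooth $F:U\to G$ such that $F(0,0)=e$ and, for all $(\nu,\eta)\in U$, all $\dot\nu_1,\dot\nu_2\in\mathfrak g_\mu^*$ and all $\zeta_1,\zeta_2\in\mathfrak g_\mu^\perp$, $$\big\langle \mu+\nu,\big[F(\nu,\eta)^{-1}(DF(\nu,\eta)\cdot(\dot\nu_1,\zeta_1)),\,F(\nu,\eta)^{-1}(DF(\nu,\eta)\cdot(\dot\nu_2,\zeta_2))\big]\big\rangle$$ $$+\big\langle\dot\nu_2,F(\nu,\eta)^{-1}(DF(\nu,\eta)\cdot(\dot\nu_1,\zeta_1))\big\rangle-\big\langle\dot\nu_1,F(\nu,\eta)^{-1}(DF(\nu,\eta)\cdot(\dot\nu_2,\zeta_2))\big\rangle=\langle\mu,[\zeta_1,\zeta_2]\rangle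 .$$
   Context: $\langle\operatorname{ad}^*_\eta\mu,\xi\rangle=\langle\mu,[\eta,\xi]\rangle$; the coadjoint action of $g$ on $\mathfrak g^*$ is $\operatorname{Ad}^*_{g^{-1}}$, where $\langle \operatorname{Ad}^*_{g^{-1}}\nu,\xi\rangle=\langle\nu,\operatorname{Ad}_{g^{-1}}\xi\rangle$. $G_\mu$ is the isotropy group of $\mu$ for the coadjoint action, with Lie algebra $\mathfrak g_\mu=\{\xi:\operatorname{ad}^*_\xi\mu=0\}$. $\mathcal O_\mu$ is the coadjoint orbit of $\mu$; $T_\mu\mathcal O_\mu=\{\operatorname{ad}^*_\eta\mu:\eta\in\mathfrak g_\mu^\perp\}$, and $\eta\mapsto\operatorname{ad}^*_\eta\mu$ is a linear isomorphism $\mathfrak g_\mu^\perp\to T_\mu\mathcal O_\mu$. Via the splitting $\mathfrak g=\mathfrak g_\mu\oplus\mathfrak g_\mu^\perp$, $\mathfrak g_\mu^*$ is regarded as the subspace of $\mathfrak g^*$ of elements annihilating $\mathfrak g_\mu^\perp$; $\xi^\mu$ denotes the $\mathfrak g_\mu$-component of $\xi$. $T^*G$ is identified with $G\times\mathfrak g^*$ by left-trivialisation, and tangent vectors to $G$ are also left-trivialised (so $\xi\in\mathfrak g$ at $g$ means $g\xi\in T_gG$). The canonical symplectic form is $$\Omega_c(g,\nu)((\xi_1,\rho_1),(\xi_2,\rho_2))=\langle\nu,[\xi_1,\xi_2]\rangle+\langle\rho_2,\xi_1\rangle-\langle\rho_1,\xi_2\rangle .$$ On $G\times\mathfrak g_\mu^*\times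 T_\mu\mathcal O_\mu$ the two-form $\Omega_Y$ is, at $(g,\nu,\rho)$, $$\Omega_Y\big((\xi_1,\dot\nu_1,\operatorname{ad}^*_{\zeta_1}\mu),(\xi_2,\dot\nu_2,\operatorname{ad}^*_{\zeta_2}\mu)\big)=\langle\mu+\nu,[\xi_1,\xi_2]\rangle+\langle\dot\nu_2,\xi_1^\mu\rangle-\langle\dot\nu_1,\xi_2^\mu\rangle-\langle\mu,[\zeta_1,\zeta_2]\rangle,$$ with $\xi_i\in\mathfrak g$, $\dot\nu_i\in\mathfrak g_\mu^*$, $\zeta_i\in\mathfrak g_\mu^\perp$. $G$ acts on $G\times\mathfrak g^*$ by $h(g,\nu)=(hg,\nu)$ and on $G\times\mathfrak g_\mu^*\times T_\mu\mathcal O_\mu$ by $h(g,\nu,\rho)=(hg,\nu,\rho)$. For $F$ with values in $G$, $F(\nu,\eta)^{-1}(DF(\nu,\eta)\cdot(\dot\nu,\zeta))\in\mathfrak g$ is the left translation to the identity of the derivative of $F$ at $(\nu,\eta)$ in direction $(\dot\nu,\zeta)$. *)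

theory Defs
  imports "HOL-Analysis.Analysis" "HOL-Algebra.Group"
begin

section \<open>Smooth maps on open subsets of linear subspaces\<close>

text \<open>
  In the following two definitions, W is a finite-dimensional linear subspace of a normed space and
  S is a relatively open subset of W.  A derivative relative to W is then uniquely determined on W
  (and only there), which is why only directions in W are used.
\<close>

fun k_smooth_on ::
  "nat \<Rightarrow> 'e::real_normed_vector set \<Rightarrow> 'e set \<Rightarrow> ('e \<Rightarrow> 'f::real_normed_vector) \<Rightarrow> bool" where
  "k_smooth_on 0 W S f \<longleftrightarrow> continuous_on S f"
| "k_smooth_on (Suc k) W S f \<longleftrightarrow>
     (\<forall>x\<in>S. f differentiable (at x within W)) \<and>
     (\<forall>v\<in>W. k_smooth_on k W S (\<lambda>x. frechet_derivative f (at x within W) v))"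

definition smooth_on ::
  "'e::real_normed_vector set \<Rightarrow> 'e set \<Rightarrow> ('e \<Rightarrow> 'f::real_normed_vector) \<Rightarrow> bool" where
  "smooth_on W S f \<longleftrightarrow> (\<forall>k. k_smooth_on k W S f)"


section \<open>Smooth manifolds\<close>

text \<open>
  A chart is a pair of its domain and its coordinate map.  A manifold is modelled on a linear
  subspace of a normed space, so that linear subspaces and their open subsets are manifolds without
  a choice of basis.  The record carries a preferred chart around each point; it serves to represent
  the tangent space at p: the model space stands for the tangent space at p
  through the differential at p of the preferred chart at p.
\<close>

type_synonym ('m, 'e) chart = "'m set \<times> ('m \<Rightarrow> 'e)"

record ('m, 'e) mfd =
  mtop :: "'m topology"
  model :: "'e set"
  atlas :: "('m, 'e) chart set"
  chart_at :: "'m \<Rightarrow> ('m, 'e) chart"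

abbreviation dom_at :: "('m, 'e) mfd \<Rightarrow> 'm \<Rightarrow> 'm set" where
  "dom_at M p \<equiv> fst (chart_at M p)"

abbreviation coord_at :: "('m, 'e) mfd \<Rightarrow> 'm \<Rightarrow> 'm \<Rightarrow> 'e" where
  "coord_at M p \<equiv> snd (chart_at M p)"

abbreviation param_at :: "('m, 'e) mfd \<Rightarrow> 'm \<Rightarrow> 'e \<Rightarrow> 'm" where
  "param_at M p \<equiv> inv_into (dom_at M p) (coord_at M p)"

definition second_countable_space :: "'m topology \<Rightarrow> bool" where
  "second_countable_space T \<longleftrightarrow>
     (\<exists>\<B>. countable \<B> \<and> (\<forall>B\<in>\<B>. openin T B) \<and>
        (\<forall>S x. openin T S \<and> x \<in> S \<longrightarrow> (\<exists>B\<in>\<B>. x \<in> B \<and> B \<subseteq> S)))"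

definition smooth_manifold :: "('m, 'e::real_normed_vector) mfd \<Rightarrow> bool" where
  "smooth_manifold M \<longleftrightarrow>
     Hausdorff_space (mtop M) \<and> second_countable_space (mtop M) \<and>
     subspace (model M) \<and> (\<exists>B. finite B \<and> model M = span B) \<and>
     (\<forall>(D, \<phi>)\<in>atlas M. openin (mtop M) D \<and> openin (top_of_set (model M)) (\<phi> ` D) \<and>
        homeomorphic_map (subtopology (mtop M) D) (top_of_set (\<phi> ` D)) \<phi>) \<and>
     (\<forall>(D, \<phi>)\<in>atlas M. \<forall>(D', \<phi>')\<in>atlas M.
        smooth_on (model M) (\<phi> ` (D \<inter> D')) (\<phi>' \<circ> inv_into D \<phi>)) \<and>
     (\<forall>p\<in>topspace (mtop M). chart_at M p \<in> atlas M \<and> p \<in> dom_at M p)"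

definition smooth_map ::
  "('m, 'e::real_normed_vector) mfd \<Rightarrow> ('n, 'f::real_normed_vector) mfd \<Rightarrow> ('m \<Rightarrow> 'n) \<Rightarrow> bool" where
  "smooth_map M N f \<longleftrightarrow>
     continuous_map (mtop M) (mtop N) f \<and>
     (\<forall>(D, \<phi>)\<in>atlas M. \<forall>(E, \<psi>)\<in>atlas N.
        smooth_on (model M) (\<phi> ` {x \<in> D. f x \<in> E}) (\<psi> \<circ> f \<circ> inv_into D \<phi>))"

definition vec_mfd :: "'e::real_normed_vector set \<Rightarrow> ('e, 'e) mfd" where
  "vec_mfd W = \<lparr>mtop = top_of_set W, model = W, atlas = {(W, id)}, chart_at = (\<lambda>_. (W, id))\<rparr>"

definition prod_chart :: "('m, 'e) chart \<Rightarrow> ('n, 'f) chart \<Rightarrow> ('m \<times> 'n, 'e \<times> 'f) chart" where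
  "prod_chart c d = (fst c \<times> fst d, map_prod (snd c) (snd d))"

definition prod_mfd :: "('m, 'e) mfd \<Rightarrow> ('n, 'f) mfd \<Rightarrow> ('m \<times> 'n, 'e \<times> 'f) mfd" where
  "prod_mfd M N =
     \<lparr>mtop = prod_topology (mtop M) (mtop N),
      model = model M \<times> model N,
      atlas = {prod_chart c d |c d. c \<in> atlas M \<and> d \<in> atlas N},
      chart_at = (\<lambda>(p, q). prod_chart (chart_at M p) (chart_at N q))\<rparr>"

text \<open>The open submanifold with underlying set S (S is assumed open wherever this is used).\<close>

definition open_submfd :: "('m, 'e) mfd \<Rightarrow> 'm set \<Rightarrow> ('m, 'e) mfd" where
  "open_submfd M S =
     \<lparr>mtop = subtopology (mtop M) S,
      model = model M,
      atlas = (\<lambda>(D, \<phi>). (D \<inter> S, \<phi>)) ` atlas M,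
      chart_at = (\<lambda>p. (dom_at M p \<inter> S, coord_at M p))\<rparr>"

definition diffeo ::
  "('m, 'e::real_normed_vector) mfd \<Rightarrow> ('n, 'f::real_normed_vector) mfd \<Rightarrow> ('m \<Rightarrow> 'n) \<Rightarrow> bool" where
  "diffeo M N f \<longleftrightarrow>
     bij_betw f (topspace (mtop M)) (topspace (mtop N)) \<and>
     smooth_map M N f \<and> smooth_map N M (inv_into (topspace (mtop M)) f)"

definition local_diffeo ::
  "('m, 'e::real_normed_vector) mfd \<Rightarrow> ('n, 'f::real_normed_vector) mfd \<Rightarrow> ('m \<Rightarrow> 'n) \<Rightarrow> bool" where
  "local_diffeo M N f \<longleftrightarrow>
     (\<forall>p\<in>topspace (mtop M). \<exists>S. openin (mtop M) S \<and> p \<in> S \<and> openin (mtop N) (f ` S) \<and>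
        diffeo (open_submfd M S) (open_submfd N (f ` S)) f)"


section \<open>Tangent maps, pullbacks and brackets of vector fields\<close>

definition tangent_map ::
  "('m, 'e::real_normed_vector) mfd \<Rightarrow> ('n, 'f::real_normed_vector) mfd \<Rightarrow> ('m \<Rightarrow> 'n) \<Rightarrow> 'm \<Rightarrow> 'e \<Rightarrow> 'f" where
  "tangent_map M N f p =
     frechet_derivative (coord_at N (f p) \<circ> f \<circ> param_at M p) (at (coord_at M p p) within model M)"

definition form_pullback ::
  "('m, 'e::real_normed_vector) mfd \<Rightarrow> ('n, 'f::real_normed_vector) mfd \<Rightarrow> ('m \<Rightarrow> 'n) \<Rightarrow>
     ('n \<Rightarrow> 'f \<Rightarrow> 'f \<Rightarrow> real) \<Rightarrow> 'm \<Rightarrow> 'e \<Rightarrow> 'e \<Rightarrow> real" where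
  "form_pullback M N f \<omega> p v w = \<omega> (f p) (tangent_map M N f p v) (tangent_map M N f p w)"

text \<open>
  The coordinate expression, in the preferred chart at p, of a vector field X (where X q is
  represented in the preferred chart at q).
\<close>

definition field_coord ::
  "('m, 'e::real_normed_vector) mfd \<Rightarrow> ('m \<Rightarrow> 'e) \<Rightarrow> 'm \<Rightarrow> 'e \<Rightarrow> 'e" where
  "field_coord M X p x =
     (let q = param_at M p x in
      frechet_derivative (coord_at M p \<circ> param_at M q) (at (coord_at M q q) within model M) (X q))"

definition field_bracket ::
  "('m, 'e::real_normed_vector) mfd \<Rightarrow> ('m \<Rightarrow> 'e) \<Rightarrow> ('m \<Rightarrow> 'e) \<Rightarrow> 'm \<Rightarrow> 'e" where
  "field_bracket M X Y p =
     (let F = at (coord_at M p p) within model M in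
      frechet_derivative (field_coord M Y p) F (X p) - frechet_derivative (field_coord M X p) F (Y p))"


section \<open>Lie groups\<close>

text \<open>
  The model space is a whole Euclidean space, which thereby represents the Lie
  algebra, i.e. the tangent space at the identity.  The inner product of the type plays no role.
\<close>

definition lie_group :: "('g, 'x) monoid_scheme \<Rightarrow> ('g, 'a::euclidean_space) mfd \<Rightarrow> bool" where
  "lie_group G M \<longleftrightarrow>
     group G \<and> smooth_manifold M \<and> topspace (mtop M) = carrier G \<and> model M = UNIV \<and>
     smooth_map (prod_mfd M M) M (\<lambda>(x, y). x \<otimes>\<^bsub>G\<^esub> y) \<and>
     smooth_map M M (\<lambda>x. inv\<^bsub>G\<^esub> x)"

type_synonym 'a dual = "'a \<Rightarrow>\<^sub>L real"

definition left_invariant_field ::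
  "('g, 'x) monoid_scheme \<Rightarrow> ('g, 'a::euclidean_space) mfd \<Rightarrow> 'a \<Rightarrow> 'g \<Rightarrow> 'a" where
  "left_invariant_field G M \<xi> g = tangent_map M M (\<lambda>x. g \<otimes>\<^bsub>G\<^esub> x) \<one>\<^bsub>G\<^esub> \<xi>"

definition lie_bracket ::
  "('g, 'x) monoid_scheme \<Rightarrow> ('g, 'a::euclidean_space) mfd \<Rightarrow> 'a \<Rightarrow> 'a \<Rightarrow> 'a" where
  "lie_bracket G M \<xi> \<eta> =
     field_bracket M (left_invariant_field G M \<xi>) (left_invariant_field G M \<eta>) \<one>\<^bsub>G\<^esub>"

definition left_triv ::
  "('g, 'x) monoid_scheme \<Rightarrow> ('g, 'a::euclidean_space) mfd \<Rightarrow> 'g \<Rightarrow> 'a \<Rightarrow> 'a" where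
  "left_triv G M g v = tangent_map M M (\<lambda>x. inv\<^bsub>G\<^esub> g \<otimes>\<^bsub>G\<^esub> x) g v"

definition Ad :: "('g, 'x) monoid_scheme \<Rightarrow> ('g, 'a::euclidean_space) mfd \<Rightarrow> 'g \<Rightarrow> 'a \<Rightarrow> 'a" where
  "Ad G M g \<xi> = tangent_map M M (\<lambda>x. g \<otimes>\<^bsub>G\<^esub> x \<otimes>\<^bsub>G\<^esub> inv\<^bsub>G\<^esub> g) \<one>\<^bsub>G\<^esub> \<xi>"

text \<open>
  The dual of Ad, without an inverse built in: the coadjoint action of g is the dual map at the
  inverse of g.
\<close>

definition Ad_star ::
  "('g, 'x) monoid_scheme \<Rightarrow> ('g, 'a::euclidean_space) mfd \<Rightarrow> 'g \<Rightarrow> 'a dual \<Rightarrow> 'a dual" where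
  "Ad_star G M g \<nu> = Blinfun (\<lambda>\<xi>. blinfun_apply \<nu> (Ad G M g \<xi>))"

definition ad_star ::
  "('g, 'x) monoid_scheme \<Rightarrow> ('g, 'a::euclidean_space) mfd \<Rightarrow> 'a \<Rightarrow> 'a dual \<Rightarrow> 'a dual" where
  "ad_star G M \<eta> \<mu> = Blinfun (\<lambda>\<xi>. blinfun_apply \<mu> (lie_bracket G M \<eta> \<xi>))"

definition invariant_inner_product ::
  "('g, 'x) monoid_scheme \<Rightarrow> ('g, 'a::euclidean_space) mfd \<Rightarrow> ('a \<Rightarrow> 'a \<Rightarrow> real) \<Rightarrow> bool" where
  "invariant_inner_product G M ip \<longleftrightarrow>
     bilinear ip \<and> (\<forall>\<xi> \<eta>. ip \<xi> \<eta> = ip \<eta> \<xi>) \<and> (\<forall>\<xi>. \<xi> \<noteq> 0 \<longrightarrow> ip \<xi> \<xi> > 0) \<and>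
     (\<forall>g\<in>carrier G. \<forall>\<xi> \<eta>. ip (Ad G M g \<xi>) (Ad G M g \<eta>) = ip \<xi> \<eta>)"


section \<open>Spaces attached to a momentum value\<close>

definition isotropy_algebra ::
  "('g, 'x) monoid_scheme \<Rightarrow> ('g, 'a::euclidean_space) mfd \<Rightarrow> 'a dual \<Rightarrow> 'a set" where
  "isotropy_algebra G M \<mu> = {\<xi>. ad_star G M \<xi> \<mu> = 0}"

definition isotropy_perp ::
  "('g, 'x) monoid_scheme \<Rightarrow> ('g, 'a::euclidean_space) mfd \<Rightarrow> ('a \<Rightarrow> 'a \<Rightarrow> real) \<Rightarrow> 'a dual \<Rightarrow> 'a set" where
  "isotropy_perp G M ip \<mu> = {\<eta>. \<forall>\<xi>\<in>isotropy_algebra G M \<mu>. ip \<xi> \<eta> = 0}"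

definition isotropy_dual ::
  "('g, 'x) monoid_scheme \<Rightarrow> ('g, 'a::euclidean_space) mfd \<Rightarrow> ('a \<Rightarrow> 'a \<Rightarrow> real) \<Rightarrow> 'a dual \<Rightarrow> 'a dual set" where
  "isotropy_dual G M ip \<mu> = {\<nu>. \<forall>\<eta>\<in>isotropy_perp G M ip \<mu>. blinfun_apply \<nu> \<eta> = 0}"

definition isotropy_component ::
  "('g, 'x) monoid_scheme \<Rightarrow> ('g, 'a::euclidean_space) mfd \<Rightarrow> ('a \<Rightarrow> 'a \<Rightarrow> real) \<Rightarrow> 'a dual \<Rightarrow> 'a \<Rightarrow> 'a" where
  "isotropy_component G M ip \<mu> \<xi> =
     (THE \<alpha>. \<alpha> \<in> isotropy_algebra G M \<mu> \<and> \<xi> - \<alpha> \<in> isotropy_perp G M ip \<mu>)"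

definition orbit_tangent ::
  "('g, 'x) monoid_scheme \<Rightarrow> ('g, 'a::euclidean_space) mfd \<Rightarrow> ('a \<Rightarrow> 'a \<Rightarrow> real) \<Rightarrow> 'a dual \<Rightarrow> 'a dual set" where
  "orbit_tangent G M ip \<mu> = (\<lambda>\<eta>. ad_star G M \<eta> \<mu>) ` isotropy_perp G M ip \<mu>"

definition orbit_tangent_rep ::
  "('g, 'x) monoid_scheme \<Rightarrow> ('g, 'a::euclidean_space) mfd \<Rightarrow> ('a \<Rightarrow> 'a \<Rightarrow> real) \<Rightarrow> 'a dual \<Rightarrow> 'a dual \<Rightarrow> 'a" where
  "orbit_tangent_rep G M ip \<mu> \<rho> = (THE \<zeta>. \<zeta> \<in> isotropy_perp G M ip \<mu> \<and> ad_star G M \<zeta> \<mu> = \<rho>)"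


section \<open>Phase spaces and their two-forms\<close>

definition cotangent_mfd ::
  "('g, 'a::euclidean_space) mfd \<Rightarrow> ('g \<times> 'a dual, 'a \<times> 'a dual) mfd" where
  "cotangent_mfd M = prod_mfd M (vec_mfd UNIV)"

definition slice_params ::
  "('g, 'x) monoid_scheme \<Rightarrow> ('g, 'a::euclidean_space) mfd \<Rightarrow> ('a \<Rightarrow> 'a \<Rightarrow> real) \<Rightarrow> 'a dual \<Rightarrow>
     ('a dual \<times> 'a, 'a dual \<times> 'a) mfd" where
  "slice_params G M ip \<mu> =
     prod_mfd (vec_mfd (isotropy_dual G M ip \<mu>)) (vec_mfd (isotropy_perp G M ip \<mu>))"

definition slice_model ::
  "('g, 'x) monoid_scheme \<Rightarrow> ('g, 'a::euclidean_space) mfd \<Rightarrow> ('a \<Rightarrow> 'a \<Rightarrow> real) \<Rightarrow> 'a dual \<Rightarrow>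
     ('g \<times> 'a dual \<times> 'a dual, 'a \<times> 'a dual \<times> 'a dual) mfd" where
  "slice_model G M ip \<mu> =
     prod_mfd M (prod_mfd (vec_mfd (isotropy_dual G M ip \<mu>)) (vec_mfd (orbit_tangent G M ip \<mu>)))"

definition slice_set ::
  "('g, 'x) monoid_scheme \<Rightarrow> ('g, 'a::euclidean_space) mfd \<Rightarrow> 'a dual \<Rightarrow> ('a dual \<times> 'a) set \<Rightarrow>
     ('g \<times> 'a dual \<times> 'a dual) set" where
  "slice_set G M \<mu> U = {(g, \<nu>, ad_star G M \<eta> \<mu>) |g \<nu> \<eta>. g \<in> carrier G \<and> (\<nu>, \<eta>) \<in> U}"

text \<open>
  Both forms are given by their left-trivialised formulas; they take tangent vectors to G as
  arguments, which are therefore first translated to the identity.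
\<close>

definition Omega_c ::
  "('g, 'x) monoid_scheme \<Rightarrow> ('g, 'a::euclidean_space) mfd \<Rightarrow>
     'g \<times> 'a dual \<Rightarrow> 'a \<times> 'a dual \<Rightarrow> 'a \<times> 'a dual \<Rightarrow> real" where
  "Omega_c G M = (\<lambda>(g, \<nu>) (v\<^sub>1, \<rho>\<^sub>1) (v\<^sub>2, \<rho>\<^sub>2).
     let \<xi>\<^sub>1 = left_triv G M g v\<^sub>1; \<xi>\<^sub>2 = left_triv G M g v\<^sub>2 in
     blinfun_apply \<nu> (lie_bracket G M \<xi>\<^sub>1 \<xi>\<^sub>2) + blinfun_apply \<rho>\<^sub>2 \<xi>\<^sub>1 - blinfun_apply \<rho>\<^sub>1 \<xi>\<^sub>2)"

definition Omega_Y ::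
  "('g, 'x) monoid_scheme \<Rightarrow> ('g, 'a::euclidean_space) mfd \<Rightarrow> ('a \<Rightarrow> 'a \<Rightarrow> real) \<Rightarrow> 'a dual \<Rightarrow>
     'g \<times> 'a dual \<times> 'a dual \<Rightarrow> 'a \<times> 'a dual \<times> 'a dual \<Rightarrow> 'a \<times> 'a dual \<times> 'a dual \<Rightarrow> real" where
  "Omega_Y G M ip \<mu> = (\<lambda>(g, \<nu>, \<rho>) (v\<^sub>1, \<nu>\<^sub>1, \<rho>\<^sub>1) (v\<^sub>2, \<nu>\<^sub>2, \<rho>\<^sub>2).
     let \<xi>\<^sub>1 = left_triv G M g v\<^sub>1; \<xi>\<^sub>2 = left_triv G M g v\<^sub>2;
         \<zeta>\<^sub>1 = orbit_tangent_rep G M ip \<mu> \<rho>\<^sub>1; \<zeta>\<^sub>2 = orbit_tangent_rep G M ip \<mu> \<rho>\<^sub>2 in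
     blinfun_apply (\<mu> + \<nu>) (lie_bracket G M \<xi>\<^sub>1 \<xi>\<^sub>2)
     + blinfun_apply \<nu>\<^sub>2 (isotropy_component G M ip \<mu> \<xi>\<^sub>1)
     - blinfun_apply \<nu>\<^sub>1 (isotropy_component G M ip \<mu> \<xi>\<^sub>2)
     - blinfun_apply \<mu> (lie_bracket G M \<zeta>\<^sub>1 \<zeta>\<^sub>2))"

definition left_triv_deriv ::
  "('g, 'x) monoid_scheme \<Rightarrow> ('g, 'a::euclidean_space) mfd \<Rightarrow> ('u, 'e::real_normed_vector) mfd \<Rightarrow>
     ('u \<Rightarrow> 'g) \<Rightarrow> 'u \<Rightarrow> 'e \<Rightarrow> 'a" where
  "left_triv_deriv G M P F u w = left_triv G M (F u) (tangent_map P M F u w)"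

end

(*
  Left translation by the group turns Phi into a pair (g a(u), b(u)) with u = (nu, eta).  Put
  F = a^-1, c = Ad*_F b and alpha = F^-1 DF.  The left-trivialised derivative of Phi is then
  (Ad_F (xi - alpha), Db), and since the derivative of Ad_F zeta is Ad_F [alpha, zeta], the pullback
  of the canonical form is
    <c, [xi_1, xi_2]> - <c, [alpha_1, alpha_2]> + <Dc_2, xi_1 - alpha_1> - <Dc_1, xi_2 - alpha_2>.
  Comparing with Omega_Y on a vector tangent to the group and a vector tangent to U gives Dc = nu-dot,
  hence c = mu + nu by connectedness of U; the vectors tangent to U give the equation for F.
*)
theory Submission
  imports Defs
begin

text \<open>Two vectors tangent to the group would only give
  \<open><c, [xi_1, xi_2]> = <mu + nu, [xi_1, xi_2]>\<close>, which fixes c on the derived algebra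
  alone. Pairing a group vector with a parameter vector reaches every xi, but yields only the
  derivative of c; the missing constant is the value mu of c at (0,0). Moving the momentum back by F
  is what makes the form collapse: the bracket hidden in Dc absorbs all mixed brackets of xi and
  alpha. Once c = mu + nu, every term containing xi cancels against Omega_Y and the defect of the
  equation for F is left, so one computation serves both implications.

  The obstacle that shapes the proof is that the bracket is defined through left-invariant fields in
  a chart. The derivative of Ad therefore has to be extracted from second derivatives of the
  multiplication, which calls for their symmetry and for a chain rule of every order. Moreover
  derivatives are relative to subspaces and determined only in directions from the subspace, and
  coordinate expressions are meaningful only close to the point concerned.\<close>

section \<open>Derivatives relative to a linear subspace\<close>

lemma frechet_derivative_within_eq:
  assumes f: "(f has_derivative D) (at x within W)" and W: "subspace W" "x \<in> W" "v \<in> W"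
  shows "frechet_derivative f (at x within W) v = D v"
proof -
  \<comment> \<open>This line stays in W, so restricting to it turns a derivative relative to W into
    an ordinary derivative of one real variable, and that one is unique.\<close>
  let ?\<gamma> = "\<lambda>t::real. x + t *\<^sub>R v"
  have \<gamma>: "(?\<gamma> has_derivative (\<lambda>t. t *\<^sub>R v)) (at 0)"
    by (auto intro!: derivative_eq_intros)
  have sub: "range ?\<gamma> \<subseteq> W"
    using W by (auto intro: subspace_add subspace_scale)
  have *: "((f \<circ> ?\<gamma>) has_derivative (E \<circ> (\<lambda>t. t *\<^sub>R v))) (at 0)"
    if "(f has_derivative E) (at x within W)" for E
    by (rule diff_chain_within) (use \<gamma> that has_derivative_subset[OF _ sub] in auto)
  let ?E = "frechet_derivative f (at x within W)"
  have "(f has_derivative ?E) (at x within W)"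
    using f frechet_derivative_works differentiable_def by blast
  from has_derivative_unique[OF *[OF this] *[OF f]]
  have "(?E \<circ> (\<lambda>t. t *\<^sub>R v)) 1 = (D \<circ> (\<lambda>t. t *\<^sub>R v)) 1" by simp
  then show ?thesis by simp
qed

lemma has_derivative_within_cong:
  assumes "openin (top_of_set W) S" "x \<in> S" "\<And>y. y \<in> S \<Longrightarrow> f y = g y"
    and "(f has_derivative D) (at x within W)"
  shows "(g has_derivative D) (at x within W)"
proof -
  obtain d where "d > 0" "\<And>y. y \<in> W \<Longrightarrow> dist y x < d \<Longrightarrow> y \<in> S"
    using assms(1,2) unfolding openin_euclidean_subtopology_iff by blast
  with assms show ?thesis
    by (intro has_derivative_transform_within[of f D x W d g])
       (auto simp: openin_euclidean_subtopology_iff)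
qed

lemma has_derivative_within_cong_iff:
  assumes "openin (top_of_set W) S" "x \<in> S" "\<And>y. y \<in> S \<Longrightarrow> f y = g y"
  shows "(f has_derivative D) (at x within W) \<longleftrightarrow> (g has_derivative D) (at x within W)"
proof
  show "(g has_derivative D) (at x within W)" if "(f has_derivative D) (at x within W)"
    using has_derivative_within_cong[of W S x f g D] assms that by simp
  show "(f has_derivative D) (at x within W)" if "(g has_derivative D) (at x within W)"
    using has_derivative_within_cong[of W S x g f D] assms that by simp
qed

lemma frechet_derivative_within_cong:
  assumes "openin (top_of_set W) S" "x \<in> S" "\<And>y. y \<in> S \<Longrightarrow> f y = g y"
  shows "frechet_derivative f (at x within W) = frechet_derivative g (at x within W)"
  unfolding frechet_derivative_def using has_derivative_within_cong_iff[OF assms] by simp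

lemma has_derivative_within_open_subset:
  assumes "openin (top_of_set W) S" "x \<in> S" "(f has_derivative D) (at x within S)"
  shows "(f has_derivative D) (at x within W)"
proof -
  obtain T where T: "open T" "S = W \<inter> T" using assms(1) by (auto simp: openin_open)
  then have "at x within S = at x within W"
    using assms(2) by (intro at_within_nhd[of _ T]) auto
  with assms(3) show ?thesis by simp
qed

text \<open>Only a relatively open set around x has to land in W'. Coordinate expressions offer no
  more than that, since \<open>inv_into\<close> takes unspecified values outside the image of a
  chart.\<close>

lemma has_derivative_within_chain:
  assumes f: "(f has_derivative D) (at x within W)" and g: "(g has_derivative E) (at (f x) within W')"
    and S: "openin (top_of_set W) S" "x \<in> S" "f ` S \<subseteq> W'"
  shows "((\<lambda>y. g (f y)) has_derivative (\<lambda>v. E (D v))) (at x within W)"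
proof -
  have "S \<subseteq> W" using S(1) openin_imp_subset by blast
  then have "((g \<circ> f) has_derivative (E \<circ> D)) (at x within S)"
    using f g S(3) by (intro diff_chain_within) (auto intro: has_derivative_subset)
  from has_derivative_within_open_subset[OF S(1,2) this] show ?thesis by (simp add: o_def)
qed

text \<open>The difference quotient evaluates the derivative only at y - x, which lies in W; off W
  the derivative may be exchanged for any bounded linear map with the same restriction.\<close>

lemma has_derivative_within_cong_derivative:
  assumes "(f has_derivative D) (at x within W)" "bounded_linear E"
    and "subspace W" "x \<in> W" "\<And>v. v \<in> W \<Longrightarrow> D v = E v"
  shows "(f has_derivative E) (at x within W)"
proof -
  have "((\<lambda>y. (1 / norm (y - x)) *\<^sub>R (f y - (f x + D (y - x)))) \<longlongrightarrow> 0) (at x within W)"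
    using assms(1) by (simp add: has_derivative_within)
  moreover have "\<forall>\<^sub>F y in at x within W.
      (1 / norm (y - x)) *\<^sub>R (f y - (f x + D (y - x))) = (1 / norm (y - x)) *\<^sub>R (f y - (f x + E (y - x)))"
    unfolding eventually_at_filter using assms(3-5)
    by (intro always_eventually) (simp add: subspace_diff)
  ultimately have "((\<lambda>y. (1 / norm (y - x)) *\<^sub>R (f y - (f x + E (y - x)))) \<longlongrightarrow> 0) (at x within W)"
    by (rule Lim_transform_eventually)
  with assms(2) show ?thesis by (simp add: has_derivative_within)
qed

text \<open>A small ball intersected with W is convex and lies in U, so f is constant on it;
  connectedness of U passes from locally constant to constant. The derivative is known to vanish on
  W only and is replaced by the zero map beforehand.\<close>

lemma zero_derivative_within_imp_constant:
  fixes f :: "'e::real_normed_vector \<Rightarrow> 'f::real_normed_vector"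
  assumes W: "subspace W" and U: "openin (top_of_set W) U" "connected U"
    and f: "\<And>x. x \<in> U \<Longrightarrow> (f has_derivative D x) (at x within W)"
    and D: "\<And>x v. x \<in> U \<Longrightarrow> v \<in> W \<Longrightarrow> D x v = 0"
    and xy: "x \<in> U" "y \<in> U"
  shows "f x = f y"
proof (rule connected_local_const[where f=f, OF U(2) xy], rule ballI)
  fix a assume a: "a \<in> U"
  obtain d where d: "d > 0" "\<And>y. y \<in> W \<Longrightarrow> dist y a < d \<Longrightarrow> y \<in> U" and "U \<subseteq> W"
    using U(1) a unfolding openin_euclidean_subtopology_iff by blast
  let ?C = "W \<inter> ball a d"
  have CU: "?C \<subseteq> U" using d by (auto simp: dist_commute)
  have cv: "convex ?C" using W by (intro convex_Int subspace_imp_convex convex_ball)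
  have "(f has_derivative (\<lambda>_. 0)) (at z within ?C)" if "z \<in> ?C" for z
  proof -
    have "z \<in> U" using CU that by auto
    then have "(f has_derivative (\<lambda>_. 0)) (at z within W)"
      using that by (intro has_derivative_within_cong_derivative[OF f _ W]) (simp_all add: D)
    then show ?thesis by (rule has_derivative_subset) auto
  qed
  from has_derivative_zero_constant[OF cv this]
  obtain c where "\<And>z. z \<in> ?C \<Longrightarrow> f z = c" by blast
  moreover have "a \<in> ?C" using a \<open>U \<subseteq> W\<close> d(1) by auto
  ultimately have "\<And>z. z \<in> U \<Longrightarrow> dist z a < d \<Longrightarrow> f a = f z"
    using \<open>U \<subseteq> W\<close> by (auto simp: dist_commute subset_iff)
  with d(1) show "\<forall>\<^sub>F b in at a within U. f a = f b"
    unfolding eventually_at by blast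
qed

subsection \<open>Symmetry of second derivatives\<close>

text \<open>The mean value theorem is applied to the difference along w as a function of the
  v-coordinate, and again along w. Both steps have the same length s, so exchanging v and w leaves
  the second difference unchanged.\<close>

lemma second_difference_mean_value:
  fixes f :: "'e::real_normed_vector \<Rightarrow> real"
  assumes f: "\<And>y. y \<in> S \<Longrightarrow> (f has_derivative f' y) (at y)"
    and v: "\<And>y. y \<in> S \<Longrightarrow> ((\<lambda>y. f' y v) has_derivative Dv y) (at y)"
    and s: "s > 0" "\<And>\<sigma> \<tau>. \<sigma> \<in> {0..s} \<Longrightarrow> \<tau> \<in> {0..s} \<Longrightarrow> x + \<sigma> *\<^sub>R v + \<tau> *\<^sub>R w \<in> S"
  obtains \<sigma> \<tau> where "\<sigma> \<in> {0..s}" "\<tau> \<in> {0..s}"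
    "f (x + s *\<^sub>R v + s *\<^sub>R w) - f (x + s *\<^sub>R v) - f (x + s *\<^sub>R w) + f x
      = s * s * Dv (x + \<sigma> *\<^sub>R v + \<tau> *\<^sub>R w) w"
proof -
  have lin: "Dv y (t *\<^sub>R z) = t * Dv y z" if "y \<in> S" for y t z
    using v[OF that] by (simp add: bounded_linear.linear has_derivative_bounded_linear linear_cmul)
  have lin': "f' y (t *\<^sub>R z) = t * f' y z" if "y \<in> S" for y t z
    using f[OF that] by (simp add: bounded_linear.linear has_derivative_bounded_linear linear_cmul)
  let ?g = "\<lambda>\<sigma>. f (x + \<sigma> *\<^sub>R v + s *\<^sub>R w) - f (x + \<sigma> *\<^sub>R v)"
  let ?g' = "\<lambda>\<sigma>. f' (x + \<sigma> *\<^sub>R v + s *\<^sub>R w) v - f' (x + \<sigma> *\<^sub>R v) v"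
  have inS: "x + \<sigma> *\<^sub>R v \<in> S" "x + \<sigma> *\<^sub>R v + s *\<^sub>R w \<in> S" if "\<sigma> \<in> {0..s}" for \<sigma>
    using s(2)[of \<sigma> 0] s(2)[of \<sigma> s] that s(1) by auto
  have g: "(?g has_derivative (\<lambda>t. t * ?g' \<sigma>)) (at \<sigma> within {0..s})" if "\<sigma> \<in> {0..s}" for \<sigma>
  proof -
    have "((\<lambda>\<sigma>. f (x + \<sigma> *\<^sub>R v + s *\<^sub>R w)) has_derivative (\<lambda>t. f' (x + \<sigma> *\<^sub>R v + s *\<^sub>R w) (t *\<^sub>R v))) (at \<sigma> within {0..s})"
      by (rule has_derivative_compose[OF _ f]) (use inS that in \<open>auto intro!: derivative_eq_intros\<close>)
    moreover have "((\<lambda>\<sigma>. f (x + \<sigma> *\<^sub>R v)) has_derivative (\<lambda>t. f' (x + \<sigma> *\<^sub>R v) (t *\<^sub>R v))) (at \<sigma> within {0..s})"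
      by (rule has_derivative_compose[OF _ f]) (use inS that in \<open>auto intro!: derivative_eq_intros\<close>)
    ultimately show ?thesis
      using has_derivative_diff inS[OF that] by (fastforce simp: lin' algebra_simps)
  qed
  obtain \<sigma> where \<sigma>: "\<sigma> \<in> {0<..<s}" "?g s - ?g 0 = s * ?g' \<sigma>"
    using mvt_simple[of 0 s ?g "\<lambda>\<sigma> t. t * ?g' \<sigma>"] s(1) g by auto
  let ?h = "\<lambda>\<tau>. f' (x + \<sigma> *\<^sub>R v + \<tau> *\<^sub>R w) v"
  have "(?h has_derivative (\<lambda>t. t * Dv (x + \<sigma> *\<^sub>R v + \<tau> *\<^sub>R w) w)) (at \<tau> within {0..s})" if "\<tau> \<in> {0..s}" for \<tau>
  proof -
    have "(?h has_derivative (\<lambda>t. Dv (x + \<sigma> *\<^sub>R v + \<tau> *\<^sub>R w) (t *\<^sub>R w))) (at \<tau> within {0..s})"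
      by (rule has_derivative_compose[OF _ v]) (use s \<sigma> that in \<open>auto intro!: derivative_eq_intros\<close>)
    then show ?thesis using s(2)[of \<sigma> \<tau>] \<sigma> that by (simp add: lin)
  qed
  then obtain \<tau> where "\<tau> \<in> {0<..<s}" "?h s - ?h 0 = s * Dv (x + \<sigma> *\<^sub>R v + \<tau> *\<^sub>R w) w"
    using mvt_simple[of 0 s ?h "\<lambda>\<tau> t. t * Dv (x + \<sigma> *\<^sub>R v + \<tau> *\<^sub>R w) w"] s(1) by auto
  with \<sigma> show thesis by (intro that[of \<sigma> \<tau>]) auto
qed

text \<open>Schwarz's argument: the second difference over a small parallelogram equals
  \<open>s * s\<close> times either mixed derivative at some point of it, and both are continuous at
  x. Continuity is asked for in the two fixed directions only, which is the form that
  \<open>k_smooth_on\<close> delivers.\<close>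

lemma symmetric_second_derivative_real:
  fixes f :: "'e::real_normed_vector \<Rightarrow> real"
  assumes S: "open S" "x \<in> S"
    and f: "\<And>y. y \<in> S \<Longrightarrow> (f has_derivative f' y) (at y)"
    and v: "\<And>y. y \<in> S \<Longrightarrow> ((\<lambda>y. f' y v) has_derivative Dv y) (at y)"
    and w: "\<And>y. y \<in> S \<Longrightarrow> ((\<lambda>y. f' y w) has_derivative Dw y) (at y)"
    and cont: "isCont (\<lambda>y. Dv y w) x" "isCont (\<lambda>y. Dw y v) x"
  shows "Dv x w = Dw x v"
proof (rule ccontr)
  assume "Dv x w \<noteq> Dw x v"
  then have e: "\<bar>Dv x w - Dw x v\<bar> / 2 > 0" (is "?e > 0") by simp
  obtain d0 where d0: "d0 > 0" "ball x d0 \<subseteq> S" using S openE by blast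
  obtain d1 where d1: "d1 > 0" "\<And>y. dist y x < d1 \<Longrightarrow> dist (Dv y w) (Dv x w) < ?e"
    using cont(1) e unfolding continuous_at_eps_delta dist_norm by blast
  obtain d2 where d2: "d2 > 0" "\<And>y. dist y x < d2 \<Longrightarrow> dist (Dw y v) (Dw x v) < ?e"
    using cont(2) e unfolding continuous_at_eps_delta dist_norm by blast
  define d where "d = min d0 (min d1 d2)"
  have d: "d > 0" using d0 d1 d2 by (simp add: d_def)
  \<comment> \<open>The whole parallelogram then has points within d / 2 of x; the summand 1 keeps
    the denominator positive when v and w vanish.\<close>
  define s where "s = d / (2 * (norm v + norm w + 1))"
  have nn: "0 < norm v + norm w + 1" by (simp add: add_nonneg_pos)
  have s: "s > 0" using d nn by (simp add: s_def)
  have near: "dist (x + \<sigma> *\<^sub>R v + \<tau> *\<^sub>R w) x < d" if "\<sigma> \<in> {0..s}" "\<tau> \<in> {0..s}" for \<sigma> \<tau>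
  proof -
    have "dist (x + \<sigma> *\<^sub>R v + \<tau> *\<^sub>R w) x = norm (\<sigma> *\<^sub>R v + \<tau> *\<^sub>R w)"
      by (simp add: dist_norm add.assoc)
    also have "\<dots> \<le> \<sigma> * norm v + \<tau> * norm w"
      using norm_triangle_ineq[of "\<sigma> *\<^sub>R v" "\<tau> *\<^sub>R w"] that by simp
    also have "\<dots> \<le> s * norm v + s * norm w"
      using that by (intro add_mono mult_right_mono) auto
    also have "\<dots> \<le> s * (norm v + norm w + 1)" using s by (simp add: algebra_simps)
    also have "\<dots> = d / 2" using nn by (simp add: s_def field_simps)
    also have "\<dots> < d" using d by simp
    finally show ?thesis .
  qed
  have inS: "x + \<sigma> *\<^sub>R v + \<tau> *\<^sub>R w \<in> S" if "\<sigma> \<in> {0..s}" "\<tau> \<in> {0..s}" for \<sigma> \<tau>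
    using near[OF that] d0 by (auto simp: d_def subset_iff dist_commute)
  obtain \<sigma> \<tau> where 1: "\<sigma> \<in> {0..s}" "\<tau> \<in> {0..s}"
    "f (x + s *\<^sub>R v + s *\<^sub>R w) - f (x + s *\<^sub>R v) - f (x + s *\<^sub>R w) + f x
      = s * s * Dv (x + \<sigma> *\<^sub>R v + \<tau> *\<^sub>R w) w"
    using second_difference_mean_value[of S f f' v Dv s x w] f v s inS by blast
  have inS': "x + \<sigma> *\<^sub>R w + \<tau> *\<^sub>R v \<in> S" if "\<sigma> \<in> {0..s}" "\<tau> \<in> {0..s}" for \<sigma> \<tau>
    using inS[OF that(2,1)] by (simp add: algebra_simps)
  obtain \<sigma>' \<tau>' where 2: "\<sigma>' \<in> {0..s}" "\<tau>' \<in> {0..s}"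
    "f (x + s *\<^sub>R w + s *\<^sub>R v) - f (x + s *\<^sub>R w) - f (x + s *\<^sub>R v) + f x
      = s * s * Dw (x + \<sigma>' *\<^sub>R w + \<tau>' *\<^sub>R v) v"
    using second_difference_mean_value[of S f f' w Dw s x v] f w s inS' by blast
  have "s * s * Dv (x + \<sigma> *\<^sub>R v + \<tau> *\<^sub>R w) w = s * s * Dw (x + \<tau>' *\<^sub>R v + \<sigma>' *\<^sub>R w) v"
    using 1(3) 2(3) by (simp add: algebra_simps)
  then have "Dv (x + \<sigma> *\<^sub>R v + \<tau> *\<^sub>R w) w = Dw (x + \<tau>' *\<^sub>R v + \<sigma>' *\<^sub>R w) v"
    using s by simp
  moreover have "dist (Dv (x + \<sigma> *\<^sub>R v + \<tau> *\<^sub>R w) w) (Dv x w) < ?e"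
    using near[OF 1(1,2)] by (intro d1(2)) (auto simp: d_def)
  moreover have "dist (Dw (x + \<tau>' *\<^sub>R v + \<sigma>' *\<^sub>R w) v) (Dw x v) < ?e"
    using near[OF 2(2,1)] by (intro d2(2)) (auto simp: d_def)
  ultimately show False unfolding dist_real_def by (smt (verit) field_sum_of_halves)
qed

lemma symmetric_second_derivative:
  fixes f :: "'e::real_normed_vector \<Rightarrow> 'f::euclidean_space"
  assumes S: "open S" "x \<in> S"
    and f: "\<And>y. y \<in> S \<Longrightarrow> (f has_derivative f' y) (at y)"
    and v: "\<And>y. y \<in> S \<Longrightarrow> ((\<lambda>y. f' y v) has_derivative Dv y) (at y)"
    and w: "\<And>y. y \<in> S \<Longrightarrow> ((\<lambda>y. f' y w) has_derivative Dw y) (at y)"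
    and cont: "isCont (\<lambda>y. Dv y w) x" "isCont (\<lambda>y. Dw y v) x"
  shows "Dv x w = Dw x v"
proof (rule euclidean_eqI)
  fix b :: 'f assume "b \<in> Basis"
  show "Dv x w \<bullet> b = Dw x v \<bullet> b"
    by (rule symmetric_second_derivative_real[OF S, of "\<lambda>y. f y \<bullet> b" "\<lambda>y z. f' y z \<bullet> b" v "\<lambda>y z. Dv y z \<bullet> b" w "\<lambda>y z. Dw y z \<bullet> b"])
       (use f v w cont in \<open>auto intro!: has_derivative_inner_left continuous_intros\<close>)
qed

subsection \<open>Smooth functions on relatively open sets\<close>

lemma k_smooth_on_cong:
  assumes S: "openin (top_of_set W) S"
    and fg: "\<And>y. y \<in> S \<Longrightarrow> f y = g y" and f: "k_smooth_on k W S f"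
  shows "k_smooth_on k W S g"
  using fg f
proof (induction k arbitrary: f g)
  case 0
  then show ?case using continuous_on_cong[of S S f g] by simp
next
  case (Suc k)
  have "g differentiable (at x within W)" if "x \<in> S" for x
    using Suc.prems(2) that has_derivative_within_cong_iff[OF S that, of f g] Suc.prems(1)
    unfolding differentiable_def k_smooth_on.simps by blast
  moreover have "k_smooth_on k W S (\<lambda>x. frechet_derivative g (at x within W) v)" if v: "v \<in> W" for v
  proof (rule Suc.IH)
    show "k_smooth_on k W S (\<lambda>x. frechet_derivative f (at x within W) v)"
      using Suc.prems(2) v by simp
  qed (simp add: frechet_derivative_within_cong[OF S _ Suc.prems(1)])
  ultimately show ?case by simp
qed

text \<open>The recursion refers to \<open>frechet_derivative\<close>, a choice among possibly many
  derivatives relative to W. A derivative D found by the rules of calculus agrees with it in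
  directions from W, the only ones the recursion visits.\<close>

lemma k_smooth_on_SucI:
  assumes W: "subspace W" and S: "openin (top_of_set W) S"
    and D: "\<And>x. x \<in> S \<Longrightarrow> (f has_derivative D x) (at x within W)"
    and k: "\<And>v. v \<in> W \<Longrightarrow> k_smooth_on k W S (\<lambda>x. D x v)"
  shows "k_smooth_on (Suc k) W S f"
proof -
  have SW: "S \<subseteq> W" using S openin_imp_subset by blast
  have "k_smooth_on k W S (\<lambda>x. frechet_derivative f (at x within W) v)" if v: "v \<in> W" for v
  proof (rule k_smooth_on_cong[OF S _ k[OF v]])
    fix x assume x: "x \<in> S"
    show "D x v = frechet_derivative f (at x within W) v"
      using frechet_derivative_within_eq[OF D[OF x] W _ v] x SW by auto
  qed
  moreover have "\<forall>x\<in>S. f differentiable (at x within W)"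
    using D differentiable_def by blast
  ultimately show ?thesis by simp
qed

lemma k_smooth_on_SucD:
  assumes "k_smooth_on (Suc k) W S f" "x \<in> S"
  shows "(f has_derivative frechet_derivative f (at x within W)) (at x within W)"
  using assms frechet_derivative_works by auto

text \<open>Derivatives are taken relative to W and not to S, so T may be any subset.\<close>

lemma k_smooth_on_subset:
  "k_smooth_on k W S f \<Longrightarrow> T \<subseteq> S \<Longrightarrow> k_smooth_on k W T f"
proof (induction k arbitrary: f)
  case 0
  then show ?case using continuous_on_subset by auto
next
  case (Suc k)
  have "k_smooth_on k W T (\<lambda>x. frechet_derivative f (at x within W) v)" if "v \<in> W" for v
    using Suc.prems that by (intro Suc.IH) auto
  with Suc.prems show ?case by auto
qed

lemma k_smooth_on_Suc_imp:
  assumes "S \<subseteq> W" "k_smooth_on (Suc k) W S f"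
  shows "k_smooth_on k W S f"
  using assms(2)
proof (induction k arbitrary: f)
  case 0
  have "continuous (at x within S) f" if "x \<in> S" for x
    using k_smooth_on_SucD[OF 0 that] has_derivative_continuous continuous_within_subset assms(1)
    by blast
  then show ?case by (simp add: continuous_on_eq_continuous_within)
next
  case (Suc k)
  have "k_smooth_on k W S (\<lambda>x. frechet_derivative f (at x within W) v)" if "v \<in> W" for v
    using Suc.prems[unfolded k_smooth_on.simps(2)[of "Suc k"]] that by (intro Suc.IH) blast
  with Suc.prems show ?case by simp
qed

text \<open>Needed for compositions of maps between manifolds, where the chart of the middle space
  has to be chosen anew around each point.\<close>

lemma k_smooth_on_local:
  assumes S: "S \<subseteq> W"
    and loc: "\<And>x. x \<in> S \<Longrightarrow> \<exists>T. openin (top_of_set W) T \<and> x \<in> T \<and> k_smooth_on k W T f"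
  shows "k_smooth_on k W S f"
  using loc
proof (induction k arbitrary: f)
  case 0
  have "continuous (at x within S) f" if x: "x \<in> S" for x
  proof -
    obtain T where T: "openin (top_of_set W) T" "x \<in> T" "continuous_on T f"
      using "0.prems"[OF x] by auto
    obtain T' where T': "open T'" "T = W \<inter> T'" using T(1) by (auto simp: openin_open)
    have "continuous (at x within T) f" using T by (simp add: continuous_on_eq_continuous_within)
    moreover have "at x within T = at x within W"
      using T' T(2) by (intro at_within_nhd[of _ T']) auto
    ultimately show ?thesis using S continuous_within_subset by fastforce
  qed
  then show ?case by (simp add: continuous_on_eq_continuous_within)
next
  case (Suc k)
  have "k_smooth_on k W S (\<lambda>x. frechet_derivative f (at x within W) v)" if "v \<in> W" for v
    using Suc.prems that by (intro Suc.IH) fastforce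
  moreover have "f differentiable (at x within W)" if "x \<in> S" for x
    using Suc.prems[OF that] by auto
  ultimately show ?case by simp
qed

lemma k_smooth_on_const: 
  assumes "subspace W" "openin (top_of_set W) S"
  shows "k_smooth_on k W S (\<lambda>x. c)"
proof (induction k arbitrary: c)
  case (Suc k)
  then show ?case by (intro k_smooth_on_SucI[OF assms, of _ "\<lambda>x v. 0"]) auto
qed simp

lemma k_smooth_on_bounded_linear:
  assumes "subspace W" "openin (top_of_set W) S" "bounded_linear L" "k_smooth_on k W S f"
  shows "k_smooth_on k W S (\<lambda>x. L (f x))"
  using assms(4)
proof (induction k arbitrary: f)
  case 0
  then show ?case using bounded_linear.continuous_on[OF assms(3)] by auto
next
  case (Suc k)
  show ?case
  proof (intro k_smooth_on_SucI[OF assms(1,2)])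
    show "((\<lambda>x. L (f x)) has_derivative (\<lambda>v. L (frechet_derivative f (at x within W) v))) (at x within W)"
      if "x \<in> S" for x
      using k_smooth_on_SucD[OF Suc.prems that] bounded_linear.has_derivative[OF assms(3)] by auto
  qed (use Suc in auto)
qed

lemma k_smooth_on_Pair:
  assumes "subspace W" "openin (top_of_set W) S" "k_smooth_on k W S f" "k_smooth_on k W S g"
  shows "k_smooth_on k W S (\<lambda>x. (f x, g x))"
  using assms(3,4)
proof (induction k arbitrary: f g)
  case 0
  then show ?case by (auto intro: continuous_on_Pair)
next
  case (Suc k)
  show ?case
  proof (intro k_smooth_on_SucI[OF assms(1,2)])
    show "((\<lambda>x. (f x, g x)) has_derivative (\<lambda>v. (frechet_derivative f (at x within W) v, frechet_derivative g (at x within W) v))) (at x within W)"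
      if "x \<in> S" for x
      using k_smooth_on_SucD[OF Suc.prems(1) that] k_smooth_on_SucD[OF Suc.prems(2) that]
      by (rule has_derivative_Pair)
  qed (use Suc in auto)
qed

lemma k_smooth_on_add:
  assumes "subspace W" "openin (top_of_set W) S" "k_smooth_on k W S f" "k_smooth_on k W S g"
  shows "k_smooth_on k W S (\<lambda>x. f x + g x)"
  using assms(3,4)
proof (induction k arbitrary: f g)
  case 0
  then show ?case by (auto intro: continuous_on_add)
next
  case (Suc k)
  show ?case
  proof (intro k_smooth_on_SucI[OF assms(1,2)])
    show "((\<lambda>x. f x + g x) has_derivative (\<lambda>v. frechet_derivative f (at x within W) v + frechet_derivative g (at x within W) v)) (at x within W)"
      if "x \<in> S" for x
      using k_smooth_on_SucD[OF Suc.prems(1) that] k_smooth_on_SucD[OF Suc.prems(2) that]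
      by (rule has_derivative_add)
  qed (use Suc in auto)
qed

lemma k_smooth_on_sum:
  assumes "subspace W" "openin (top_of_set W) S" "\<And>i. i \<in> I \<Longrightarrow> k_smooth_on k W S (f i)"
  shows "k_smooth_on k W S (\<lambda>x. \<Sum>i\<in>I. f i x)"
  using assms(3)
proof (induction I rule: infinite_finite_induct)
  case (insert i I)
  then have "k_smooth_on k W S (\<lambda>x. f i x + (\<Sum>i\<in>I. f i x))"
    by (intro k_smooth_on_add assms(1,2)) auto
  with insert show ?case by simp
qed (simp_all add: k_smooth_on_const assms(1,2))

lemma k_smooth_on_scaleR:
  assumes "subspace W" "openin (top_of_set W) S" "k_smooth_on k W S f" "k_smooth_on k W S g"
  shows "k_smooth_on k W S (\<lambda>x. f x *\<^sub>R g x)"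
  using assms(3,4)
proof (induction k arbitrary: f g)
  case 0
  then show ?case by (auto intro: continuous_on_scaleR)
next
  case (Suc k)
  have SW: "S \<subseteq> W" using assms(2) openin_imp_subset by blast
  show ?case
  proof (intro k_smooth_on_SucI[OF assms(1,2)])
    show "((\<lambda>x. f x *\<^sub>R g x) has_derivative (\<lambda>v. f x *\<^sub>R frechet_derivative g (at x within W) v
        + frechet_derivative f (at x within W) v *\<^sub>R g x)) (at x within W)"
      if "x \<in> S" for x
      using k_smooth_on_SucD[OF Suc.prems(1) that] k_smooth_on_SucD[OF Suc.prems(2) that]
      by (rule has_derivative_scaleR)
    show "k_smooth_on k W S (\<lambda>x. f x *\<^sub>R frechet_derivative g (at x within W) v
        + frechet_derivative f (at x within W) v *\<^sub>R g x)" if "v \<in> W" for v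
      using Suc.prems that k_smooth_on_Suc_imp[OF SW Suc.prems(1)] k_smooth_on_Suc_imp[OF SW Suc.prems(2)]
      by (intro k_smooth_on_add Suc.IH assms(1,2)) auto
  qed
qed

text \<open>The derivative of an affine map is constant, so differentiating in direction v only
  calls for the derivative of g in the fixed direction L v. The induction thus closes for arbitrary
  normed spaces and subspaces W'.\<close>

lemma k_smooth_on_compose_affine:
  assumes W: "subspace W" "openin (top_of_set W) S"
    and L: "bounded_linear L" "\<And>v. v \<in> W \<Longrightarrow> L v \<in> W'"
    and S: "\<And>x. x \<in> S \<Longrightarrow> c + L x \<in> T" and T: "T \<subseteq> W'" and W': "subspace W'"
    and g: "k_smooth_on k W' T g"
  shows "k_smooth_on k W S (\<lambda>x. g (c + L x))"
  using g
proof (induction k arbitrary: g)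
  case 0
  have "continuous_on S (\<lambda>x. c + L x)"
    using L(1) by (intro continuous_intros linear_continuous_on)
  with 0 S show ?case by (auto intro: continuous_on_compose2)
next
  case (Suc k)
  show ?case
  proof (intro k_smooth_on_SucI[OF W])
    show "((\<lambda>x. g (c + L x)) has_derivative (\<lambda>v. frechet_derivative g (at (c + L x) within W') (L v))) (at x within W)"
      if x: "x \<in> S" for x
    proof (rule has_derivative_within_chain[of "\<lambda>x. c + L x", OF _ _ W(2) x])
      show "((\<lambda>x. c + L x) has_derivative L) (at x within W)"
        using bounded_linear.has_derivative[OF L(1) has_derivative_ident]
        by (auto intro!: derivative_eq_intros)
      show "(\<lambda>x. c + L x) ` S \<subseteq> W'" using S T by auto
    qed (use k_smooth_on_SucD[OF Suc.prems] S x in auto)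
    show "k_smooth_on k W S (\<lambda>x. frechet_derivative g (at (c + L x) within W') (L v))" if "v \<in> W" for v
      using Suc.prems L(2)[OF that] by (intro Suc.IH) auto
  qed
qed

text \<open>Expanding the direction in a basis turns a derivative in a moving direction into a
  finite sum of products with derivatives in fixed directions, to which the rules for
  \<open>k_smooth_on\<close> apply.\<close>

lemma has_derivative_euclidean_sum:
  fixes q :: "'e::euclidean_space"
  assumes "(g has_derivative D) F"
  shows "D q = (\<Sum>b\<in>Basis. (q \<bullet> b) *\<^sub>R D b)"
proof -
  interpret bounded_linear D using assms by (rule has_derivative_bounded_linear)
  have "D (\<Sum>b\<in>Basis. (q \<bullet> b) *\<^sub>R b) = (\<Sum>b\<in>Basis. (q \<bullet> b) *\<^sub>R D b)"
    by (simp add: sum scale)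
  then show ?thesis by (simp add: euclidean_representation)
qed

text \<open>In the chain rule the derivative of g is taken in the direction of the derivative of f,
  which varies with x, whereas \<open>k_smooth_on\<close> controls fixed directions. Expansion in
  the basis of the middle space closes the induction.\<close>

lemma k_smooth_on_compose:
  fixes f :: "'e::real_normed_vector \<Rightarrow> 'f::euclidean_space"
  assumes W: "subspace W" "openin (top_of_set W) S"
    and f: "k_smooth_on k W S f" and g: "k_smooth_on k UNIV T g" and T: "f ` S \<subseteq> T"
  shows "k_smooth_on k W S (\<lambda>x. g (f x))"
  using f g T
proof (induction k arbitrary: f g)
  case 0
  then show ?case by (auto intro: continuous_on_compose2)
next
  case (Suc k)
  have SW: "S \<subseteq> W" using W(2) openin_imp_subset by blast
  let ?D = "\<lambda>x v. \<Sum>b\<in>Basis. (frechet_derivative f (at x within W) v \<bullet> b) *\<^sub>R frechet_derivative g (at (f x)) b"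
  show ?case
  proof (intro k_smooth_on_SucI[OF W])
    show "((\<lambda>x. g (f x)) has_derivative ?D x) (at x within W)" if x: "x \<in> S" for x
    proof -
      have g': "(g has_derivative frechet_derivative g (at (f x))) (at (f x))"
        using k_smooth_on_SucD[OF Suc.prems(2)] Suc.prems(3) x by auto
      then have "((\<lambda>x. g (f x)) has_derivative (\<lambda>v. frechet_derivative g (at (f x)) (frechet_derivative f (at x within W) v))) (at x within W)"
        by (intro has_derivative_within_chain[OF k_smooth_on_SucD[OF Suc.prems(1) x] _ W(2) x, of _ _ UNIV]) auto
      moreover have "(\<lambda>v. frechet_derivative g (at (f x)) (frechet_derivative f (at x within W) v)) = ?D x"
        by (rule ext) (rule has_derivative_euclidean_sum[OF g'])
      ultimately show ?thesis by simp
    qed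
    show "k_smooth_on k W S (\<lambda>x. ?D x v)" if v: "v \<in> W" for v
    proof (intro k_smooth_on_sum k_smooth_on_scaleR W)
      fix b :: 'f assume "b \<in> Basis"
      show "k_smooth_on k W S (\<lambda>x. frechet_derivative f (at x within W) v \<bullet> b)"
        using Suc.prems(1) v by (intro k_smooth_on_bounded_linear[OF W bounded_linear_inner_left]) auto
      show "k_smooth_on k W S (\<lambda>x. frechet_derivative g (at (f x)) b)"
        by (rule Suc.IH[OF k_smooth_on_Suc_imp[OF SW Suc.prems(1)] _ Suc.prems(3)]) (use Suc.prems(2) in simp)
    qed
  qed
qed

text \<open>A product rule for a first derivative whose base point h and direction q both move: one
  term from the direction, and one second derivative with the direction held at q x.\<close>

lemma has_derivative_frechet_derivative_apply:
  fixes f :: "'e::euclidean_space \<Rightarrow> 'f::real_normed_vector"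
  assumes S: "open S" "h x \<in> S" and f: "k_smooth_on (Suc (Suc 0)) UNIV S f"
    and h: "(h has_derivative H) (at x)" and q: "(q has_derivative Q) (at x)"
  shows "((\<lambda>y. frechet_derivative f (at (h y)) (q y)) has_derivative
    (\<lambda>v. frechet_derivative f (at (h x)) (Q v)
       + frechet_derivative (\<lambda>z. frechet_derivative f (at z) (q x)) (at (h x)) (H v))) (at x)"
proof -
  let ?f' = "\<lambda>z. frechet_derivative f (at z)"
  let ?f'' = "\<lambda>b. frechet_derivative (\<lambda>z. ?f' z b) (at (h x))"
  have 1: "(f has_derivative ?f' z) (at z)" if "z \<in> S" for z
    using k_smooth_on_SucD[OF f that] by simp
  have 2: "((\<lambda>z. ?f' z b) has_derivative ?f'' b) (at (h x))" for b
    using k_smooth_on_SucD[of 0 UNIV S "\<lambda>z. ?f' z b" "h x"] f S(2) by simp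
  obtain r where "r > 0" "ball (h x) r \<subseteq> S" using S openE by blast
  moreover have "isCont h x" using h has_derivative_continuous by blast
  ultimately obtain d where d: "d > 0" "\<And>y. dist y x < d \<Longrightarrow> h y \<in> S"
    unfolding continuous_at_eps_delta by (metis dist_commute dist_norm mem_ball subset_iff)
  have "((\<lambda>y. \<Sum>b\<in>Basis. (q y \<bullet> b) *\<^sub>R ?f' (h y) b) has_derivative
      (\<lambda>v. \<Sum>b\<in>Basis. (q x \<bullet> b) *\<^sub>R ?f'' b (H v) + (Q v \<bullet> b) *\<^sub>R ?f' (h x) b)) (at x)"
    by (intro has_derivative_sum has_derivative_scaleR has_derivative_inner_left q
        has_derivative_compose[OF h 2])
  then have A: "((\<lambda>y. ?f' (h y) (q y)) has_derivative
      (\<lambda>v. \<Sum>b\<in>Basis. (q x \<bullet> b) *\<^sub>R ?f'' b (H v) + (Q v \<bullet> b) *\<^sub>R ?f' (h x) b)) (at x)"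
    by (rule has_derivative_transform_within[OF _ d(1)])
       (auto intro!: has_derivative_euclidean_sum[OF 1, symmetric] d(2))
  \<comment> \<open>With the direction frozen at \<open>q x\<close>, the sum of the second
    derivatives over the basis folds back into a single derivative.\<close>
  have "((\<lambda>z. \<Sum>b\<in>Basis. (q x \<bullet> b) *\<^sub>R ?f' z b) has_derivative
      (\<lambda>w. \<Sum>b\<in>Basis. (q x \<bullet> b) *\<^sub>R ?f'' b w)) (at (h x))"
    by (intro has_derivative_sum has_derivative_scaleR_right 2)
  then have "((\<lambda>z. ?f' z (q x)) has_derivative (\<lambda>w. \<Sum>b\<in>Basis. (q x \<bullet> b) *\<^sub>R ?f'' b w)) (at (h x))"
    by (rule has_derivative_transform_within_open[OF _ S])
       (rule has_derivative_euclidean_sum[OF 1, symmetric])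
  then have "?f'' (q x) = (\<lambda>w. \<Sum>b\<in>Basis. (q x \<bullet> b) *\<^sub>R ?f'' b w)"
    by (rule frechet_derivative_at[symmetric])
  moreover have "?f' (h x) (Q v) = (\<Sum>b\<in>Basis. (Q v \<bullet> b) *\<^sub>R ?f' (h x) b)" for v
    using has_derivative_euclidean_sum[OF 1[OF S(2)]] .
  ultimately have "(\<lambda>v. ?f' (h x) (Q v) + ?f'' (q x) (H v)) =
      (\<lambda>v. \<Sum>b\<in>Basis. (q x \<bullet> b) *\<^sub>R ?f'' b (H v) + (Q v \<bullet> b) *\<^sub>R ?f' (h x) b)"
    by (simp only: sum.distrib add.commute)
  then show ?thesis using A by (simp only:)
qed

lemma k_smooth_on_symmetric:
  fixes f :: "'e::real_normed_vector \<Rightarrow> 'f::euclidean_space"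
  assumes S: "open S" "x \<in> S" and f: "k_smooth_on (Suc (Suc 0)) UNIV S f"
  shows "frechet_derivative (\<lambda>z. frechet_derivative f (at z) v) (at x) w
    = frechet_derivative (\<lambda>z. frechet_derivative f (at z) w) (at x) v"
proof (rule symmetric_second_derivative[OF S, of f "\<lambda>z. frechet_derivative f (at z)"])
  show "(f has_derivative frechet_derivative f (at y)) (at y)" if "y \<in> S" for y
    using k_smooth_on_SucD[OF f that] .
  show "((\<lambda>y. frechet_derivative f (at y) b) has_derivative
      frechet_derivative (\<lambda>z. frechet_derivative f (at z) b) (at y)) (at y)" if "y \<in> S" for b y
    using k_smooth_on_SucD[of 0 UNIV S "\<lambda>z. frechet_derivative f (at z) b" y] f that by simp
  then show "y \<in> S \<Longrightarrow> ((\<lambda>y. frechet_derivative f (at y) w) has_derivative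
      frechet_derivative (\<lambda>z. frechet_derivative f (at z) w) (at y)) (at y)" for y .
  have "isCont (\<lambda>y. frechet_derivative (\<lambda>z. frechet_derivative f (at z) b) (at y) c) x" for b c
    using f S by (auto simp: continuous_on_eq_continuous_at)
  then show "isCont (\<lambda>y. frechet_derivative (\<lambda>z. frechet_derivative f (at z) v) (at y) w) x"
    "isCont (\<lambda>y. frechet_derivative (\<lambda>z. frechet_derivative f (at z) w) (at y) v) x" by blast+
qed

lemma smooth_onD: "smooth_on W S f \<Longrightarrow> k_smooth_on k W S f"
  by (simp add: smooth_on_def)

lemma smooth_on_has_derivative:
  "smooth_on W S f \<Longrightarrow> x \<in> S \<Longrightarrow> (f has_derivative frechet_derivative f (at x within W)) (at x within W)"
  using k_smooth_on_SucD smooth_onD by blast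

subsection \<open>Charted spaces\<close>

text \<open>Bundles what the calculus in preferred charts draws on. It passes to products and open
  subsets, so the phase spaces acquire it from the group and from linear subspaces.\<close>

definition charted :: "('m, 'e::real_normed_vector) mfd \<Rightarrow> bool" where
  "charted M \<longleftrightarrow>
     subspace (model M) \<and>
     (\<forall>(D, \<phi>)\<in>atlas M. openin (mtop M) D \<and> openin (top_of_set (model M)) (\<phi> ` D) \<and>
        homeomorphic_map (subtopology (mtop M) D) (top_of_set (\<phi> ` D)) \<phi>) \<and>
     (\<forall>p\<in>topspace (mtop M). chart_at M p \<in> atlas M \<and> p \<in> dom_at M p)"

lemma smooth_manifold_imp_charted: "smooth_manifold M \<Longrightarrow> charted M"
  unfolding smooth_manifold_def charted_def by blast

lemma charted_subspace: "charted M \<Longrightarrow> subspace (model M)"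
  by (simp add: charted_def)

lemma charted_chart:
  assumes "charted M" "(D, \<phi>) \<in> atlas M"
  shows "openin (mtop M) D" "D \<subseteq> topspace (mtop M)" "inj_on \<phi> D" "\<phi> ` D \<subseteq> model M"
    "\<And>S. openin (mtop M) S \<Longrightarrow> openin (top_of_set (model M)) (\<phi> ` (D \<inter> S))"
proof -
  have h: "openin (mtop M) D" "openin (top_of_set (model M)) (\<phi> ` D)"
    "homeomorphic_map (subtopology (mtop M) D) (top_of_set (\<phi> ` D)) \<phi>"
    using assms unfolding charted_def by blast+
  show "openin (mtop M) D" by (rule h)
  then show D: "D \<subseteq> topspace (mtop M)" by (rule openin_subset)
  then show "inj_on \<phi> D"
    using homeomorphic_imp_injective_map[OF h(3)] by (simp add: Int_absorb1)
  show "\<phi> ` D \<subseteq> model M" using h(2) openin_imp_subset by blast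
  fix S assume "openin (mtop M) S"
  then have "openin (subtopology (mtop M) D) (D \<inter> S)"
    by (rule openin_subtopology_Int2)
  then have "openin (top_of_set (\<phi> ` D)) (\<phi> ` (D \<inter> S))"
    using homeomorphic_imp_open_map[OF h(3)] unfolding open_map_def by blast
  then show "openin (top_of_set (model M)) (\<phi> ` (D \<inter> S))"
    using h(2) openin_trans by blast
qed

lemma charted_at:
  assumes "charted M" "p \<in> topspace (mtop M)"
  shows "(dom_at M p, coord_at M p) \<in> atlas M" "p \<in> dom_at M p"
  using assms unfolding charted_def by auto

lemma param_coord [simp]:
  assumes "charted M" "p \<in> topspace (mtop M)" "x \<in> dom_at M p"
  shows "param_at M p (coord_at M p x) = x"
  using assms charted_chart(3)[OF assms(1) charted_at(1)[OF assms(1,2)]] by simp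

lemma charted_vec_mfd: "subspace W \<Longrightarrow> charted (vec_mfd W)"
  by (auto simp: charted_def vec_mfd_def subtopology_subtopology)

lemma vec_mfd_simps [simp]:
  "mtop (vec_mfd W) = top_of_set W" "model (vec_mfd W) = W" "atlas (vec_mfd W) = {(W, id)}"
  "chart_at (vec_mfd W) p = (W, id)"
  by (simp_all add: vec_mfd_def)

lemma prod_mfd_simps [simp]:
  "mtop (prod_mfd M N) = prod_topology (mtop M) (mtop N)"
  "model (prod_mfd M N) = model M \<times> model N"
  "chart_at (prod_mfd M N) (p, q) =
    (dom_at M p \<times> dom_at N q, map_prod (coord_at M p) (coord_at N q))"
  by (simp_all add: prod_mfd_def prod_chart_def)

lemma prod_mfd_atlas:
  "c \<in> atlas (prod_mfd M N) \<longleftrightarrow>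
    (\<exists>D \<phi> E \<psi>. (D, \<phi>) \<in> atlas M \<and> (E, \<psi>) \<in> atlas N \<and> c = (D \<times> E, map_prod \<phi> \<psi>))"
  by (auto simp: prod_mfd_def prod_chart_def)

lemma open_submfd_simps [simp]:
  "mtop (open_submfd M S) = subtopology (mtop M) S"
  "model (open_submfd M S) = model M"
  "chart_at (open_submfd M S) p = (dom_at M p \<inter> S, coord_at M p)"
  by (simp_all add: open_submfd_def)

lemma open_submfd_atlas:
  "c \<in> atlas (open_submfd M S) \<longleftrightarrow> (\<exists>D \<phi>. (D, \<phi>) \<in> atlas M \<and> c = (D \<inter> S, \<phi>))"
  by (simp add: open_submfd_def image_iff Bex_def)

lemma charted_prod_mfd:
  assumes M: "charted M" and N: "charted N"
  shows "charted (prod_mfd M N)"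
  unfolding charted_def
proof (intro conjI ballI)
  show "subspace (model (prod_mfd M N))"
    using assms by (simp add: subspace_Times charted_subspace)
  fix c assume "c \<in> atlas (prod_mfd M N)"
  then obtain D \<phi> E \<psi> where c: "(D, \<phi>) \<in> atlas M" "(E, \<psi>) \<in> atlas N" "c = (D \<times> E, map_prod \<phi> \<psi>)"
    unfolding prod_mfd_atlas by blast
  have im: "map_prod \<phi> \<psi> ` (D \<times> E) = \<phi> ` D \<times> \<psi> ` E" by (auto simp: image_iff)
  have h: "homeomorphic_map (subtopology (mtop M) D) (top_of_set (\<phi> ` D)) \<phi>"
    "homeomorphic_map (subtopology (mtop N) E) (top_of_set (\<psi> ` E)) \<psi>"
    using M N c unfolding charted_def by blast+
  then obtain \<phi>' \<psi>' where "homeomorphic_maps (subtopology (mtop M) D) (top_of_set (\<phi> ` D)) \<phi> \<phi>'"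
    "homeomorphic_maps (subtopology (mtop N) E) (top_of_set (\<psi> ` E)) \<psi> \<psi>'"
    unfolding homeomorphic_map_maps by blast
  then have "homeomorphic_map (prod_topology (subtopology (mtop M) D) (subtopology (mtop N) E))
      (prod_topology (top_of_set (\<phi> ` D)) (top_of_set (\<psi> ` E))) (\<lambda>(x, y). (\<phi> x, \<psi> y))"
    unfolding homeomorphic_map_maps by (intro exI, subst homeomorphic_maps_prod) blast
  then have "homeomorphic_map (subtopology (prod_topology (mtop M) (mtop N)) (D \<times> E))
      (top_of_set (\<phi> ` D \<times> \<psi> ` E)) (map_prod \<phi> \<psi>)"
    by (simp add: map_prod_def subtopology_Times)
  moreover have "openin (prod_topology (mtop M) (mtop N)) (D \<times> E)"
    using charted_chart(1)[OF M c(1)] charted_chart(1)[OF N c(2)] by (simp add: openin_prod_Times_iff)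
  moreover have "openin (top_of_set (model M \<times> model N)) (\<phi> ` D \<times> \<psi> ` E)"
    using charted_chart(5)[OF M c(1) openin_topspace] charted_chart(5)[OF N c(2) openin_topspace]
      charted_chart(2)[OF M c(1)] charted_chart(2)[OF N c(2)]
    by (simp add: openin_Times Int_absorb2)
  ultimately show "case c of (D, \<phi>) \<Rightarrow> openin (mtop (prod_mfd M N)) D \<and>
      openin (top_of_set (model (prod_mfd M N))) (\<phi> ` D) \<and>
      homeomorphic_map (subtopology (mtop (prod_mfd M N)) D) (top_of_set (\<phi> ` D)) \<phi>"
    by (simp only: c(3) im prod_mfd_simps split_conv simp_thms)
next
  fix z assume "z \<in> topspace (mtop (prod_mfd M N))"
  then obtain p q where z: "z = (p, q)" "p \<in> topspace (mtop M)" "q \<in> topspace (mtop N)" by auto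
  show "chart_at (prod_mfd M N) z \<in> atlas (prod_mfd M N)"
    using charted_at(1)[OF M z(2)] charted_at(1)[OF N z(3)] unfolding prod_mfd_atlas z(1) by force
  show "z \<in> dom_at (prod_mfd M N) z"
    using charted_at(2)[OF M z(2)] charted_at(2)[OF N z(3)] z(1) by simp
qed

lemma charted_open_submfd:
  assumes M: "charted M" and S: "openin (mtop M) S"
  shows "charted (open_submfd M S)"
  unfolding charted_def
proof (intro conjI ballI)
  show "subspace (model (open_submfd M S))"
    using assms by (simp add: charted_subspace)
  fix c assume "c \<in> atlas (open_submfd M S)"
  then obtain D \<phi> where c: "(D, \<phi>) \<in> atlas M" "c = (D \<inter> S, \<phi>)"
    unfolding open_submfd_atlas by blast
  have h: "homeomorphic_map (subtopology (mtop M) D) (top_of_set (\<phi> ` D)) \<phi>"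
    using M c unfolding charted_def by blast
  have "\<phi> ` (topspace (subtopology (mtop M) D) \<inter> (D \<inter> S)) = topspace (top_of_set (\<phi> ` D)) \<inter> \<phi> ` (D \<inter> S)"
    using charted_chart(2)[OF M c(1)] by auto
  from homeomorphic_map_subtopologies[OF h this]
  have "homeomorphic_map (subtopology (subtopology (mtop M) S) (D \<inter> S)) (top_of_set (\<phi> ` (D \<inter> S))) \<phi>"
    by (simp add: subtopology_subtopology Int_ac image_mono Int_absorb1)
  moreover have "openin (subtopology (mtop M) S) (D \<inter> S)"
    using charted_chart(1)[OF M c(1)] by (rule openin_subtopology_Int)
  ultimately show "case c of (D, \<phi>) \<Rightarrow> openin (mtop (open_submfd M S)) D \<and>
      openin (top_of_set (model (open_submfd M S))) (\<phi> ` D) \<and>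
      homeomorphic_map (subtopology (mtop (open_submfd M S)) D) (top_of_set (\<phi> ` D)) \<phi>"
    using charted_chart(5)[OF M c(1) S] by (simp add: c(2))
next
  fix p assume "p \<in> topspace (mtop (open_submfd M S))"
  then have p: "p \<in> topspace (mtop M)" "p \<in> S" by auto
  show "chart_at (open_submfd M S) p \<in> atlas (open_submfd M S)"
    using charted_at(1)[OF M p(1)] unfolding open_submfd_atlas open_submfd_simps by blast
  show "p \<in> dom_at (open_submfd M S) p"
    using charted_at(2)[OF M p(1)] p by simp
qed

subsection \<open>Derivatives of maps between charted spaces\<close>

text \<open>The derivative of the coordinate expression alone does not force f to map points near p
  into the chart at f p, beyond which \<open>coord_at\<close> is arbitrary. Continuity at p supplies
  this and makes the chain rule true. As a relation with T explicit, it avoids the choice in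
  \<open>tangent_map\<close>; T matters on \<open>model M\<close> only.\<close>

definition has_tangent ::
  "('m, 'e::real_normed_vector) mfd \<Rightarrow> ('n, 'f::real_normed_vector) mfd \<Rightarrow> ('m \<Rightarrow> 'n) \<Rightarrow> 'm \<Rightarrow> ('e \<Rightarrow> 'f) \<Rightarrow> bool" where
  "has_tangent M N f p T \<longleftrightarrow>
     topcontinuous_at (mtop M) (mtop N) f p \<and>
     ((\<lambda>x. coord_at N (f p) (f (param_at M p x))) has_derivative T) (at (coord_at M p p) within model M)"

lemma has_tangent_topspace:
  assumes "has_tangent M N f p T"
  shows "p \<in> topspace (mtop M)" "f p \<in> topspace (mtop N)"
  using assms unfolding has_tangent_def topcontinuous_at_def by auto

lemma has_tangent_linear:
  assumes "has_tangent M N f p T"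
  shows "bounded_linear T"
  using assms has_derivative_bounded_linear unfolding has_tangent_def by blast

lemma coord_in_model:
  assumes "charted M" "p \<in> topspace (mtop M)" "x \<in> dom_at M p"
  shows "coord_at M p x \<in> model M"
  using charted_chart(4)[OF assms(1) charted_at(1)[OF assms(1,2)]] assms(3) by blast

lemma tangent_map_eq:
  assumes M: "charted M" and f: "has_tangent M N f p T" and v: "v \<in> model M"
  shows "tangent_map M N f p v = T v"
proof -
  note p = has_tangent_topspace(1)[OF f]
  have "frechet_derivative (\<lambda>x. coord_at N (f p) (f (param_at M p x))) (at (coord_at M p p) within model M) v = T v"
    using f v unfolding has_tangent_def
    by (intro frechet_derivative_within_eq charted_subspace coord_in_model charted_at(2) M p) auto
  then show ?thesis by (simp add: tangent_map_def o_def)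
qed

lemma has_tangent_unique:
  assumes "charted M" "has_tangent M N f p T" "has_tangent M N f p T'" "v \<in> model M"
  shows "T v = T' v"
  using assms tangent_map_eq by metis

text \<open>\<open>param_at\<close> inverts a chart only on the image of its domain. An identity on
  an open set around p nevertheless suffices to exchange coordinate expressions under the
  derivative, because the chart image of that set is relatively open.\<close>

lemma chart_cong:
  assumes M: "charted M" and p: "p \<in> S" "openin (mtop M) S"
    and fg: "\<And>x. x \<in> S \<Longrightarrow> x \<in> dom_at M p \<Longrightarrow> f (coord_at M p x) = g (coord_at M p x)"
    and f: "(f has_derivative T) (at (coord_at M p p) within model M)"
  shows "(g has_derivative T) (at (coord_at M p p) within model M)"
proof (rule has_derivative_within_cong[OF _ _ _ f])
  have p': "p \<in> topspace (mtop M)" using p openin_subset by blast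
  show "openin (top_of_set (model M)) (coord_at M p ` (dom_at M p \<inter> S))"
    using charted_chart(5)[OF M charted_at(1)[OF M p'] p(2)] .
  show "coord_at M p p \<in> coord_at M p ` (dom_at M p \<inter> S)"
    using p charted_at(2)[OF M p'] by auto
qed (use fg in auto)

lemma has_tangent_cong:
  assumes M: "charted M" and fg: "\<And>x. x \<in> topspace (mtop M) \<Longrightarrow> f x = g x"
    and f: "has_tangent M N f p T"
  shows "has_tangent M N g p T"
  unfolding has_tangent_def
proof
  note p = has_tangent_topspace(1)[OF f]
  have "f \<in> topspace (mtop M) \<rightarrow> topspace (mtop N)"
    using f unfolding has_tangent_def topcontinuous_at_def by auto
  then have 1: "g \<in> topspace (mtop M) \<rightarrow> topspace (mtop N)" using fg by (simp add: Pi_iff)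
  have 2: "\<exists>U. openin (mtop M) U \<and> p \<in> U \<and> (\<forall>y\<in>U. g y \<in> V)" if V: "openin (mtop N) V" "g p \<in> V" for V
  proof -
    have "f p \<in> V" using V fg[OF p] by simp
    then obtain U where "openin (mtop M) U" "p \<in> U" "\<forall>y\<in>U. f y \<in> V"
      using f V(1) unfolding has_tangent_def topcontinuous_at_def by blast
    moreover have "\<forall>y\<in>U. f y = g y" using fg \<open>openin (mtop M) U\<close> openin_subset by blast
    ultimately show ?thesis by auto
  qed
  show "topcontinuous_at (mtop M) (mtop N) g p"
    unfolding topcontinuous_at_def using p 1 2 by blast
  show "((\<lambda>x. coord_at N (g p) (g (param_at M p x))) has_derivative T) (at (coord_at M p p) within model M)"
  proof (rule chart_cong[OF M p openin_topspace])
    show "((\<lambda>x. coord_at N (f p) (f (param_at M p x))) has_derivative T) (at (coord_at M p p) within model M)"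
      using f by (simp add: has_tangent_def)
  qed (simp add: M p fg)
qed

lemma has_tangent_compose:
  assumes M: "charted M" and N: "charted N"
    and f: "has_tangent M N f p T" and g: "has_tangent N L g (f p) T'"
  shows "has_tangent M L (\<lambda>x. g (f x)) p (\<lambda>v. T' (T v))"
  unfolding has_tangent_def
proof
  note p = has_tangent_topspace[OF f]
  have tf: "topcontinuous_at (mtop M) (mtop N) f p" and tg: "topcontinuous_at (mtop N) (mtop L) g (f p)"
    using f g unfolding has_tangent_def by auto
  show "topcontinuous_at (mtop M) (mtop L) (\<lambda>x. g (f x)) p"
    unfolding topcontinuous_at_def
  proof (intro conjI allI impI p)
    show "(\<lambda>x. g (f x)) \<in> topspace (mtop M) \<rightarrow> topspace (mtop L)"
      using tf tg unfolding topcontinuous_at_def by auto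
    fix V assume "openin (mtop L) V \<and> g (f p) \<in> V"
    then obtain V' where "openin (mtop N) V'" "f p \<in> V'" "\<forall>y\<in>V'. g y \<in> V"
      using tg unfolding topcontinuous_at_def by blast
    moreover then obtain U where "openin (mtop M) U" "p \<in> U" "\<forall>y\<in>U. f y \<in> V'"
      using tf unfolding topcontinuous_at_def by blast
    ultimately show "\<exists>U. openin (mtop M) U \<and> p \<in> U \<and> (\<forall>y\<in>U. g (f y) \<in> V)" by blast
  qed
  have dN: "openin (mtop N) (dom_at N (f p))" "f p \<in> dom_at N (f p)"
    using charted_chart(1)[OF N charted_at(1)[OF N p(2)]] charted_at(2)[OF N p(2)] by auto
  \<comment> \<open>On S the values of f remain in the chart at f p, so the inserted pair of that
    chart and its inverse cancels.\<close>
  then obtain S where S: "openin (mtop M) S" "p \<in> S" "\<forall>y\<in>S. f y \<in> dom_at N (f p)"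
    using tf unfolding topcontinuous_at_def by blast
  let ?f = "\<lambda>x. coord_at N (f p) (f (param_at M p x))"
  let ?g = "\<lambda>x. coord_at L (g (f p)) (g (param_at N (f p) x))"
  note pd = charted_at(2)[OF M p(1)]
  have "((\<lambda>x. ?g (?f x)) has_derivative (\<lambda>v. T' (T v))) (at (coord_at M p p) within model M)"
  proof (rule has_derivative_within_chain[of ?f])
    show "(?f has_derivative T) (at (coord_at M p p) within model M)"
      using f by (simp add: has_tangent_def)
    show "(?g has_derivative T') (at (?f (coord_at M p p)) within model N)"
      using g pd p M by (simp add: has_tangent_def)
    show "openin (top_of_set (model M)) (coord_at M p ` (dom_at M p \<inter> S))"
      using charted_chart(5)[OF M charted_at(1)[OF M p(1)] S(1)] .
    show "coord_at M p p \<in> coord_at M p ` (dom_at M p \<inter> S)"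
      using pd S by blast
    show "?f ` coord_at M p ` (dom_at M p \<inter> S) \<subseteq> model N"
      using M p S(3) N by (auto intro!: coord_in_model)
  qed
  then show "((\<lambda>x. coord_at L (g (f p)) (g (f (param_at M p x)))) has_derivative (\<lambda>v. T' (T v)))
      (at (coord_at M p p) within model M)"
    by (rule chart_cong[OF M S(2,1), rotated]) (use M N p S in simp)
qed

lemma has_tangent_const:
  assumes "p \<in> topspace (mtop M)" "c \<in> topspace (mtop N)"
  shows "has_tangent M N (\<lambda>_. c) p (\<lambda>_. 0)"
  using assms unfolding has_tangent_def topcontinuous_at_def by auto

lemma has_tangent_id:
  assumes "charted M" "p \<in> topspace (mtop M)"
  shows "has_tangent M M (\<lambda>x. x) p (\<lambda>v. v)"
  unfolding has_tangent_def
proof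
  show "topcontinuous_at (mtop M) (mtop M) (\<lambda>x. x) p"
    using assms unfolding topcontinuous_at_def by auto
  show "((\<lambda>x. coord_at M p (param_at M p x)) has_derivative (\<lambda>v. v)) (at (coord_at M p p) within model M)"
    by (rule chart_cong[OF assms openin_topspace, of "\<lambda>x. x"]) (use assms in auto)
qed

text \<open>Restriction changes \<open>param_at\<close>, which now inverts the chart on a smaller
  domain; the two coordinate expressions agree on the restricted chart and hence have the same
  derivative.\<close>

lemma has_tangent_open_dom:
  assumes M: "charted M" and S: "openin (mtop M) S" "p \<in> S" and f: "has_tangent M N f p T"
  shows "has_tangent (open_submfd M S) N f p T"
  unfolding has_tangent_def
proof
  note p = has_tangent_topspace(1)[OF f]
  have tf: "topcontinuous_at (mtop M) (mtop N) f p" using f unfolding has_tangent_def by auto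
  have "\<exists>U. openin (subtopology (mtop M) S) U \<and> p \<in> U \<and> (\<forall>y\<in>U. f y \<in> V)"
    if V: "openin (mtop N) V" "f p \<in> V" for V
  proof -
    obtain U where U: "openin (mtop M) U" "p \<in> U" "\<forall>y\<in>U. f y \<in> V"
      using tf V unfolding topcontinuous_at_def by blast
    then have "openin (subtopology (mtop M) S) (U \<inter> S)" by (intro openin_subtopology_Int)
    with U S show ?thesis by blast
  qed
  with tf S show "topcontinuous_at (mtop (open_submfd M S)) (mtop N) f p"
    unfolding topcontinuous_at_def by auto
  have inj: "inj_on (coord_at M p) (dom_at M p)" using charted_chart(3)[OF M charted_at(1)[OF M p]] .
  have "((\<lambda>x. coord_at N (f p) (f (param_at (open_submfd M S) p x))) has_derivative T)
      (at (coord_at M p p) within model M)"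
  proof (rule chart_cong[OF M S(2,1)])
    show "((\<lambda>x. coord_at N (f p) (f (param_at M p x))) has_derivative T) (at (coord_at M p p) within model M)"
      using f by (simp add: has_tangent_def)
    fix x assume x: "x \<in> S" "x \<in> dom_at M p"
    then have "param_at (open_submfd M S) p (coord_at M p x) = x"
      using inj by (simp add: inv_into_f_f inj_on_subset[of _ _ "dom_at M p \<inter> S"])
    then show "coord_at N (f p) (f (param_at M p (coord_at M p x))) =
        coord_at N (f p) (f (param_at (open_submfd M S) p (coord_at M p x)))"
      using M p x by simp
  qed
  then show "((\<lambda>x. coord_at N (f p) (f (param_at (open_submfd M S) p x))) has_derivative T)
      (at (coord_at (open_submfd M S) p p) within model (open_submfd M S))"
    by simp
qed

lemma has_tangent_open_cod:
  assumes f: "has_tangent M N f p T" and S: "f ` topspace (mtop M) \<subseteq> S"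
  shows "has_tangent M (open_submfd N S) f p T"
  unfolding has_tangent_def
proof
  have tf: "topcontinuous_at (mtop M) (mtop N) f p" using f unfolding has_tangent_def by auto
  have "\<exists>U. openin (mtop M) U \<and> p \<in> U \<and> (\<forall>y\<in>U. f y \<in> V)"
    if V: "openin (subtopology (mtop N) S) V" "f p \<in> V" for V
  proof -
    obtain V' where V': "openin (mtop N) V'" "V = V' \<inter> S" using V by (auto simp: openin_subtopology)
    then obtain U where U: "openin (mtop M) U" "p \<in> U" "\<forall>y\<in>U. f y \<in> V'"
      using tf V unfolding topcontinuous_at_def by blast
    moreover have "\<forall>y\<in>U. f y \<in> S" using U(1) S openin_subset by blast
    ultimately show ?thesis using V' by blast
  qed
  with tf S show "topcontinuous_at (mtop M) (mtop (open_submfd N S)) f p"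
    unfolding topcontinuous_at_def by auto
qed (use f in \<open>simp add: has_tangent_def\<close>)

lemma has_tangent_vec_mfd:
  assumes "bounded_linear L" "\<And>w. w \<in> W \<Longrightarrow> L w \<in> W'" "p \<in> W"
  shows "has_tangent (vec_mfd W) (vec_mfd W') L p L"
  unfolding has_tangent_def
proof
  have "continuous_map (top_of_set W) (top_of_set W') L"
    using assms by (auto intro: linear_continuous_on)
  then show "topcontinuous_at (mtop (vec_mfd W)) (mtop (vec_mfd W')) L p"
    using assms(3) by (simp add: continuous_map_eq_topcontinuous_at)
  have "inv_into W id x = x" if "x \<in> W" for x
    using that by (metis f_inv_into_f id_apply image_id)
  then have "((\<lambda>x. L (inv_into W id x)) has_derivative L) (at p within W)"
    using bounded_linear.has_derivative[OF assms(1) has_derivative_ident, of "at p within W"] assms(3)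
    by (rule_tac has_derivative_transform[of p W _ L]) auto
  then show "((\<lambda>x. coord_at (vec_mfd W') (L p) (L (param_at (vec_mfd W) p x))) has_derivative L)
      (at (coord_at (vec_mfd W) p p) within model (vec_mfd W))"
    by simp
qed

lemma param_at_prod_mfd:
  assumes "charted M" "charted N" "p \<in> topspace (mtop M)" "q \<in> topspace (mtop N)"
    "x \<in> dom_at M p" "y \<in> dom_at N q"
  shows "param_at (prod_mfd M N) (p, q) (coord_at M p x, coord_at N q y) = (x, y)"
  using param_coord[OF charted_prod_mfd[OF assms(1,2)], of "(p, q)" "(x, y)"] assms by simp

lemma has_tangent_fst:
  assumes M: "charted M" and N: "charted N" and p: "p \<in> topspace (mtop M)" "q \<in> topspace (mtop N)"
  shows "has_tangent (prod_mfd M N) M fst (p, q) fst"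
  unfolding has_tangent_def
proof
  have "continuous_map (prod_topology (mtop M) (mtop N)) (mtop M) fst" by (rule continuous_map_fst)
  then show "topcontinuous_at (mtop (prod_mfd M N)) (mtop M) fst (p, q)"
    using p by (simp add: continuous_map_eq_topcontinuous_at)
  show "((\<lambda>x. coord_at M (fst (p, q)) (fst (param_at (prod_mfd M N) (p, q) x))) has_derivative fst)
      (at (coord_at (prod_mfd M N) (p, q) (p, q)) within model (prod_mfd M N))"
    by (rule chart_cong[OF charted_prod_mfd[OF M N], of _ "topspace (mtop (prod_mfd M N))" fst])
       (use assms openin_topspace[of "prod_topology (mtop M) (mtop N)"] in \<open>auto simp: param_at_prod_mfd[simplified] intro!: bounded_linear.has_derivative[OF bounded_linear_fst]\<close>)
qed

lemma has_tangent_snd: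
  assumes M: "charted M" and N: "charted N" and p: "p \<in> topspace (mtop M)" "q \<in> topspace (mtop N)"
  shows "has_tangent (prod_mfd M N) N snd (p, q) snd"
  unfolding has_tangent_def
proof
  have "continuous_map (prod_topology (mtop M) (mtop N)) (mtop N) snd" by (rule continuous_map_snd)
  then show "topcontinuous_at (mtop (prod_mfd M N)) (mtop N) snd (p, q)"
    using p by (simp add: continuous_map_eq_topcontinuous_at)
  show "((\<lambda>x. coord_at N (snd (p, q)) (snd (param_at (prod_mfd M N) (p, q) x))) has_derivative snd)
      (at (coord_at (prod_mfd M N) (p, q) (p, q)) within model (prod_mfd M N))"
    by (rule chart_cong[OF charted_prod_mfd[OF M N], of _ "topspace (mtop (prod_mfd M N))" snd])
       (use assms openin_topspace[of "prod_topology (mtop M) (mtop N)"] in \<open>auto simp: param_at_prod_mfd[simplified] intro!: bounded_linear.has_derivative[OF bounded_linear_snd]\<close>)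
qed

lemma has_tangent_Pair:
  assumes f: "has_tangent L M f p T" and g: "has_tangent L N g p T'"
  shows "has_tangent L (prod_mfd M N) (\<lambda>x. (f x, g x)) p (\<lambda>v. (T v, T' v))"
  unfolding has_tangent_def
proof
  have "limitin (mtop M) f (f p) (atin (mtop L) p)" "limitin (mtop N) g (g p) (atin (mtop L) p)"
    using f g by (auto simp: has_tangent_def topcontinuous_at_atin)
  then have "limitin (prod_topology (mtop M) (mtop N)) (\<lambda>x. (f x, g x)) (f p, g p) (atin (mtop L) p)"
    by (simp add: limitin_pairwise o_def)
  then show "topcontinuous_at (mtop L) (mtop (prod_mfd M N)) (\<lambda>x. (f x, g x)) p"
    using f g by (auto simp: has_tangent_def topcontinuous_at_atin)
  show "((\<lambda>x. coord_at (prod_mfd M N) (f p, g p) (f (param_at L p x), g (param_at L p x)))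
      has_derivative (\<lambda>v. (T v, T' v))) (at (coord_at L p p) within model L)"
    using f g by (auto simp: has_tangent_def intro: has_derivative_Pair)
qed

lemma has_tangent_vec_UNIV_iff:
  "has_tangent M (vec_mfd UNIV) f p T \<longleftrightarrow>
    p \<in> topspace (mtop M) \<and> (f \<longlongrightarrow> f p) (atin (mtop M) p) \<and>
    ((\<lambda>x. f (param_at M p x)) has_derivative T) (at (coord_at M p p) within model M)"
  by (auto simp: has_tangent_def topcontinuous_at_atin)

text \<open>Intended for the evaluation pairing of the momentum b with the moving vector Ad_F
  applied to a fixed Lie algebra element.\<close>

lemma has_tangent_bilinear:
  assumes M: "charted M" and B: "bounded_bilinear B"
    and f: "has_tangent M (vec_mfd UNIV) f p T" and g: "has_tangent M (vec_mfd UNIV) g p T'"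
  shows "has_tangent M (vec_mfd UNIV) (\<lambda>x. B (f x) (g x)) p (\<lambda>v. B (f p) (T' v) + B (T v) (g p))"
proof -
  have p: "p \<in> topspace (mtop M)" using f by (rule has_tangent_topspace)
  have "param_at M p (coord_at M p p) = p" using M p charted_at(2)[OF M p] by simp
  then show ?thesis
    using f g bounded_bilinear.tendsto[OF B, of f "f p" "atin (mtop M) p" g "g p"]
      bounded_bilinear.FDERIV[OF B, of "\<lambda>x. f (param_at M p x)" T "coord_at M p p" "model M"
        "\<lambda>x. g (param_at M p x)" T']
    unfolding has_tangent_vec_UNIV_iff by simp
qed

lemma has_tangent_bounded_linear:
  assumes B: "bounded_linear B" and f: "has_tangent M (vec_mfd UNIV) f p T"
  shows "has_tangent M (vec_mfd UNIV) (\<lambda>x. B (f x)) p (\<lambda>v. B (T v))"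
  using f bounded_linear.tendsto[OF B] bounded_linear.has_derivative[OF B]
  unfolding has_tangent_vec_UNIV_iff by blast

lemma has_tangent_diff:
  assumes f: "has_tangent M (vec_mfd UNIV) f p T" and g: "has_tangent M (vec_mfd UNIV) g p T'"
  shows "has_tangent M (vec_mfd UNIV) (\<lambda>x. f x - g x) p (\<lambda>v. T v - T' v)"
  using f g unfolding has_tangent_vec_UNIV_iff
  by (auto intro: tendsto_diff has_derivative_diff)

lemma smooth_map_has_tangent:
  assumes M: "charted M" and N: "charted N" and f: "smooth_map M N f" and p: "p \<in> topspace (mtop M)"
  shows "has_tangent M N f p (tangent_map M N f p)"
  unfolding has_tangent_def
proof
  show c: "topcontinuous_at (mtop M) (mtop N) f p"
    using f p by (simp add: smooth_map_def continuous_map_eq_topcontinuous_at)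
  then have fp: "f p \<in> topspace (mtop N)" using p by (auto simp: topcontinuous_at_def)
  have "smooth_on (model M) (coord_at M p ` {x \<in> dom_at M p. f x \<in> dom_at N (f p)})
      (coord_at N (f p) \<circ> f \<circ> param_at M p)"
    using f charted_at(1)[OF M p] charted_at(1)[OF N fp] unfolding smooth_map_def by blast
  from smooth_on_has_derivative[OF this, of "coord_at M p p"]
  show "((\<lambda>x. coord_at N (f p) (f (param_at M p x))) has_derivative tangent_map M N f p)
      (at (coord_at M p p) within model M)"
    using charted_at(2)[OF M p] charted_at(2)[OF N fp] by (simp add: tangent_map_def o_def)
qed

subsection \<open>Smooth maps\<close>

lemma smooth_mapI:
  assumes "continuous_map (mtop M) (mtop N) f"
    and "\<And>D \<phi> E \<psi>. (D, \<phi>) \<in> atlas M \<Longrightarrow> (E, \<psi>) \<in> atlas N \<Longrightarrow>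
      smooth_on (model M) (\<phi> ` {x \<in> D. f x \<in> E}) (\<psi> \<circ> f \<circ> inv_into D \<phi>)"
  shows "smooth_map M N f"
  using assms unfolding smooth_map_def by blast

lemma smooth_mapD:
  assumes "smooth_map M N f"
  shows "continuous_map (mtop M) (mtop N) f"
    and "\<And>D \<phi> E \<psi>. (D, \<phi>) \<in> atlas M \<Longrightarrow> (E, \<psi>) \<in> atlas N \<Longrightarrow>
      smooth_on (model M) (\<phi> ` {x \<in> D. f x \<in> E}) (\<psi> \<circ> f \<circ> inv_into D \<phi>)"
  using assms unfolding smooth_map_def by blast+

lemma chart_preimage_open:
  assumes "charted M" "(D, \<phi>) \<in> atlas M" "continuous_map (mtop M) X f" "openin X E"
  shows "openin (top_of_set (model M)) (\<phi> ` {x \<in> D. f x \<in> E})"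
proof -
  have "{x \<in> D. f x \<in> E} = D \<inter> {x \<in> topspace (mtop M). f x \<in> E}"
    using charted_chart(2)[OF assms(1,2)] by auto
  then show ?thesis
    using charted_chart(5)[OF assms(1,2)] openin_continuous_map_preimage[OF assms(3,4)] by simp
qed

text \<open>In charts the identity is a transition map, so this is the compatibility of the
  atlas.\<close>

lemma smooth_map_id:
  assumes "smooth_manifold M"
  shows "smooth_map M M (\<lambda>x. x)"
proof (rule smooth_mapI)
  fix D \<phi> E \<psi> assume "(D, \<phi>) \<in> atlas M" "(E, \<psi>) \<in> atlas M"
  then have "smooth_on (model M) (\<phi> ` (D \<inter> E)) (\<psi> \<circ> inv_into D \<phi>)"
    using assms unfolding smooth_manifold_def by blast
  then show "smooth_on (model M) (\<phi> ` {x \<in> D. x \<in> E}) (\<psi> \<circ> (\<lambda>x. x) \<circ> inv_into D \<phi>)"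
    by (simp add: o_def Int_def)
qed simp

lemma smooth_map_const:
  assumes M: "charted M" and c: "c \<in> topspace (mtop N)"
  shows "smooth_map M N (\<lambda>_. c)"
proof (rule smooth_mapI)
  fix D \<phi> E \<psi> assume D: "(D, \<phi>) \<in> atlas M" "(E, \<psi>) \<in> atlas N"
  have "openin (top_of_set (model M)) (\<phi> ` {x \<in> D. c \<in> E})"
    using charted_chart(5)[OF M D(1) openin_topspace] charted_chart(2)[OF M D(1)]
    by (cases "c \<in> E") (auto simp: Int_absorb2)
  then show "smooth_on (model M) (\<phi> ` {x \<in> D. c \<in> E}) (\<psi> \<circ> (\<lambda>_. c) \<circ> inv_into D \<phi>)"
    unfolding smooth_on_def o_def by (intro allI k_smooth_on_const charted_subspace M)
qed (use c in simp)

lemma smooth_map_Pair: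
  assumes L: "charted L" and M: "charted M" and N: "charted N"
    and f: "smooth_map L M f" and g: "smooth_map L N g"
  shows "smooth_map L (prod_mfd M N) (\<lambda>x. (f x, g x))"
proof (rule smooth_mapI)
  show c: "continuous_map (mtop L) (mtop (prod_mfd M N)) (\<lambda>x. (f x, g x))"
    using f g by (simp add: smooth_map_def continuous_map_pairwise o_def)
  fix D \<phi> E' \<psi>' assume D: "(D, \<phi>) \<in> atlas L" and "(E', \<psi>') \<in> atlas (prod_mfd M N)"
  then obtain E \<psi> H \<theta> where E: "(E, \<psi>) \<in> atlas M" "(H, \<theta>) \<in> atlas N" "E' = E \<times> H" "\<psi>' = map_prod \<psi> \<theta>"
    unfolding prod_mfd_atlas by blast
  let ?S = "\<phi> ` {x \<in> D. (f x, g x) \<in> E \<times> H}"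
  have "openin (top_of_set (model L)) ?S"
    using charted_chart(1)[OF M E(1)] charted_chart(1)[OF N E(2)] c
    by (intro chart_preimage_open[OF L D c]) (simp add: openin_prod_Times_iff)
  moreover have "k_smooth_on k (model L) ?S (\<psi> \<circ> f \<circ> inv_into D \<phi>)" for k
    by (rule k_smooth_on_subset[OF smooth_onD[OF smooth_mapD(2)[OF f D E(1)]]]) auto
  moreover have "k_smooth_on k (model L) ?S (\<theta> \<circ> g \<circ> inv_into D \<phi>)" for k
    by (rule k_smooth_on_subset[OF smooth_onD[OF smooth_mapD(2)[OF g D E(2)]]]) auto
  ultimately have "k_smooth_on k (model L) ?S
      (\<lambda>x. ((\<psi> \<circ> f \<circ> inv_into D \<phi>) x, (\<theta> \<circ> g \<circ> inv_into D \<phi>) x))" for k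
    by (intro k_smooth_on_Pair charted_subspace L)
  then show "smooth_on (model L) (\<phi> ` {x \<in> D. (f x, g x) \<in> E'}) (\<psi>' \<circ> (\<lambda>x. (f x, g x)) \<circ> inv_into D \<phi>)"
    unfolding smooth_on_def E(3,4) by (simp add: o_def)
qed

text \<open>In product charts the projection is a transition map of M after the linear projection;
  the latter is treated as an affine map with translation part 0.\<close>

lemma smooth_map_fst:
  assumes M: "smooth_manifold M" and N: "charted N"
  shows "smooth_map (prod_mfd M N) M fst"
proof (rule smooth_mapI)
  show c: "continuous_map (mtop (prod_mfd M N)) (mtop M) fst" by (simp add: continuous_map_fst)
  have M': "charted M" using M by (rule smooth_manifold_imp_charted)
  note MN = charted_prod_mfd[OF M' N]
  fix D' \<phi>' E \<psi> assume D': "(D', \<phi>') \<in> atlas (prod_mfd M N)" and E: "(E, \<psi>) \<in> atlas M"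
  obtain D \<phi> H \<theta> where D: "(D, \<phi>) \<in> atlas M" "(H, \<theta>) \<in> atlas N" "D' = D \<times> H" "\<phi>' = map_prod \<phi> \<theta>"
    using D' unfolding prod_mfd_atlas by blast
  let ?S = "\<phi>' ` {x \<in> D'. fst x \<in> E}"
  have S: "openin (top_of_set (model (prod_mfd M N))) ?S"
    by (rule chart_preimage_open[OF MN D' c charted_chart(1)[OF M' E]])
  have "k_smooth_on k (model (prod_mfd M N)) ?S (\<psi> \<circ> fst \<circ> inv_into D' \<phi>')" for k
  proof (rule k_smooth_on_cong[OF S])
    show "k_smooth_on k (model (prod_mfd M N)) ?S (\<lambda>x. (\<psi> \<circ> inv_into D \<phi>) (0 + fst x))"
    proof (rule k_smooth_on_compose_affine[OF charted_subspace[OF MN] S bounded_linear_fst])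
      show "k_smooth_on k (model M) (\<phi> ` (D \<inter> E)) (\<psi> \<circ> inv_into D \<phi>)"
        using M D E unfolding smooth_manifold_def smooth_on_def by blast
      show "\<phi> ` (D \<inter> E) \<subseteq> model M" using charted_chart(4)[OF M' D(1)] by blast
    qed (use M' D in \<open>auto simp: charted_subspace\<close>)
    fix y assume "y \<in> ?S"
    then obtain x where x: "x \<in> D'" "fst x \<in> E" "y = \<phi>' x" by blast
    then have "inv_into D' \<phi>' y = x" using charted_chart(3)[OF MN D'] by simp
    then show "(\<psi> \<circ> inv_into D \<phi>) (0 + fst y) = (\<psi> \<circ> fst \<circ> inv_into D' \<phi>') y"
      using x D charted_chart(3)[OF M' D(1)] by auto
  qed
  then show "smooth_on (model (prod_mfd M N)) ?S (\<psi> \<circ> fst \<circ> inv_into D' \<phi>')"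
    by (simp add: smooth_on_def)
qed

text \<open>Around each point the middle manifold is entered and left through its preferred chart at
  f x, and the two coordinate expressions are composed. The middle model is a full Euclidean space
  so that \<open>k_smooth_on_compose\<close> applies.\<close>

lemma smooth_map_compose:
  fixes N :: "('n, 'e::euclidean_space) mfd"
  assumes M: "charted M" and N: "charted N" "model N = UNIV" and L: "charted L"
    and f: "smooth_map M N f" and g: "smooth_map N L g"
  shows "smooth_map M L (\<lambda>x. g (f x))"
proof (rule smooth_mapI)
  note cf = smooth_mapD(1)[OF f] and cg = smooth_mapD(1)[OF g]
  show cgf: "continuous_map (mtop M) (mtop L) (\<lambda>x. g (f x))"
    using continuous_map_compose[OF cf cg] by (simp add: o_def)
  fix D \<phi> E \<psi> assume D: "(D, \<phi>) \<in> atlas M" and E: "(E, \<psi>) \<in> atlas L"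
  have "k_smooth_on k (model M) (\<phi> ` {x \<in> D. g (f x) \<in> E}) (\<psi> \<circ> (\<lambda>x. g (f x)) \<circ> inv_into D \<phi>)" for k
  proof (rule k_smooth_on_local)
    show "\<phi> ` {x \<in> D. g (f x) \<in> E} \<subseteq> model M" using charted_chart(4)[OF M D] by blast
    fix y assume "y \<in> \<phi> ` {x \<in> D. g (f x) \<in> E}"
    then obtain x where x: "x \<in> D" "g (f x) \<in> E" "y = \<phi> x" by blast
    have fx: "f x \<in> topspace (mtop N)"
      using x charted_chart(2)[OF M D] cf by (auto simp: continuous_map_def)
    let ?H = "dom_at N (f x)" let ?\<theta> = "coord_at N (f x)"
    note H = charted_at[OF N(1) fx]
    \<comment> \<open>The part of the chart around f x that g sends into the chart of L; over its
      preimage both coordinate expressions are meaningful.\<close>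
    let ?E' = "?H \<inter> {z \<in> topspace (mtop N). g z \<in> E}"
    have E': "openin (mtop N) ?E'"
      by (intro openin_Int charted_chart(1)[OF N(1) H(1)]
          openin_continuous_map_preimage[OF cg] charted_chart(1)[OF L E])
    let ?T = "\<phi> ` {x \<in> D. f x \<in> ?E'}"
    have T: "openin (top_of_set (model M)) ?T"
      by (rule chart_preimage_open[OF M D cf E'])
    have inj: "inj_on \<phi> D" "inj_on ?\<theta> ?H"
      using charted_chart(3)[OF M D] charted_chart(3)[OF N(1) H(1)] .
    have "k_smooth_on k (model M) ?T (\<psi> \<circ> (\<lambda>x. g (f x)) \<circ> inv_into D \<phi>)"
    proof (rule k_smooth_on_cong[OF T])
      show "k_smooth_on k (model M) ?T (\<lambda>y. (\<psi> \<circ> g \<circ> inv_into ?H ?\<theta>) ((?\<theta> \<circ> f \<circ> inv_into D \<phi>) y))"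
      proof (rule k_smooth_on_compose[OF charted_subspace[OF M] T])
        show "k_smooth_on k (model M) ?T (?\<theta> \<circ> f \<circ> inv_into D \<phi>)"
          by (rule k_smooth_on_subset[OF smooth_onD[OF smooth_mapD(2)[OF f D H(1)]]]) auto
        show "k_smooth_on k UNIV (?\<theta> ` {z \<in> ?H. g z \<in> E}) (\<psi> \<circ> g \<circ> inv_into ?H ?\<theta>)"
          using smooth_onD[OF smooth_mapD(2)[OF g H(1) E]] N(2) by simp
        show "(?\<theta> \<circ> f \<circ> inv_into D \<phi>) ` ?T \<subseteq> ?\<theta> ` {z \<in> ?H. g z \<in> E}"
          using inj by auto
      qed
    qed (use inj in auto)
    moreover have "y \<in> ?T" using x H(2) fx by auto
    ultimately show "\<exists>T. openin (top_of_set (model M)) T \<and> y \<in> T \<and>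
        k_smooth_on k (model M) T (\<psi> \<circ> (\<lambda>x. g (f x)) \<circ> inv_into D \<phi>)" using T by blast
  qed
  then show "smooth_on (model M) (\<phi> ` {x \<in> D. g (f x) \<in> E}) (\<psi> \<circ> (\<lambda>x. g (f x)) \<circ> inv_into D \<phi>)"
    by (simp add: smooth_on_def)
qed

subsection \<open>Lie groups\<close>

lemma has_derivative_snd_slice:
  assumes "(g has_derivative D) (at (x, y))"
  shows "((\<lambda>y. g (x, y)) has_derivative (\<lambda>v. D (0, v))) (at y)"
  by (rule has_derivative_compose[of "\<lambda>y. (x, y)" "\<lambda>v. (0, v)"])
     (use assms in \<open>auto intro!: derivative_eq_intros\<close>)

lemma has_derivative_fst_slice:
  assumes "(g has_derivative D) (at (x, y))"
  shows "((\<lambda>x. g (x, y)) has_derivative (\<lambda>v. D (v, 0))) (at x)"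
  by (rule has_derivative_compose[of "\<lambda>x. (x, y)" "\<lambda>v. (v, 0)"])
     (use assms in \<open>auto intro!: derivative_eq_intros\<close>)

lemma coord_tendsto:
  assumes M: "charted M" and p: "p \<in> topspace (mtop M)"
  shows "(coord_at M p \<longlongrightarrow> coord_at M p p) (atin (mtop M) p)"
proof -
  let ?D = "dom_at M p" and ?\<phi> = "coord_at M p"
  note D = charted_at[OF M p] charted_chart[OF M charted_at(1)[OF M p]]
  have "homeomorphic_map (subtopology (mtop M) ?D) (top_of_set (?\<phi> ` ?D)) ?\<phi>"
    using M D(1) unfolding charted_def by blast
  then have "continuous_map (subtopology (mtop M) ?D) (top_of_set (?\<phi> ` ?D)) ?\<phi>"
    by (rule homeomorphic_imp_continuous_map)
  then have c: "continuous_map (subtopology (mtop M) ?D) euclidean ?\<phi>"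
    using continuous_map_into_fulltopology by blast
  have "\<forall>\<^sub>F x in atin (mtop M) p. ?\<phi> x \<in> V" if V: "open V" "?\<phi> p \<in> V" for V
  proof -
    have "openin (subtopology (mtop M) ?D) {x \<in> topspace (subtopology (mtop M) ?D). ?\<phi> x \<in> V}"
      using openin_continuous_map_preimage[OF c] V by auto
    then have "openin (mtop M) {x \<in> topspace (subtopology (mtop M) ?D). ?\<phi> x \<in> V}"
      using D(3) openin_trans_full by blast
    then show ?thesis using p V D(2) by (auto simp: eventually_atin)
  qed
  then show ?thesis by (simp add: tendsto_def)
qed

locale lie_grp =
  fixes G :: "('g, 'x) monoid_scheme" (structure) and M :: "('g, 'a::euclidean_space) mfd"
  assumes lie: "lie_group G M"
begin

sublocale group G using lie by (simp add: lie_group_def)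

lemma smooth_manifold: "smooth_manifold M"
  and topspace_eq [simp]: "topspace (mtop M) = carrier G"
  and model_eq [simp]: "model M = UNIV"
  and smooth_mult: "smooth_map (prod_mfd M M) M (\<lambda>(x, y). x \<otimes> y)"
  and smooth_inv: "smooth_map M M (\<lambda>x. inv x)"
  using lie by (simp_all add: lie_group_def)

lemma charted_M [simp]: "charted M"
  using smooth_manifold by (rule smooth_manifold_imp_charted)

lemma charted_MM [simp]: "charted (prod_mfd M M)"
  by (simp add: charted_prod_mfd)

lemma smooth_map_mult:
  assumes "charted N" "smooth_map N M f" "smooth_map N M g"
  shows "smooth_map N M (\<lambda>x. f x \<otimes> g x)"
proof -
  have "smooth_map N M (\<lambda>x. (\<lambda>(x, y). x \<otimes> y) (f x, g x))"
    by (rule smooth_map_compose[OF assms(1) charted_MM _ charted_M _ smooth_mult])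
       (simp_all add: smooth_map_Pair assms)
  then show ?thesis by simp
qed

lemma smooth_map_inv:
  assumes "charted N" "smooth_map N M f"
  shows "smooth_map N M (\<lambda>x. inv (f x))"
  by (rule smooth_map_compose[OF assms(1) charted_M model_eq charted_M assms(2) smooth_inv])

lemma smooth_map_translate: "g \<in> carrier G \<Longrightarrow> smooth_map M M (\<lambda>x. g \<otimes> x)"
  by (intro smooth_map_mult smooth_map_id smooth_map_const) (simp_all add: smooth_manifold)

lemma smooth_map_conj: "g \<in> carrier G \<Longrightarrow> smooth_map M M (\<lambda>x. g \<otimes> x \<otimes> inv g)"
  by (intro smooth_map_mult smooth_map_id smooth_map_const) (simp_all add: smooth_manifold)

lemma smooth_conjugation: "smooth_map (prod_mfd M M) M (\<lambda>(x, y). x \<otimes> y \<otimes> inv x)"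
proof -
  have "smooth_map (prod_mfd M M) M (\<lambda>z. (\<lambda>(x, y). x \<otimes> y) z \<otimes> inv (fst z))"
    by (intro smooth_map_mult smooth_map_inv smooth_mult smooth_map_fst)
       (simp_all add: smooth_manifold)
  then show ?thesis by (simp add: case_prod_unfold)
qed

text \<open>By the chain rule, left-trivialising a velocity amounts to translating the map until it
  passes through the identity. Later computations always differentiate such translated maps, so the
  group operations are differentiated at the identity only.\<close>

lemma has_tangent_translate:
  assumes N: "charted N" and f: "has_tangent N M f p T"
  shows "has_tangent N M (\<lambda>x. inv (f p) \<otimes> f x) p (\<lambda>v. left_triv G M (f p) (T v))"
proof -
  have fp: "f p \<in> carrier G" using has_tangent_topspace(2)[OF f] by simp
  then have "has_tangent M M (\<lambda>x. inv (f p) \<otimes> x) (f p) (tangent_map M M (\<lambda>x. inv (f p) \<otimes> x) (f p))"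
    by (intro smooth_map_has_tangent smooth_map_translate) auto
  from has_tangent_compose[OF N charted_M f this] show ?thesis
    by (simp add: left_triv_def)
qed

lemma has_tangent_conj:
  assumes "g \<in> carrier G"
  shows "has_tangent M M (\<lambda>x. g \<otimes> x \<otimes> inv g) \<one> (Ad G M g)"
proof -
  have "has_tangent M M (\<lambda>x. g \<otimes> x \<otimes> inv g) \<one> (tangent_map M M (\<lambda>x. g \<otimes> x \<otimes> inv g) \<one>)"
    by (intro smooth_map_has_tangent smooth_map_conj) (use assms in auto)
  then show ?thesis by (simp add: Ad_def[abs_def])
qed

lemma bounded_linear_Ad: "g \<in> carrier G \<Longrightarrow> bounded_linear (Ad G M g)"
  by (rule has_tangent_linear[OF has_tangent_conj])

lemma Ad_one [simp]: "Ad G M \<one> \<xi> = \<xi>"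
proof -
  have "has_tangent M M (\<lambda>x. x) \<one> (Ad G M \<one>)"
    by (rule has_tangent_cong[OF _ _ has_tangent_conj[OF one_closed]]) auto
  from has_tangent_unique[OF charted_M this has_tangent_id] show ?thesis by simp
qed

lemma Ad_mult:
  assumes g: "g \<in> carrier G" and h: "h \<in> carrier G"
  shows "Ad G M (g \<otimes> h) \<xi> = Ad G M g (Ad G M h \<xi>)"
proof -
  have "has_tangent M M (\<lambda>x. g \<otimes> (h \<otimes> x \<otimes> inv h) \<otimes> inv g) \<one> (\<lambda>v. Ad G M g (Ad G M h v))"
    by (rule has_tangent_compose[OF charted_M charted_M has_tangent_conj[OF h], of M "\<lambda>x. g \<otimes> x \<otimes> inv g"])
       (use has_tangent_conj[OF g] h in simp)
  then have "has_tangent M M (\<lambda>x. (g \<otimes> h) \<otimes> x \<otimes> inv (g \<otimes> h)) \<one> (\<lambda>v. Ad G M g (Ad G M h v))"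
    by (rule has_tangent_cong[OF charted_M, rotated]) (use g h in \<open>simp add: inv_mult_group m_assoc\<close>)
  from has_tangent_unique[OF charted_M has_tangent_conj this] g h show ?thesis by simp
qed

lemma Ad_inv_cancel [simp]:
  assumes "g \<in> carrier G"
  shows "Ad G M (inv g) (Ad G M g \<xi>) = \<xi>" "Ad G M g (Ad G M (inv g) \<xi>) = \<xi>"
  using assms by (simp_all flip: Ad_mult)

lemma left_triv_one [simp]: "left_triv G M \<one> v = v"
proof -
  have "has_tangent M M (\<lambda>x. inv \<one> \<otimes> x) \<one> (\<lambda>v. left_triv G M \<one> v)"
    using has_tangent_translate[OF charted_M has_tangent_id[OF charted_M, of \<one>]] by simp
  then have "has_tangent M M (\<lambda>x. x) \<one> (\<lambda>v. left_triv G M \<one> v)"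
    by (rule has_tangent_cong[OF charted_M, rotated]) auto
  from has_tangent_unique[OF charted_M this has_tangent_id] show ?thesis by simp
qed

lemma bounded_linear_left_triv:
  assumes "g \<in> carrier G" shows "bounded_linear (left_triv G M g)"
  using has_tangent_linear[OF has_tangent_translate[OF charted_M has_tangent_id[OF charted_M, of g]]] assms
  by simp

text \<open>The derivative of the multiplication at the pair of identities is linear, hence the sum
  of its partial derivatives; both are the identity map because multiplying by \<one> on either side
  changes nothing.\<close>

lemma has_tangent_mult_one:
  assumes N: "charted N" and f: "has_tangent N M f p T" "f p = \<one>" and g: "has_tangent N M g p T'" "g p = \<one>"
  shows "has_tangent N M (\<lambda>x. f x \<otimes> g x) p (\<lambda>v. T v + T' v)"
proof -
  let ?D = "tangent_map (prod_mfd M M) M (\<lambda>(x, y). x \<otimes> y) (\<one>, \<one>)"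
  have D: "has_tangent (prod_mfd M M) M (\<lambda>(x, y). x \<otimes> y) (\<one>, \<one>) ?D"
    by (intro smooth_map_has_tangent smooth_mult) auto
  interpret D: bounded_linear ?D using D by (rule has_tangent_linear)
  have DP: "has_tangent L M (\<lambda>x. f x \<otimes> g x) q (\<lambda>v. ?D (T v, T' v))"
    if "charted L" "has_tangent L M f q T" "has_tangent L M g q T'" "f q = \<one>" "g q = \<one>"
    for L :: "('l, 'm::real_normed_vector) mfd" and f g q T T'
    using has_tangent_compose[OF that(1) charted_MM has_tangent_Pair[OF that(2,3)], of M "\<lambda>(x, y). x \<otimes> y" ?D] D that(4,5)
    by simp
  have "?D (v, 0) = v" for v
  proof -
    have "has_tangent M M (\<lambda>x. x \<otimes> \<one>) \<one> (\<lambda>v. ?D (v, 0))"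
      by (rule DP[OF charted_M has_tangent_id has_tangent_const]) auto
    then have "has_tangent M M (\<lambda>x. x) \<one> (\<lambda>v. ?D (v, 0))"
      by (rule has_tangent_cong[OF charted_M, rotated]) auto
    from has_tangent_unique[OF charted_M this has_tangent_id] show ?thesis by simp
  qed
  then have D1: "?D (v, 0) = v" for v .
  have "?D (0, v) = v" for v
  proof -
    have "has_tangent M M (\<lambda>x. \<one> \<otimes> x) \<one> (\<lambda>v. ?D (0, v))"
      by (rule DP[OF charted_M has_tangent_const has_tangent_id]) auto
    then have "has_tangent M M (\<lambda>x. x) \<one> (\<lambda>v. ?D (0, v))"
      by (rule has_tangent_cong[OF charted_M, rotated]) auto
    from has_tangent_unique[OF charted_M this has_tangent_id] show ?thesis by simp
  qed
  then have "?D (v, w) = v + w" for v w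
    using D.add[of "(v, 0)" "(0, w)"] D1 by simp
  with DP[OF N f(1) g(1) f(2) g(2)] show ?thesis by simp
qed

text \<open>Obtained by differentiating \<open>x \<otimes> inv x = \<one>\<close> at the
  identity.\<close>

lemma has_tangent_inv_one:
  assumes N: "charted N" and f: "has_tangent N M f p T" "f p = \<one>"
  shows "has_tangent N M (\<lambda>x. inv (f x)) p (\<lambda>v. - T v)"
proof -
  let ?I = "tangent_map M M (\<lambda>x. inv x) \<one>"
  have I: "has_tangent M M (\<lambda>x. inv x) \<one> ?I"
    by (intro smooth_map_has_tangent smooth_inv) auto
  have "has_tangent M M (\<lambda>x. x \<otimes> inv x) \<one> (\<lambda>v. v + ?I v)"
    by (intro has_tangent_mult_one has_tangent_id I) auto
  then have "has_tangent M M (\<lambda>x. \<one>) \<one> (\<lambda>v. v + ?I v)"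
    by (rule has_tangent_cong[OF charted_M, rotated]) auto
  from has_tangent_unique[OF charted_M this has_tangent_const] have "v + ?I v = 0" for v by simp
  then have "?I v = - v" for v by (simp add: eq_neg_iff_add_eq_0 add.commute)
  moreover have "has_tangent N M (\<lambda>x. inv (f x)) p (\<lambda>v. ?I (T v))"
    using has_tangent_compose[OF N charted_M f(1), of M "\<lambda>x. inv x" ?I] I f(2) by simp
  ultimately show ?thesis by simp
qed

subsection \<open>The bracket as derivative of the adjoint action\<close>

abbreviation D\<^sub>1 :: "'g set" where "D\<^sub>1 \<equiv> dom_at M \<one>"
abbreviation \<phi>\<^sub>1 :: "'g \<Rightarrow> 'a" where "\<phi>\<^sub>1 \<equiv> coord_at M \<one>"
abbreviation \<psi>\<^sub>1 :: "'a \<Rightarrow> 'g" where "\<psi>\<^sub>1 \<equiv> param_at M \<one>"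

text \<open>A map on G x G read through the chart at the identity in both arguments and in the
  value. It is total, but has meaning only where the points and the value lie in that chart.\<close>

definition local_rep :: "('g \<times> 'g \<Rightarrow> 'g) \<Rightarrow> 'a \<times> 'a \<Rightarrow> 'a" where
  "local_rep f z = \<phi>\<^sub>1 (f (\<psi>\<^sub>1 (fst z), \<psi>\<^sub>1 (snd z)))"

lemma D\<^sub>1: "(D\<^sub>1, \<phi>\<^sub>1) \<in> atlas M" "\<one> \<in> D\<^sub>1" "D\<^sub>1 \<subseteq> carrier G" "inj_on \<phi>\<^sub>1 D\<^sub>1" "open (\<phi>\<^sub>1 ` D\<^sub>1)"
  using charted_at[OF charted_M, of \<one>] charted_chart[OF charted_M charted_at(1)[OF charted_M, of \<one>]]
    charted_chart(5)[OF charted_M charted_at(1)[OF charted_M, of \<one>] openin_topspace]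
  by (auto simp: Int_absorb2)

lemma \<psi>\<^sub>1_\<phi>\<^sub>1 [simp]: "x \<in> D\<^sub>1 \<Longrightarrow> \<psi>\<^sub>1 (\<phi>\<^sub>1 x) = x"
  using D\<^sub>1(4) by simp

lemma local_rep_smooth:
  assumes f: "smooth_map (prod_mfd M M) M f"
  shows "\<exists>Z. open Z \<and> (\<forall>a\<in>D\<^sub>1. \<forall>b\<in>D\<^sub>1. f (a, b) \<in> D\<^sub>1 \<longrightarrow> (\<phi>\<^sub>1 a, \<phi>\<^sub>1 b) \<in> Z) \<and>
    (\<forall>z\<in>Z. \<exists>a\<in>D\<^sub>1. \<exists>b\<in>D\<^sub>1. z = (\<phi>\<^sub>1 a, \<phi>\<^sub>1 b) \<and> f (a, b) \<in> D\<^sub>1) \<and>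
    (\<forall>k. k_smooth_on k UNIV Z (local_rep f))"
proof (intro exI conjI allI ballI impI)
  let ?Z = "map_prod \<phi>\<^sub>1 \<phi>\<^sub>1 ` {x \<in> D\<^sub>1 \<times> D\<^sub>1. f x \<in> D\<^sub>1}"
  have at: "(D\<^sub>1 \<times> D\<^sub>1, map_prod \<phi>\<^sub>1 \<phi>\<^sub>1) \<in> atlas (prod_mfd M M)"
    using D\<^sub>1(1) unfolding prod_mfd_atlas by blast
  have "openin (top_of_set (model (prod_mfd M M))) ?Z"
    by (rule chart_preimage_open[OF charted_MM at smooth_mapD(1)[OF f] charted_chart(1)[OF charted_M D\<^sub>1(1)]])
  then show oZ: "open ?Z" by (simp add: subtopology_UNIV)
  show "(\<phi>\<^sub>1 a, \<phi>\<^sub>1 b) \<in> ?Z" if "a \<in> D\<^sub>1" "b \<in> D\<^sub>1" "f (a, b) \<in> D\<^sub>1" for a b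
    using that by force
  show "\<exists>a\<in>D\<^sub>1. \<exists>b\<in>D\<^sub>1. z = (\<phi>\<^sub>1 a, \<phi>\<^sub>1 b) \<and> f (a, b) \<in> D\<^sub>1" if "z \<in> ?Z" for z
    using that by auto
  have inj: "inj_on (map_prod \<phi>\<^sub>1 \<phi>\<^sub>1) (D\<^sub>1 \<times> D\<^sub>1)"
    using charted_chart(3)[OF charted_MM at] .
  show "k_smooth_on k UNIV ?Z (local_rep f)" for k
  proof (rule k_smooth_on_cong)
    show "openin (top_of_set UNIV) ?Z" using oZ by (simp add: subtopology_UNIV)
    show "k_smooth_on k UNIV ?Z (\<phi>\<^sub>1 \<circ> f \<circ> inv_into (D\<^sub>1 \<times> D\<^sub>1) (map_prod \<phi>\<^sub>1 \<phi>\<^sub>1))"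
      using smooth_onD[OF smooth_mapD(2)[OF f at D\<^sub>1(1)]] by simp
    fix y assume "y \<in> ?Z"
    then obtain a b where ab: "a \<in> D\<^sub>1" "b \<in> D\<^sub>1" "y = (\<phi>\<^sub>1 a, \<phi>\<^sub>1 b)" by auto
    have "inv_into (D\<^sub>1 \<times> D\<^sub>1) (map_prod \<phi>\<^sub>1 \<phi>\<^sub>1) (map_prod \<phi>\<^sub>1 \<phi>\<^sub>1 (a, b)) = (a, b)"
      by (rule inv_into_f_f[OF inj]) (use ab in auto)
    then show "(\<phi>\<^sub>1 \<circ> f \<circ> inv_into (D\<^sub>1 \<times> D\<^sub>1) (map_prod \<phi>\<^sub>1 \<phi>\<^sub>1)) y = local_rep f y"
      using ab by (simp add: local_rep_def)
  qed
qed

lemma local_rep_partial: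
  assumes f: "smooth_map (prod_mfd M M) M f" and a: "a \<in> D\<^sub>1" "f (a, \<one>) \<in> D\<^sub>1"
  shows "((\<lambda>y. \<phi>\<^sub>1 (f (a, \<psi>\<^sub>1 y))) has_derivative
    (\<lambda>v. frechet_derivative (local_rep f) (at (\<phi>\<^sub>1 a, \<phi>\<^sub>1 \<one>)) (0, v))) (at (\<phi>\<^sub>1 \<one>))"
proof -
  obtain Z where Z: "open Z" "\<forall>a\<in>D\<^sub>1. \<forall>b\<in>D\<^sub>1. f (a, b) \<in> D\<^sub>1 \<longrightarrow> (\<phi>\<^sub>1 a, \<phi>\<^sub>1 b) \<in> Z"
    "\<forall>k. k_smooth_on k UNIV Z (local_rep f)"
    using local_rep_smooth[OF f] by blast
  have "(local_rep f has_derivative frechet_derivative (local_rep f) (at (\<phi>\<^sub>1 a, \<phi>\<^sub>1 \<one>))) (at (\<phi>\<^sub>1 a, \<phi>\<^sub>1 \<one>))"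
    using k_smooth_on_SucD[OF Z(3)[rule_format]] Z(2) a D\<^sub>1(2) by simp
  from has_derivative_snd_slice[OF this] show ?thesis using a by (simp add: local_rep_def)
qed

text \<open>The value of the field at a is given in the preferred chart at a and carried over to the
  chart at the identity. By the chain rule the chart at a cancels, leaving the partial derivative of
  the multiplication in its second argument.\<close>

lemma field_coord_left_invariant:
  assumes a: "a \<in> D\<^sub>1"
  shows "field_coord M (left_invariant_field G M \<xi>) \<one> (\<phi>\<^sub>1 a)
    = frechet_derivative (local_rep (\<lambda>(x, y). x \<otimes> y)) (at (\<phi>\<^sub>1 a, \<phi>\<^sub>1 \<one>)) (0, \<xi>)"
proof -
  have ac: "a \<in> carrier G" using a D\<^sub>1 by auto
  let ?D = "dom_at M a" and ?\<phi> = "coord_at M a" and ?\<psi> = "param_at M a"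
  have at: "(?D, ?\<phi>) \<in> atlas M" "a \<in> ?D" using charted_at[OF charted_M, of a] ac by auto
  have "smooth_on UNIV (?\<phi> ` (?D \<inter> D\<^sub>1)) (\<phi>\<^sub>1 \<circ> ?\<psi>)"
    using smooth_manifold at D\<^sub>1(1) unfolding smooth_manifold_def model_eq by blast
  then have E: "((\<phi>\<^sub>1 \<circ> ?\<psi>) has_derivative frechet_derivative (\<phi>\<^sub>1 \<circ> ?\<psi>) (at (?\<phi> a))) (at (?\<phi> a))"
    by (rule smooth_on_has_derivative) (use at a in auto)
  have L: "has_tangent M M (\<lambda>x. a \<otimes> x) \<one> (\<lambda>\<xi>. left_invariant_field G M \<xi> a)"
    using smooth_map_has_tangent[OF charted_M charted_M smooth_map_translate[OF ac], of \<one>]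
    by (simp add: left_invariant_field_def)
  then have T: "((\<lambda>x. ?\<phi> (a \<otimes> \<psi>\<^sub>1 x)) has_derivative (\<lambda>\<xi>. left_invariant_field G M \<xi> a)) (at (\<phi>\<^sub>1 \<one>))"
    using ac by (simp add: has_tangent_def)
  have "((\<lambda>x. (\<phi>\<^sub>1 \<circ> ?\<psi>) (?\<phi> (a \<otimes> \<psi>\<^sub>1 x))) has_derivative
      (\<lambda>\<xi>. frechet_derivative (\<phi>\<^sub>1 \<circ> ?\<psi>) (at (?\<phi> a)) (left_invariant_field G M \<xi> a))) (at (\<phi>\<^sub>1 \<one>))"
    by (rule has_derivative_compose[OF T]) (use E ac D\<^sub>1(2) in \<open>simp del: o_apply add: comp_def\<close>)
  \<comment> \<open>For x near the identity \<open>a \<otimes> x\<close> stays in the chart at a,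
    where that chart and its inverse cancel.\<close>
  moreover obtain S where S: "openin (mtop M) S" "\<one> \<in> S" "\<forall>x\<in>S. a \<otimes> x \<in> ?D"
    using L charted_chart(1)[OF charted_M at(1)] at(2) ac
    unfolding has_tangent_def topcontinuous_at_def by (metis r_one)
  ultimately have "((\<lambda>x. \<phi>\<^sub>1 (a \<otimes> \<psi>\<^sub>1 x)) has_derivative
      (\<lambda>\<xi>. frechet_derivative (\<phi>\<^sub>1 \<circ> ?\<psi>) (at (?\<phi> a)) (left_invariant_field G M \<xi> a))) (at (\<phi>\<^sub>1 \<one>))"
    using chart_cong[OF charted_M S(2,1), of "\<lambda>x. (\<phi>\<^sub>1 \<circ> ?\<psi>) (?\<phi> (a \<otimes> \<psi>\<^sub>1 x))" "\<lambda>x. \<phi>\<^sub>1 (a \<otimes> \<psi>\<^sub>1 x)"] ac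
    by simp
  moreover have "((\<lambda>x. \<phi>\<^sub>1 (a \<otimes> \<psi>\<^sub>1 x)) has_derivative
      (\<lambda>v. frechet_derivative (local_rep (\<lambda>(x, y). x \<otimes> y)) (at (\<phi>\<^sub>1 a, \<phi>\<^sub>1 \<one>)) (0, v))) (at (\<phi>\<^sub>1 \<one>))"
    using local_rep_partial[OF smooth_mult a] a ac by simp
  ultimately have "(\<lambda>\<xi>. frechet_derivative (\<phi>\<^sub>1 \<circ> ?\<psi>) (at (?\<phi> a)) (left_invariant_field G M \<xi> a))
      = (\<lambda>v. frechet_derivative (local_rep (\<lambda>(x, y). x \<otimes> y)) (at (\<phi>\<^sub>1 a, \<phi>\<^sub>1 \<one>)) (0, v))"
    by (rule has_derivative_unique)
  then show ?thesis
    using a by (simp add: field_coord_def Let_def fun_eq_iff)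
qed

lemma left_invariant_field_one: "left_invariant_field G M \<xi> \<one> = \<xi>"
proof -
  have "has_tangent M M (\<lambda>x. \<one> \<otimes> x) \<one> (\<lambda>\<xi>. left_invariant_field G M \<xi> \<one>)"
    using smooth_map_has_tangent[OF charted_M charted_M smooth_map_translate[OF one_closed], of \<one>]
    by (simp add: left_invariant_field_def)
  then have "has_tangent M M (\<lambda>x. x) \<one> (\<lambda>\<xi>. left_invariant_field G M \<xi> \<one>)"
    by (rule has_tangent_cong[OF charted_M, rotated]) auto
  from has_tangent_unique[OF charted_M this has_tangent_id] show ?thesis by simp
qed

text \<open>Left-invariant fields being partial derivatives of the multiplication, their bracket is
  an antisymmetrised mixed second derivative at the identity. The derivative of Ad yields the same
  expression when conjugation is multiplied back by a: the resulting identity involves the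
  multiplication and Ad only, and no second derivative of inversion.\<close>

lemma has_derivative_Ad_chart:
  "((\<lambda>x. Ad G M (\<psi>\<^sub>1 x) \<xi>) has_derivative (\<lambda>\<alpha>. lie_bracket G M \<alpha> \<xi>)) (at (\<phi>\<^sub>1 \<one>))"
proof -
  let ?e = "\<phi>\<^sub>1 \<one>"
  define m where "m = local_rep (\<lambda>(x, y). x \<otimes> y)"
  define k where "k = local_rep (\<lambda>(x, y). x \<otimes> y \<otimes> inv x)"
  \<comment> \<open>The second derivative of the multiplication at the pair of identities: v is the
    direction of the inner derivative, w that of the outer one.\<close>
  define P where "P v w = frechet_derivative (\<lambda>z. frechet_derivative m (at z) v) (at (?e, ?e)) w" for v w
  obtain Z where Z: "open Z" "\<forall>a\<in>D\<^sub>1. \<forall>b\<in>D\<^sub>1. a \<otimes> b \<in> D\<^sub>1 \<longrightarrow> (\<phi>\<^sub>1 a, \<phi>\<^sub>1 b) \<in> Z"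
    "\<forall>k. k_smooth_on k UNIV Z m"
    using local_rep_smooth[OF smooth_mult, folded m_def, unfolded split_conv] by blast
  obtain Zk where Zk: "open Zk"
    "\<forall>a\<in>D\<^sub>1. \<forall>b\<in>D\<^sub>1. a \<otimes> b \<otimes> inv a \<in> D\<^sub>1 \<longrightarrow> (\<phi>\<^sub>1 a, \<phi>\<^sub>1 b) \<in> Zk"
    "\<forall>z\<in>Zk. \<exists>a\<in>D\<^sub>1. \<exists>b\<in>D\<^sub>1. z = (\<phi>\<^sub>1 a, \<phi>\<^sub>1 b) \<and> a \<otimes> b \<otimes> inv a \<in> D\<^sub>1"
    "\<forall>j. k_smooth_on j UNIV Zk k"
    using local_rep_smooth[OF smooth_conjugation, folded k_def, unfolded split_conv] by blast
  note Z = Z(1) Z(2)[rule_format] Z(3)[rule_format]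
  note Zk = Zk(1) Zk(2)[rule_format] Zk(3)[rule_format] Zk(4)[rule_format]
  have c: "a \<in> carrier G" if "a \<in> D\<^sub>1" for a using that D\<^sub>1 by auto
  have eeZ: "(?e, ?e) \<in> Z" using Z(2) D\<^sub>1 by auto
  have Dm: "(m has_derivative frechet_derivative m (at z)) (at z)" if "z \<in> Z" for z
    using k_smooth_on_SucD[OF Z(3) that] .
  have sym: "P v w = P w v" for v w
    unfolding P_def using k_smooth_on_symmetric[OF Z(1) eeZ Z(3)] .
  have DP: "((\<lambda>x. frechet_derivative m (at (h x)) (q x)) has_derivative
      (\<lambda>v. frechet_derivative m (at (?e, ?e)) (Q v) + P (q ?e) (H v))) (at ?e)"
    if "(h has_derivative H) (at ?e)" "(q has_derivative Q) (at ?e)" "h ?e = (?e, ?e)" for h H q Q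
    using has_derivative_frechet_derivative_apply[OF Z(1) _ Z(3) that(1,2)] eeZ that(3)
    unfolding P_def by simp
  have field: "(field_coord M (left_invariant_field G M \<eta>) \<one> has_derivative (\<lambda>v. P (0, \<eta>) (v, 0))) (at ?e)" for \<eta>
  proof -
    have "((\<lambda>x. frechet_derivative m (at (x, ?e)) (0, \<eta>)) has_derivative
        (\<lambda>v. frechet_derivative m (at (?e, ?e)) 0 + P (0, \<eta>) (v, 0))) (at ?e)"
      by (rule DP) (auto intro!: derivative_eq_intros)
    moreover have "frechet_derivative m (at (?e, ?e)) 0 = 0"
      using Dm[OF eeZ] has_derivative_bounded_linear linear_simps(3) by blast
    ultimately have "((\<lambda>x. frechet_derivative m (at (x, ?e)) (0, \<eta>)) has_derivative (\<lambda>v. P (0, \<eta>) (v, 0))) (at ?e)"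
      by simp
    then show ?thesis
      by (rule has_derivative_transform_within_open[OF _ D\<^sub>1(5)])
         (use D\<^sub>1 in \<open>auto simp: field_coord_left_invariant m_def\<close>)
  qed
  have bracket: "lie_bracket G M \<alpha> \<xi> = P (0, \<xi>) (\<alpha>, 0) - P (0, \<alpha>) (\<xi>, 0)" for \<alpha>
    unfolding lie_bracket_def field_bracket_def Let_def model_eq left_invariant_field_one
    by (simp add: frechet_derivative_at[OF field, symmetric])
  define Q where "Q x = frechet_derivative k (at (x, ?e)) (0, \<xi>)" for x
  have Ad: "Ad G M a \<xi> = Q (\<phi>\<^sub>1 a)" if a: "a \<in> D\<^sub>1" for a
  proof -
    have "((\<lambda>y. \<phi>\<^sub>1 (a \<otimes> \<psi>\<^sub>1 y \<otimes> inv a)) has_derivative (\<lambda>v. frechet_derivative k (at (\<phi>\<^sub>1 a, ?e)) (0, v))) (at ?e)"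
      using local_rep_partial[OF smooth_conjugation a] a c D\<^sub>1(2) by (simp add: k_def)
    moreover have "((\<lambda>y. \<phi>\<^sub>1 (a \<otimes> \<psi>\<^sub>1 y \<otimes> inv a)) has_derivative Ad G M a) (at ?e)"
      using has_tangent_conj[OF c[OF a]] c[OF a] by (simp add: has_tangent_def)
    ultimately show ?thesis unfolding Q_def using has_derivative_unique by metis
  qed
  \<comment> \<open>Smoothness of the conjugation provides some derivative; its value is read off at
    the end from the differentiated identity \<open>key\<close>.\<close>
  obtain Q' where Q': "(Q has_derivative Q') (at ?e)"
  proof -
    have eeZk: "(?e, ?e) \<in> Zk" using Zk(2) D\<^sub>1 by auto
    have "((\<lambda>z. frechet_derivative k (at z) (0, \<xi>)) has_derivative
        frechet_derivative (\<lambda>z. frechet_derivative k (at z) (0, \<xi>)) (at (?e, ?e))) (at (?e, ?e))"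
      using k_smooth_on_SucD[of 0 UNIV Zk "\<lambda>z. frechet_derivative k (at z) (0, \<xi>)"] Zk(4)[of "Suc (Suc 0)"] eeZk
      by simp
    from that[unfolded Q_def, OF has_derivative_fst_slice[OF this]] show thesis .
  qed
  \<comment> \<open>\<open>(a b a\<^sup>-\<^sup>1) a = a b\<close>, differentiated in \<open>b\<close> at the identity\<close>
  have key: "frechet_derivative m (at (?e, x)) (Q x, 0) = frechet_derivative m (at (x, ?e)) (0, \<xi>)"
    if x: "x \<in> \<phi>\<^sub>1 ` D\<^sub>1" for x
  proof -
    obtain a where a: "a \<in> D\<^sub>1" "x = \<phi>\<^sub>1 a" using x by blast
    have xZk: "(x, ?e) \<in> Zk" and exZ: "(?e, x) \<in> Z" and xeZ: "(x, ?e) \<in> Z"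
      using Zk(2) Z(2) a D\<^sub>1 c by auto
    have kx: "k (x, ?e) = ?e" using a c D\<^sub>1 by (simp add: k_def local_rep_def)
    have "(k has_derivative frechet_derivative k (at (x, ?e))) (at (x, ?e))"
      using k_smooth_on_SucD[OF Zk(4) xZk] .
    from has_derivative_snd_slice[OF this] have "((\<lambda>y. (k (x, y), x)) has_derivative (\<lambda>v. (frechet_derivative k (at (x, ?e)) (0, v), 0))) (at ?e)"
      by (auto intro!: derivative_eq_intros)
    from has_derivative_compose[OF this, of m "frechet_derivative m (at (?e, x))"]
    have 1: "((\<lambda>y. m (k (x, y), x)) has_derivative
        (\<lambda>v. frechet_derivative m (at (?e, x)) (frechet_derivative k (at (x, ?e)) (0, v), 0))) (at ?e)"
      using Dm[OF exZ] kx by simp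
    have 2: "((\<lambda>y. m (x, y)) has_derivative (\<lambda>v. frechet_derivative m (at (x, ?e)) (0, v))) (at ?e)"
      by (rule has_derivative_snd_slice[OF Dm[OF xeZ]])
    \<comment> \<open>The two coordinate expressions agree only while the conjugate stays in the
      chart; this open slice of \<open>Zk\<close> secures that.\<close>
    have "open ((\<lambda>y. (x, y)) -` Zk)"
      by (intro open_vimage Zk continuous_intros)
    then have "((\<lambda>y. m (x, y)) has_derivative
        (\<lambda>v. frechet_derivative m (at (?e, x)) (frechet_derivative k (at (x, ?e)) (0, v), 0))) (at ?e)"
    proof (rule has_derivative_transform_within_open[OF 1])
      show "?e \<in> (\<lambda>y. (x, y)) -` Zk" using xZk by simp
      fix y assume "y \<in> (\<lambda>y. (x, y)) -` Zk"
      then obtain a' b where b: "a' \<in> D\<^sub>1" "b \<in> D\<^sub>1" "x = \<phi>\<^sub>1 a'" "y = \<phi>\<^sub>1 b" "a' \<otimes> b \<otimes> inv a' \<in> D\<^sub>1"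
        using Zk(3) by blast
      then have "a' \<otimes> b \<otimes> inv a' \<otimes> a' = a' \<otimes> b" using c by (simp add: m_assoc)
      then show "m (k (x, y), x) = m (x, y)"
        using b by (simp add: m_def k_def local_rep_def)
    qed
    from has_derivative_unique[OF this 2] show ?thesis unfolding Q_def by metis
  qed
  have Qe: "Q ?e = \<xi>" using Ad[OF D\<^sub>1(2)] by simp
  have Dm1: "frechet_derivative m (at (?e, ?e)) (v, 0) = v" for v
  proof -
    have "((\<lambda>y. m (y, ?e)) has_derivative (\<lambda>v. frechet_derivative m (at (?e, ?e)) (v, 0))) (at ?e)"
      by (rule has_derivative_fst_slice[OF Dm[OF eeZ]])
    then have "((\<lambda>y. y) has_derivative (\<lambda>v. frechet_derivative m (at (?e, ?e)) (v, 0))) (at ?e)"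
      by (rule has_derivative_transform_within_open[OF _ D\<^sub>1(5)])
         (use D\<^sub>1 c in \<open>auto simp: m_def local_rep_def\<close>)
    from has_derivative_unique[OF this has_derivative_ident] show ?thesis by metis
  qed
  \<comment> \<open>The base point \<open>(?e, x)\<close> moves with velocity \<open>(0, v)\<close>
    and the direction \<open>(Q x, 0)\<close> with velocity \<open>(Q' v, 0)\<close>. On the other
    side of \<open>key\<close> the direction is fixed and only a second derivative arises.\<close>
  have "((\<lambda>x. frechet_derivative m (at (?e, x)) (Q x, 0)) has_derivative
      (\<lambda>v. frechet_derivative m (at (?e, ?e)) (Q' v, 0) + P (Q ?e, 0) (0, v))) (at ?e)"
    by (rule DP) (use Q' in \<open>auto intro!: derivative_eq_intros\<close>)
  then have "((\<lambda>x. frechet_derivative m (at (x, ?e)) (0, \<xi>)) has_derivative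
      (\<lambda>v. Q' v + P (\<xi>, 0) (0, v))) (at ?e)"
    unfolding Dm1 Qe
    by (rule has_derivative_transform_within_open[OF _ D\<^sub>1(5)]) (use D\<^sub>1 key in auto)
  moreover have "((\<lambda>x. frechet_derivative m (at (x, ?e)) (0, \<xi>)) has_derivative
      (\<lambda>v. frechet_derivative m (at (?e, ?e)) 0 + P (0, \<xi>) (v, 0))) (at ?e)"
    by (rule DP) (auto intro!: derivative_eq_intros)
  moreover have "frechet_derivative m (at (?e, ?e)) 0 = 0" using Dm1[of 0] by (simp add: zero_prod_def)
  ultimately have "(\<lambda>v. Q' v + P (\<xi>, 0) (0, v)) = (\<lambda>v. P (0, \<xi>) (v, 0))"
    by (auto dest: has_derivative_unique)
  \<comment> \<open>Symmetry of \<open>P\<close> turns \<open>P (\<xi>, 0) (0, v)\<close> into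
    \<open>P (0, v) (\<xi>, 0)\<close>, the second term of \<open>bracket\<close>.\<close>
  then have "Q' = (\<lambda>\<alpha>. lie_bracket G M \<alpha> \<xi>)"
    by (simp add: fun_eq_iff bracket sym[of "(0, _)" "(\<xi>, 0)"] eq_diff_eq)
  then have "(Q has_derivative (\<lambda>\<alpha>. lie_bracket G M \<alpha> \<xi>)) (at ?e)" using Q' by simp
  then show ?thesis
    by (rule has_derivative_transform_within_open[OF _ D\<^sub>1(5)]) (use D\<^sub>1 Ad in auto)
qed

text \<open>The derivative is the chart statement; continuity in the topology of M follows by
  composing with the chart, which is itself continuous at the identity.\<close>

lemma has_tangent_Ad_one:
  "has_tangent M (vec_mfd UNIV) (\<lambda>h. Ad G M h \<xi>) \<one> (\<lambda>\<alpha>. lie_bracket G M \<alpha> \<xi>)"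
  unfolding has_tangent_vec_UNIV_iff
proof (intro conjI)
  have "isCont (\<lambda>x. Ad G M (\<psi>\<^sub>1 x) \<xi>) (\<phi>\<^sub>1 \<one>)"
    using has_derivative_Ad_chart has_derivative_continuous by blast
  from isCont_tendsto_compose[OF this coord_tendsto[OF charted_M]]
  have "((\<lambda>h. Ad G M (\<psi>\<^sub>1 (\<phi>\<^sub>1 h)) \<xi>) \<longlongrightarrow> Ad G M \<one> \<xi>) (atin (mtop M) \<one>)"
    using D\<^sub>1(2) by simp
  moreover have "\<forall>\<^sub>F h in atin (mtop M) \<one>. Ad G M (\<psi>\<^sub>1 (\<phi>\<^sub>1 h)) \<xi> = Ad G M h \<xi>"
    using charted_chart(1)[OF charted_M D\<^sub>1(1)] D\<^sub>1(2) by (auto simp: eventually_atin intro!: exI[of _ D\<^sub>1])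
  ultimately show "((\<lambda>h. Ad G M h \<xi>) \<longlongrightarrow> Ad G M \<one> \<xi>) (atin (mtop M) \<one>)"
    by (rule Lim_transform_eventually)
qed (simp_all add: has_derivative_Ad_chart)

text \<open>Writing F x as the product of F u and \<open>inv (F u) \<otimes> F x\<close>, the
  constant operator Ad of F u comes out in front, and the remaining factor is differentiated at the
  identity.\<close>

lemma has_tangent_Ad:
  assumes N: "charted N" and F: "has_tangent N M F u T"
  shows "has_tangent N (vec_mfd UNIV) (\<lambda>x. Ad G M (F x) \<xi>) u
    (\<lambda>w. Ad G M (F u) (lie_bracket G M (left_triv G M (F u) (T w)) \<xi>))"
proof -
  have Fc: "F x \<in> carrier G" if "x \<in> topspace (mtop N)" for x
    using F that by (auto simp: has_tangent_def topcontinuous_at_def)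
  note u = has_tangent_topspace(1)[OF F]
  have "has_tangent N (vec_mfd UNIV) (\<lambda>x. Ad G M (inv (F u) \<otimes> F x) \<xi>) u
      (\<lambda>w. lie_bracket G M (left_triv G M (F u) (T w)) \<xi>)"
    by (rule has_tangent_compose[OF N charted_M has_tangent_translate[OF N F]])
       (use has_tangent_Ad_one Fc[OF u] in simp)
  from has_tangent_bounded_linear[OF bounded_linear_Ad[OF Fc[OF u]] this]
  show ?thesis
    by (rule has_tangent_cong[OF N, rotated])
       (use Fc u in \<open>simp add: Ad_mult[symmetric] m_assoc[symmetric]\<close>)
qed

lemma lie_bracket_antisym: "lie_bracket G M \<xi> \<eta> = - lie_bracket G M \<eta> \<xi>"
  by (simp add: lie_bracket_def field_bracket_def Let_def)

text \<open>Linearity in the first argument is that of the derivative of Ad; antisymmetry, evident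
  from the definition by fields, transfers it to the second.\<close>

lemma bilinear_lie_bracket: "bilinear (lie_bracket G M)"
proof -
  have l: "linear (\<lambda>\<alpha>. lie_bracket G M \<alpha> \<xi>)" for \<xi>
    using has_tangent_linear[OF has_tangent_Ad_one] by (rule bounded_linear.linear)
  have "linear (\<lambda>\<alpha>. - lie_bracket G M \<alpha> \<xi>)" for \<xi>
    using l by (rule linear_compose_neg)
  then have "linear (lie_bracket G M \<xi>)" for \<xi>
    using lie_bracket_antisym[of \<xi>] by presburger
  with l show ?thesis by (simp add: bilinear_def)
qed

text \<open>Conjugating h by g and applying Ad to Ad_g \<eta> gives Ad_g Ad_h \<eta>; both sides are
  differentiated in h at the identity.\<close>

lemma Ad_lie_bracket:
  assumes g: "g \<in> carrier G"
  shows "Ad G M g (lie_bracket G M \<xi> \<eta>) = lie_bracket G M (Ad G M g \<xi>) (Ad G M g \<eta>)"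
proof -
  have "has_tangent M (vec_mfd UNIV) (\<lambda>h. Ad G M (g \<otimes> h \<otimes> inv g) (Ad G M g \<eta>)) \<one>
      (\<lambda>\<xi>. lie_bracket G M (Ad G M g \<xi>) (Ad G M g \<eta>))"
    by (rule has_tangent_compose[OF charted_M charted_M has_tangent_conj[OF g]])
       (use has_tangent_Ad_one g in simp)
  then have 1: "has_tangent M (vec_mfd UNIV) (\<lambda>h. Ad G M g (Ad G M h \<eta>)) \<one>
      (\<lambda>\<xi>. lie_bracket G M (Ad G M g \<xi>) (Ad G M g \<eta>))"
    by (rule has_tangent_cong[OF charted_M, rotated]) (use g in \<open>simp add: Ad_mult\<close>)
  have 2: "has_tangent M (vec_mfd UNIV) (\<lambda>h. Ad G M g (Ad G M h \<eta>)) \<one> (\<lambda>\<xi>. Ad G M g (lie_bracket G M \<xi> \<eta>))"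
    by (rule has_tangent_bounded_linear[OF bounded_linear_Ad[OF g] has_tangent_Ad_one])
  from has_tangent_unique[OF charted_M 2 1] show ?thesis by simp
qed

end

subsection \<open>The splitting of the Lie algebra at a momentum value\<close>

context lie_grp begin

lemma lie_bracket_simps [simp]:
  "lie_bracket G M (\<xi> + \<xi>') \<eta> = lie_bracket G M \<xi> \<eta> + lie_bracket G M \<xi>' \<eta>"
  "lie_bracket G M \<xi> (\<eta> + \<eta>') = lie_bracket G M \<xi> \<eta> + lie_bracket G M \<xi> \<eta>'"
  "lie_bracket G M (\<xi> - \<xi>') \<eta> = lie_bracket G M \<xi> \<eta> - lie_bracket G M \<xi>' \<eta>"
  "lie_bracket G M \<xi> (\<eta> - \<eta>') = lie_bracket G M \<xi> \<eta> - lie_bracket G M \<xi> \<eta>'"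
  "lie_bracket G M (r *\<^sub>R \<xi>) \<eta> = r *\<^sub>R lie_bracket G M \<xi> \<eta>"
  "lie_bracket G M 0 \<eta> = 0" "lie_bracket G M \<xi> 0 = 0"
  using bilinear_lie_bracket
  by (simp_all add: bilinear_ladd bilinear_radd bilinear_lsub bilinear_rsub bilinear_lzero bilinear_rzero bilinear_lmul)

lemma ad_star_apply [simp]:
  "blinfun_apply (ad_star G M \<eta> \<mu>) \<xi> = blinfun_apply \<mu> (lie_bracket G M \<eta> \<xi>)"
proof -
  have "bounded_linear (lie_bracket G M \<eta>)"
    using bilinear_lie_bracket by (simp add: bilinear_def linear_conv_bounded_linear)
  then have "bounded_linear (\<lambda>\<xi>. blinfun_apply \<mu> (lie_bracket G M \<eta> \<xi>))"
    by (rule bounded_linear_compose[OF blinfun.bounded_linear_right])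
  then show ?thesis by (simp add: ad_star_def bounded_linear_Blinfun_apply)
qed

lemma Ad_star_apply [simp]:
  assumes "g \<in> carrier G"
  shows "blinfun_apply (Ad_star G M g \<nu>) \<xi> = blinfun_apply \<nu> (Ad G M g \<xi>)"
proof -
  have "bounded_linear (\<lambda>\<xi>. blinfun_apply \<nu> (Ad G M g \<xi>))"
    by (rule bounded_linear_compose[OF blinfun.bounded_linear_right bounded_linear_Ad[OF assms]])
  then show ?thesis by (simp add: Ad_star_def bounded_linear_Blinfun_apply)
qed

lemma linear_ad_star: "linear (\<lambda>\<eta>. ad_star G M \<eta> \<mu>)"
  by (rule linearI) (auto intro!: blinfun_eqI simp: blinfun.bilinear_simps)

lemma bounded_linear_ad_star: "bounded_linear (\<lambda>\<eta>. ad_star G M \<eta> \<mu>)"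
  using linear_ad_star by (simp add: linear_conv_bounded_linear)

end

text \<open>The form \<open>ip\<close> need not be the inner product of the type. The complement of
  S for \<open>ip\<close> is the Euclidean complement of its image under a representing operator T;
  positivity makes T injective on S and S disjoint from the complement up to 0, and a dimension
  count finishes.\<close>

lemma inner_product_decomposition:
  fixes ip :: "'a::euclidean_space \<Rightarrow> 'a \<Rightarrow> real"
  assumes ip: "bilinear ip" "\<And>\<xi>. \<xi> \<noteq> 0 \<Longrightarrow> ip \<xi> \<xi> > 0" and S: "subspace S"
  shows "\<exists>\<alpha>\<in>S. \<forall>\<beta>\<in>S. ip \<beta> (\<xi> - \<alpha>) = 0"
proof -
  \<comment> \<open>The operator that represents \<open>ip\<close> through the Euclidean inner
    product.\<close>
  define T where "T \<alpha> = (\<Sum>b\<in>Basis. ip \<alpha> b *\<^sub>R b)" for \<alpha>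
  have T: "T \<alpha> \<bullet> \<beta> = ip \<alpha> \<beta>" for \<alpha> \<beta>
  proof -
    have "ip \<alpha> \<beta> = ip \<alpha> (\<Sum>b\<in>Basis. (\<beta> \<bullet> b) *\<^sub>R b)" by (simp add: euclidean_representation)
    also have "\<dots> = (\<Sum>b\<in>Basis. (\<beta> \<bullet> b) * ip \<alpha> b)"
      using ip(1) by (simp add: bilinear_def linear_sum linear_cmul)
    also have "\<dots> = T \<alpha> \<bullet> \<beta>"
      by (simp add: T_def inner_sum_left inner_commute[of \<beta>] mult.commute)
    finally show ?thesis by simp
  qed
  have lin: "linear T"
    using ip(1) by (intro linearI) (auto simp: T_def bilinear_ladd bilinear_lmul scaleR_add_left sum.distrib scaleR_sum_right)
  let ?N = "{\<eta>. \<forall>\<beta>\<in>T ` S. orthogonal \<beta> \<eta>}"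
  have TS: "subspace (T ` S)" using lin S by (rule linear_subspace_image)
  have N: "subspace ?N" by (rule subspace_orthogonal_to_vectors)
  have int: "S \<inter> ?N = {0}"
  proof
    show "S \<inter> ?N \<subseteq> {0}"
      using T ip(2) by (force simp: orthogonal_def)
    show "{0} \<subseteq> S \<inter> ?N" using S N subspace_0 by blast
  qed
  have "inj_on T S"
  proof (subst linear_injective_on_subspace_0[OF lin S], intro ballI impI)
    fix \<alpha> assume "T \<alpha> = 0"
    then have "ip \<alpha> \<alpha> = 0" using T[of \<alpha> \<alpha>] by simp
    then show "\<alpha> = 0" using ip(2)[of \<alpha>] by force
  qed
  then have "dim (T ` S) = dim S"
    using dim_image_eq[OF lin, of S] S span_eq_iff[of S, THEN iffD2] by simp
  moreover have "dim ?N + dim (T ` S) = DIM('a)"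
    using dim_subspace_orthogonal_to_vectors[OF TS subspace_UNIV] by simp
  ultimately have "dim {x + y |x y. x \<in> S \<and> y \<in> ?N} = DIM('a)"
    using dim_sums_Int[OF S N] int by simp
  then have "span {x + y |x y. x \<in> S \<and> y \<in> ?N} = UNIV"
    by (rule dim_eq_full[THEN iffD1])
  then have "{x + y |x y. x \<in> S \<and> y \<in> ?N} = UNIV"
    by (simp only: span_eq_iff[THEN iffD2, OF subspace_sums[OF S N]])
  then have "\<xi> \<in> {x + y |x y. x \<in> S \<and> y \<in> ?N}" by simp
  then obtain \<alpha> \<eta> where "\<xi> = \<alpha> + \<eta>" "\<alpha> \<in> S" "\<eta> \<in> ?N" by blast
  then show ?thesis using T by (intro bexI[of _ \<alpha>]) (auto simp: orthogonal_def)
qed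

locale momentum_value = lie_grp G M
  for G :: "('g, 'x) monoid_scheme" (structure) and M :: "('g, 'a::euclidean_space) mfd" +
  fixes ip :: "'a \<Rightarrow> 'a \<Rightarrow> real" and \<mu> :: "'a dual"
  assumes ip: "invariant_inner_product G M ip"
begin

abbreviation \<gg>\<^sub>\<mu> :: "'a set" where "\<gg>\<^sub>\<mu> \<equiv> isotropy_algebra G M \<mu>"
abbreviation \<gg>_perp :: "'a set" where "\<gg>_perp \<equiv> isotropy_perp G M ip \<mu>"
abbreviation \<gg>_dual :: "'a dual set" where "\<gg>_dual \<equiv> isotropy_dual G M ip \<mu>"
abbreviation T_orbit :: "'a dual set" where "T_orbit \<equiv> orbit_tangent G M ip \<mu>"
abbreviation ad_\<mu> :: "'a \<Rightarrow> 'a dual" where "ad_\<mu> \<eta> \<equiv> ad_star G M \<eta> \<mu>"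

lemma ip_bilinear: "bilinear ip" and ip_pos: "\<xi> \<noteq> 0 \<Longrightarrow> ip \<xi> \<xi> > 0"
  using ip by (simp_all add: invariant_inner_product_def)

lemma subspace_isotropy_algebra: "subspace \<gg>\<^sub>\<mu>"
  unfolding isotropy_algebra_def by (rule linear_subspace_kernel[OF linear_ad_star])

lemma subspace_isotropy_perp: "subspace \<gg>_perp"
  using ip_bilinear unfolding isotropy_perp_def subspace_def
  by (auto simp: bilinear_radd bilinear_rmul bilinear_rzero)

lemma subspace_isotropy_dual: "subspace \<gg>_dual"
  unfolding isotropy_dual_def subspace_def by (auto simp: blinfun.bilinear_simps)

lemma subspace_orbit_tangent: "subspace T_orbit"
  unfolding orbit_tangent_def by (rule linear_subspace_image[OF linear_ad_star subspace_isotropy_perp])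

lemma isotropy_perp_disjoint: "\<xi> \<in> \<gg>\<^sub>\<mu> \<Longrightarrow> \<xi> \<in> \<gg>_perp \<Longrightarrow> \<xi> = 0"
  using ip_pos[of \<xi>] unfolding isotropy_perp_def by force

lemma ad_\<mu>_inj: "inj_on ad_\<mu> \<gg>_perp"
  using isotropy_perp_disjoint
  by (subst linear_injective_on_subspace_0[OF linear_ad_star subspace_isotropy_perp])
     (auto simp: isotropy_algebra_def)

lemma orbit_tangent_rep_ad_star:
  "\<zeta> \<in> \<gg>_perp \<Longrightarrow> orbit_tangent_rep G M ip \<mu> (ad_\<mu> \<zeta>) = \<zeta>"
  unfolding orbit_tangent_rep_def using ad_\<mu>_inj by (intro the_equality) (auto dest: inj_onD)

text \<open>An element of the dual of the isotropy algebra annihilates the orthogonal part of \<xi>.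
  This removes the projections from \<open>Omega_Y\<close>.\<close>

lemma isotropy_component_apply:
  assumes "\<nu> \<in> \<gg>_dual"
  shows "blinfun_apply \<nu> (isotropy_component G M ip \<mu> \<xi>) = blinfun_apply \<nu> \<xi>"
proof -
  obtain \<alpha> where \<alpha>: "\<alpha> \<in> \<gg>\<^sub>\<mu>" "\<xi> - \<alpha> \<in> \<gg>_perp"
    using inner_product_decomposition[OF ip_bilinear ip_pos subspace_isotropy_algebra, of \<xi>]
    unfolding isotropy_perp_def by blast
  have "isotropy_component G M ip \<mu> \<xi> = \<alpha>"
    unfolding isotropy_component_def
  proof (rule the_equality)
    fix \<beta> assume \<beta>: "\<beta> \<in> \<gg>\<^sub>\<mu> \<and> \<xi> - \<beta> \<in> \<gg>_perp"
    have "\<beta> - \<alpha> \<in> \<gg>\<^sub>\<mu>" using \<alpha> \<beta> subspace_isotropy_algebra subspace_diff by blast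
    moreover have "(\<xi> - \<alpha>) - (\<xi> - \<beta>) \<in> \<gg>_perp" using \<alpha> \<beta> subspace_isotropy_perp subspace_diff by blast
    ultimately show "\<beta> = \<alpha>" using isotropy_perp_disjoint[of "\<beta> - \<alpha>"] by simp
  qed (use \<alpha> in blast)
  moreover have "blinfun_apply \<nu> (\<xi> - \<alpha>) = 0" using assms \<alpha>(2) unfolding isotropy_dual_def by blast
  ultimately show ?thesis by (simp add: blinfun.diff_right)
qed

text \<open>A continuous way to recover \<eta> from its image under ad*, from which the openness of
  the slice is derived.\<close>

lemma ad_star_left_inverse:
  obtains R :: "'a dual \<Rightarrow> 'a" where "bounded_linear R" "\<And>\<eta>. \<eta> \<in> \<gg>_perp \<Longrightarrow> R (ad_\<mu> \<eta>) = \<eta>"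
proof -
  \<comment> \<open>\<open>J\<close> reads a functional by its values on the basis, without loss.
    The left inverse is then sought between Euclidean spaces, where linear maps are bounded.\<close>
  define J :: "'a dual \<Rightarrow> 'a" where "J \<rho> = (\<Sum>b\<in>Basis. blinfun_apply \<rho> b *\<^sub>R b)" for \<rho>
  have J: "bounded_linear J"
    unfolding J_def by (intro bounded_linear_sum bounded_linear_scaleR_const blinfun.bounded_linear_left)
  have "\<rho> = 0" if "J \<rho> = 0" for \<rho>
  proof (rule blinfun_euclidean_eqI)
    fix b :: 'a assume b: "b \<in> Basis"
    have "J \<rho> \<bullet> b = blinfun_apply \<rho> b"
      using b by (simp add: J_def inner_sum_left inner_Basis if_distrib cong: if_cong)
    then show "blinfun_apply \<rho> b = blinfun_apply 0 b" using that by simp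
  qed
  moreover have lin: "linear (\<lambda>\<eta>. J (ad_\<mu> \<eta>))"
    using bounded_linear_compose[OF J bounded_linear_ad_star] by (rule bounded_linear.linear)
  ultimately have "inj_on (\<lambda>\<eta>. J (ad_\<mu> \<eta>)) \<gg>_perp"
    using isotropy_perp_disjoint
    by (subst linear_injective_on_subspace_0[OF lin subspace_isotropy_perp])
       (auto simp: isotropy_algebra_def)
  from linear_exists_left_inverse_on[OF lin subspace_isotropy_perp this]
  obtain L :: "'a \<Rightarrow> 'a" where L: "linear L" "\<And>\<eta>. \<eta> \<in> \<gg>_perp \<Longrightarrow> L (J (ad_\<mu> \<eta>)) = \<eta>" by auto
  show thesis
  proof
    show "bounded_linear (\<lambda>\<rho>. L (J \<rho>))"
      using L(1) J by (intro bounded_linear_compose[of L J]) (simp_all add: linear_conv_bounded_linear)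
  qed (rule L(2))
qed

end

subsection \<open>The slice model\<close>

text \<open>\<open>Y\<close>, \<open>P\<close> and \<open>C\<close> are parameters tied to their
  constructions by equations, so that statements keep short names and are unfolded only on
  demand.\<close>

locale slice = momentum_value G M ip \<mu>
  for G :: "('g, 'x) monoid_scheme" (structure) and M :: "('g, 'a::euclidean_space) mfd" and ip \<mu> +
  fixes U :: "('a dual \<times> 'a) set" and \<Phi> :: "'g \<times> 'a dual \<times> 'a dual \<Rightarrow> 'g \<times> 'a dual"
    and Y P C
  assumes openU: "openin (top_of_set (isotropy_dual G M ip \<mu> \<times> isotropy_perp G M ip \<mu>)) U"
    and Y: "Y = open_submfd (slice_model G M ip \<mu>) (slice_set G M \<mu> U)"
    and P: "P = open_submfd (slice_params G M ip \<mu>) U"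
    and C: "C = cotangent_mfd M"
    and smooth_\<Phi>: "smooth_map Y C \<Phi>"
begin

lemma U_sub: "(\<nu>, \<eta>) \<in> U \<Longrightarrow> \<nu> \<in> \<gg>_dual \<and> \<eta> \<in> \<gg>_perp"
  using openin_imp_subset[OF openU] by blast

lemma subspace_params: "subspace (\<gg>_dual \<times> \<gg>_perp)"
  by (intro subspace_Times subspace_isotropy_dual subspace_isotropy_perp)

text \<open>The slice is the full group times the preimage of U under a continuous map, which uses
  the left inverse of \<eta> to ad* on the orbit factor.\<close>

lemma openin_slice_set: "openin (mtop (slice_model G M ip \<mu>)) (slice_set G M \<mu> U)"
proof -
  obtain R :: "'a dual \<Rightarrow> 'a" where R: "bounded_linear R" "\<And>\<eta>. \<eta> \<in> \<gg>_perp \<Longrightarrow> R (ad_\<mu> \<eta>) = \<eta>"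
    using ad_star_left_inverse by blast
  have "continuous_on (\<gg>_dual \<times> T_orbit) (\<lambda>z. (fst z, R (snd z)))"
    by (intro continuous_intros bounded_linear.continuous_on[OF R(1)])
  then have c: "continuous_map (top_of_set (\<gg>_dual \<times> T_orbit)) (top_of_set (\<gg>_dual \<times> \<gg>_perp)) (\<lambda>z. (fst z, R (snd z)))"
    using R(2) by (auto simp: orbit_tangent_def)
  let ?V = "{z \<in> \<gg>_dual \<times> T_orbit. (fst z, R (snd z)) \<in> U}"
  have "openin (top_of_set (\<gg>_dual \<times> T_orbit)) ?V"
    using openin_continuous_map_preimage[OF c openU] by simp
  moreover have "slice_set G M \<mu> U = carrier G \<times> ?V"
  proof (intro Set.set_eqI iffI)
    fix z assume "z \<in> slice_set G M \<mu> U"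
    then obtain g \<nu> \<eta> where "z = (g, \<nu>, ad_\<mu> \<eta>)" "g \<in> carrier G" "(\<nu>, \<eta>) \<in> U"
      by (auto simp: slice_set_def)
    then show "z \<in> carrier G \<times> ?V" using U_sub R(2) by (auto simp: orbit_tangent_def)
  next
    fix z assume "z \<in> carrier G \<times> ?V"
    then show "z \<in> slice_set G M \<mu> U" using R(2) by (fastforce simp: slice_set_def orbit_tangent_def)
  qed
  ultimately show ?thesis
    using openin_topspace[of "mtop M"] by (simp add: slice_model_def openin_prod_Times_iff)
qed

lemma charted_slice_model: "charted (slice_model G M ip \<mu>)"
  unfolding slice_model_def
  by (intro charted_prod_mfd charted_vec_mfd charted_M subspace_isotropy_dual subspace_orbit_tangent)

lemma charted_slice_params: "charted (slice_params G M ip \<mu>)"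
  unfolding slice_params_def
  by (intro charted_prod_mfd charted_vec_mfd subspace_isotropy_dual subspace_isotropy_perp)

lemma openin_params: "openin (mtop (slice_params G M ip \<mu>)) U"
  using openU by (simp add: slice_params_def)

lemma charted_Y: "charted Y"
  unfolding Y by (intro charted_open_submfd charted_slice_model openin_slice_set)

lemma charted_P: "charted P"
  unfolding P by (intro charted_open_submfd charted_slice_params openin_params)

lemma charted_C: "charted C"
  unfolding C cotangent_mfd_def by (intro charted_prod_mfd charted_vec_mfd charted_M subspace_UNIV)

lemma topspace_Y [simp]: "topspace (mtop Y) = slice_set G M \<mu> U"
  using openin_subset[OF openin_slice_set] by (simp add: Y Int_absorb1)

lemma topspace_P [simp]: "topspace (mtop P) = U"
  using openin_subset[OF openin_params] by (simp add: P Int_absorb1)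

lemma topspace_C [simp]: "topspace (mtop C) = carrier G \<times> UNIV"
  by (simp add: C cotangent_mfd_def)

lemma model_Y [simp]: "model Y = UNIV \<times> \<gg>_dual \<times> T_orbit"
  by (simp add: Y slice_model_def)

lemma model_P [simp]: "model P = \<gg>_dual \<times> \<gg>_perp"
  by (simp add: P slice_params_def)

lemma slice_setI [intro]: "g \<in> carrier G \<Longrightarrow> (\<nu>, \<eta>) \<in> U \<Longrightarrow> (g, \<nu>, ad_\<mu> \<eta>) \<in> slice_set G M \<mu> U"
  by (auto simp: slice_set_def)

text \<open>Together with the inclusion of the parameters at fixed g this exhausts the tangent
  directions of Y, so the tangent map of \<Phi> is known from its restrictions to the two kinds of
  submanifold.\<close>

lemma has_tangent_group_inclusion:
  assumes g: "g \<in> carrier G" and u: "(\<nu>, \<eta>) \<in> U"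
  shows "has_tangent M Y (\<lambda>h. (h, \<nu>, ad_\<mu> \<eta>)) g (\<lambda>v. (v, 0))"
  unfolding Y
proof (rule has_tangent_open_cod)
  have "(\<nu>, ad_\<mu> \<eta>) \<in> topspace (mtop (prod_mfd (vec_mfd \<gg>_dual) (vec_mfd T_orbit)))"
    using U_sub[OF u] by (auto simp: orbit_tangent_def)
  then show "has_tangent M (slice_model G M ip \<mu>) (\<lambda>h. (h, \<nu>, ad_\<mu> \<eta>)) g (\<lambda>v. (v, 0))"
    unfolding slice_model_def
    by (intro has_tangent_Pair has_tangent_id has_tangent_const) (use g in auto)
qed (use u in auto)

lemma has_tangent_param_inclusion:
  assumes g: "g \<in> carrier G" and u: "u \<in> U"
  shows "has_tangent P Y (\<lambda>(\<nu>, \<eta>). (g, \<nu>, ad_\<mu> \<eta>)) u (\<lambda>(\<nu>, \<zeta>). (0, \<nu>, ad_\<mu> \<zeta>))"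
  unfolding Y
proof (rule has_tangent_open_cod)
  obtain \<nu> \<eta> where u': "u = (\<nu>, \<eta>)" by (cases u)
  have ne: "\<nu> \<in> \<gg>_dual" "\<eta> \<in> \<gg>_perp" using u u' U_sub by auto
  note ch = charted_vec_mfd[OF subspace_isotropy_dual] charted_vec_mfd[OF subspace_isotropy_perp]
  have 1: "has_tangent (slice_params G M ip \<mu>) (vec_mfd \<gg>_dual) fst u fst"
    unfolding slice_params_def u' by (rule has_tangent_fst[OF ch]) (use ne in auto)
  have 2: "has_tangent (slice_params G M ip \<mu>) (vec_mfd \<gg>_perp) snd u snd"
    unfolding slice_params_def u' by (rule has_tangent_snd[OF ch]) (use ne in auto)
  have 3: "has_tangent (slice_params G M ip \<mu>) (vec_mfd T_orbit) (\<lambda>u. ad_\<mu> (snd u)) u (\<lambda>v. ad_\<mu> (snd v))"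
    by (rule has_tangent_compose[OF charted_slice_params ch(2) 2], rule has_tangent_vec_mfd[OF bounded_linear_ad_star])
       (use ne u' in \<open>auto simp: orbit_tangent_def\<close>)
  have "has_tangent (slice_params G M ip \<mu>) M (\<lambda>_. g) u (\<lambda>_. 0)"
    by (rule has_tangent_const) (use g ne u' in \<open>auto simp: slice_params_def\<close>)
  from has_tangent_Pair[OF this has_tangent_Pair[OF 1 3]]
  have "has_tangent (slice_params G M ip \<mu>) (slice_model G M ip \<mu>) (\<lambda>(\<nu>, \<eta>). (g, \<nu>, ad_\<mu> \<eta>)) u (\<lambda>(\<nu>, \<zeta>). (0, \<nu>, ad_\<mu> \<zeta>))"
    unfolding slice_model_def by (simp add: case_prod_unfold)
  then show "has_tangent P (slice_model G M ip \<mu>) (\<lambda>(\<nu>, \<eta>). (g, \<nu>, ad_\<mu> \<eta>)) u (\<lambda>(\<nu>, \<zeta>). (0, \<nu>, ad_\<mu> \<zeta>))"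
    unfolding P by (rule has_tangent_open_dom[OF charted_slice_params openin_params u])
qed (use g in auto)

lemma has_tangent_\<Phi>:
  "y \<in> slice_set G M \<mu> U \<Longrightarrow> has_tangent Y C \<Phi> y (tangent_map Y C \<Phi> y)"
  using smooth_map_has_tangent[OF charted_Y charted_C smooth_\<Phi>] by simp

lemma has_tangent_C_fst: "q \<in> carrier G \<times> UNIV \<Longrightarrow> has_tangent C M fst q fst"
  unfolding C cotangent_mfd_def
  by (cases q) (auto intro!: has_tangent_fst charted_vec_mfd)

lemma has_tangent_C_snd: "q \<in> carrier G \<times> UNIV \<Longrightarrow> has_tangent C (vec_mfd UNIV) snd q snd"
  unfolding C cotangent_mfd_def
  by (cases q) (auto intro!: has_tangent_snd charted_vec_mfd)

lemma \<Phi>_in_C: "y \<in> slice_set G M \<mu> U \<Longrightarrow> \<Phi> y \<in> carrier G \<times> UNIV"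
  using has_tangent_topspace(2)[OF has_tangent_\<Phi>] by simp

lemma has_tangent_params_affine:
  assumes u: "u \<in> U"
  shows "has_tangent P (vec_mfd UNIV) (\<lambda>u. blinfun_apply (\<nu> + fst u) \<xi>) u (\<lambda>w. blinfun_apply (fst w) \<xi>)"
proof -
  obtain \<kappa> \<eta> where u': "u = (\<kappa>, \<eta>)" by (cases u)
  have ne: "\<kappa> \<in> \<gg>_dual" "\<eta> \<in> \<gg>_perp" using u u' U_sub by auto
  note ch = charted_vec_mfd[OF subspace_isotropy_dual] charted_vec_mfd[OF subspace_isotropy_perp]
  have 1: "has_tangent (slice_params G M ip \<mu>) (vec_mfd \<gg>_dual) fst u fst"
    unfolding slice_params_def u' by (rule has_tangent_fst[OF ch]) (use ne in auto)
  have "has_tangent (slice_params G M ip \<mu>) (vec_mfd UNIV) (\<lambda>u. blinfun_apply (fst u) \<xi>) u (\<lambda>w. blinfun_apply (fst w) \<xi>)"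
    by (rule has_tangent_compose[OF charted_slice_params ch(1) 1],
        rule has_tangent_vec_mfd[OF blinfun.bounded_linear_left]) (use ne u' in auto)
  then have P1: "has_tangent P (vec_mfd UNIV) (\<lambda>u. blinfun_apply (fst u) \<xi>) u (\<lambda>w. blinfun_apply (fst w) \<xi>)"
    unfolding P by (rule has_tangent_open_dom[OF charted_slice_params openin_params u])
  \<comment> \<open>The constant is negated so that \<open>has_tangent_diff\<close> produces a
    sum.\<close>
  have "has_tangent P (vec_mfd UNIV) (\<lambda>_. - blinfun_apply \<nu> \<xi>) u (\<lambda>_. 0)"
    by (rule has_tangent_const) (use u in auto)
  from has_tangent_diff[OF P1 this] show ?thesis
    by (simp add: blinfun.add_left add.commute)
qed

text \<open>The preferred charts of P are the identity, so a tangent in P is an ordinary derivative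
  relative to the parameter space.\<close>

lemma constant_on_params:
  assumes con: "connected U" and f: "\<And>u. u \<in> U \<Longrightarrow> has_tangent P (vec_mfd UNIV) f u (D u)"
    and D: "\<And>u v. u \<in> U \<Longrightarrow> v \<in> \<gg>_dual \<times> \<gg>_perp \<Longrightarrow> D u v = 0"
    and uw: "u \<in> U" "w \<in> U"
  shows "f u = f w"
proof (rule zero_derivative_within_imp_constant[OF subspace_params openU con _ D uw])
  fix u assume u: "u \<in> U"
  have cu: "coord_at P u x = x" for x by (cases x, cases u) (simp add: P slice_params_def)
  have "((\<lambda>x. f (param_at P u x)) has_derivative D u) (at (coord_at P u u) within model P)"
    using f[OF u] by (simp add: has_tangent_vec_UNIV_iff)
  then have "(f has_derivative D u) (at (coord_at P u u) within model P)"
    by (rule chart_cong[OF charted_P _ openin_topspace, rotated 2])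
       (use u param_coord[OF charted_P, of u] cu in auto)
  then show "(f has_derivative D u) (at u within \<gg>_dual \<times> \<gg>_perp)" by (simp add: cu)
qed

lemma P_atlas: "c \<in> atlas P \<longleftrightarrow> c = (U, map_prod id id)"
proof -
  have "c \<in> atlas P \<longleftrightarrow> c = ((\<gg>_dual \<times> \<gg>_perp) \<inter> U, map_prod id id)"
    by (simp add: P open_submfd_atlas slice_params_def prod_mfd_atlas)
  moreover have "(\<gg>_dual \<times> \<gg>_perp) \<inter> U = U"
    using openin_imp_subset[OF openU] by blast
  ultimately show ?thesis by simp
qed

text \<open>\<open>smooth_map_compose\<close> wants a full Euclidean model, whereas Y is modelled on
  a subspace. But over the identity element the parameters enter Y through a single chart and by an
  affine map, for which composition holds relative to subspaces.\<close>

lemma smooth_group_part: "smooth_map P M (\<lambda>u. fst (\<Phi> (\<one>, fst u, ad_\<mu> (snd u))))"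
proof (rule smooth_mapI)
  let ?a = "\<lambda>u. fst (\<Phi> (\<one>, fst u, ad_\<mu> (snd u)))"
  \<comment> \<open>Continuity comes as a by-product of the chain rule, being a component of
    \<open>has_tangent\<close>.\<close>
  have "topcontinuous_at (mtop P) (mtop M) ?a u" if u: "u \<in> U" for u
  proof -
    have y: "(\<one>, fst u, ad_\<mu> (snd u)) \<in> slice_set G M \<mu> U" using u by (cases u) auto
    have "has_tangent P C (\<lambda>u. \<Phi> ((\<lambda>(\<nu>, \<eta>). (\<one>, \<nu>, ad_\<mu> \<eta>)) u)) u
        (\<lambda>w. tangent_map Y C \<Phi> (\<one>, fst u, ad_\<mu> (snd u)) ((\<lambda>(\<nu>, \<zeta>). (0, \<nu>, ad_\<mu> \<zeta>)) w))"
      by (rule has_tangent_compose[OF charted_P charted_Y has_tangent_param_inclusion[OF one_closed u]])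
         (use has_tangent_\<Phi>[OF y] in \<open>simp add: case_prod_unfold\<close>)
    from has_tangent_compose[OF charted_P charted_C this has_tangent_C_fst] \<Phi>_in_C[OF y]
    show ?thesis by (simp add: case_prod_unfold has_tangent_def)
  qed
  then show cont: "continuous_map (mtop P) (mtop M) ?a"
    by (simp add: continuous_map_eq_topcontinuous_at)
  fix D \<phi> E \<psi> assume D: "(D, \<phi>) \<in> atlas P" and E: "(E, \<psi>) \<in> atlas M"
  have D_eq: "D = U" "\<phi> = map_prod id id" using D by (simp_all add: P_atlas)
  let ?S = "{u \<in> U. ?a u \<in> E}"
  have "openin (top_of_set (model P)) (\<phi> ` {u \<in> D. ?a u \<in> E})"
    by (rule chart_preimage_open[OF charted_P D cont charted_chart(1)[OF charted_M E]])
  then have S: "openin (top_of_set (\<gg>_dual \<times> \<gg>_perp)) ?S" by (simp add: D_eq map_prod.id)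
  \<comment> \<open>With the chart at the identity as group factor, this one chart of Y contains the
    image of all of U.\<close>
  let ?D = "(D\<^sub>1 \<times> \<gg>_dual \<times> T_orbit) \<inter> slice_set G M \<mu> U" and ?\<theta> = "map_prod \<phi>\<^sub>1 (map_prod id id)"
  have "(D\<^sub>1 \<times> \<gg>_dual \<times> T_orbit, ?\<theta>) \<in> atlas (slice_model G M ip \<mu>)"
    using D\<^sub>1(1) unfolding slice_model_def prod_mfd_atlas vec_mfd_simps by blast
  then have at: "(?D, ?\<theta>) \<in> atlas Y" unfolding Y open_submfd_atlas by blast
  have "(E \<times> UNIV, map_prod \<psi> id) \<in> atlas C"
    using E by (simp add: C cotangent_mfd_def prod_mfd_atlas) blast
  note sm = smooth_mapD(2)[OF smooth_\<Phi> at this]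
  have inj: "inj_on ?\<theta> ?D" by (rule charted_chart(3)[OF charted_Y at])
  define f where "f = map_prod \<psi> id \<circ> \<Phi> \<circ> inv_into ?D ?\<theta>"
  \<comment> \<open>\<open>L\<close> is the linear part of the inclusion in this chart; its
    translation part \<open>?c\<close> holds the coordinates of the identity.\<close>
  define L where "L u = (0 :: 'a, fst u :: 'a dual, ad_\<mu> (snd u))" for u
  let ?c = "(\<phi>\<^sub>1 \<one>, 0 :: 'a dual, 0 :: 'a dual)"
  have mem: "(\<one>, fst u, ad_\<mu> (snd u)) \<in> ?D" if "u \<in> U" for u
    using that U_sub[of "fst u" "snd u"] D\<^sub>1(2) by (cases u) (auto simp: orbit_tangent_def)
  have \<theta>: "?\<theta> (\<one>, fst u, ad_\<mu> (snd u)) = ?c + L u" for u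
    by (simp add: L_def)
  have f: "f (?c + L u) = map_prod \<psi> id (\<Phi> (\<one>, fst u, ad_\<mu> (snd u)))" if "u \<in> U" for u
    by (simp only: f_def o_apply \<theta>[symmetric] inv_into_f_f[OF inj mem[OF that]])
  have L: "bounded_linear L"
    unfolding L_def
    by (intro bounded_linear_Pair bounded_linear_zero bounded_linear_fst
        bounded_linear_compose[OF bounded_linear_ad_star bounded_linear_snd])
  let ?T = "?\<theta> ` {y \<in> ?D. \<Phi> y \<in> E \<times> UNIV}"
  have sm1: "k_smooth_on k (\<gg>_dual \<times> \<gg>_perp) ?S (\<lambda>u. f (?c + L u))" for k
  proof (rule k_smooth_on_compose_affine[OF subspace_params S L])
    show "k_smooth_on k (model Y) ?T f"
      using smooth_onD[OF sm] by (simp add: f_def)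
    show "?T \<subseteq> model Y" using charted_chart(4)[OF charted_Y at] by blast
    show "subspace (model Y)" using charted_Y by (rule charted_subspace)
    show "L v \<in> model Y" if "v \<in> \<gg>_dual \<times> \<gg>_perp" for v
      using that by (auto simp: L_def orbit_tangent_def)
    show "?c + L u \<in> ?T" if "u \<in> ?S" for u
      unfolding \<theta>[symmetric] by (rule imageI) (use that mem[of u] in \<open>simp add: mem_Times_iff\<close>)
  qed
  have "k_smooth_on k (\<gg>_dual \<times> \<gg>_perp) ?S (\<psi> \<circ> ?a \<circ> inv_into D \<phi>)" for k
  proof (rule k_smooth_on_cong[OF S _ k_smooth_on_bounded_linear[OF subspace_params S bounded_linear_fst sm1]])
    fix u assume u: "u \<in> ?S"
    have "inv_into U id u = u" using u inv_into_f_f[of id U u] by simp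
    then show "fst (f (?c + L u)) = (\<psi> \<circ> ?a \<circ> inv_into D \<phi>) u"
      using f u by (simp add: D_eq map_prod.id)
  qed
  then show "smooth_on (model P) (\<phi> ` {u \<in> D. ?a u \<in> E}) (\<psi> \<circ> ?a \<circ> inv_into D \<phi>)"
    by (simp add: smooth_on_def D_eq map_prod.id)
qed

end

subsection \<open>The pullback of the canonical form\<close>

text \<open>Common ground of both implications. In one, \<open>F\<close> and \<open>b\<close> are
  read off from \<Phi> over the identity; in the other, \<open>F\<close> is given and
  \<open>b\<close> is the coadjoint formula. Nothing ties \<open>b\<close> to \<mu> + \<nu>
  here.\<close>

locale slice_factor = slice G M ip \<mu> U \<Phi> Y P C
  for G :: "('g, 'x) monoid_scheme" (structure) and M :: "('g, 'a::euclidean_space) mfd" and ip \<mu> U \<Phi> Y P C +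
  fixes F :: "'a dual \<times> 'a \<Rightarrow> 'g" and b :: "'a dual \<times> 'a \<Rightarrow> 'a dual"
  assumes smooth_F: "smooth_map P M F"
    and \<Phi>_eq: "\<And>g \<nu> \<eta>. g \<in> carrier G \<Longrightarrow> (\<nu>, \<eta>) \<in> U \<Longrightarrow> \<Phi> (g, \<nu>, ad_star G M \<eta> \<mu>) = (g \<otimes> inv (F (\<nu>, \<eta>)), b (\<nu>, \<eta>))"
begin

abbreviation \<alpha> where "\<alpha> \<equiv> left_triv_deriv G M P F"

text \<open>Undoes the coadjoint action of F on the momentum: the formula for \<Phi> in the theorem
  holds exactly when \<open>c\<close> is \<mu> + \<nu>.\<close>

definition c :: "'a dual \<times> 'a \<Rightarrow> 'a dual" where "c u = Ad_star G M (F u) (b u)"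

text \<open>Taken over the identity element. Since the momentum component does not depend on g, any
  other g yields the same values on parameter directions.\<close>

definition Db :: "'a dual \<times> 'a \<Rightarrow> 'a dual \<times> 'a \<Rightarrow> 'a dual" where
  "Db u w = snd (tangent_map Y C \<Phi> (\<one>, fst u, ad_\<mu> (snd u)) (0, fst w, ad_\<mu> (snd w)))"

text \<open>The derivative of u to \<open><c u, \<xi>>\<close>, written out by the product rule for
  \<open>b\<close> and Ad_F. Fixing \<xi> keeps the differentiated functions real-valued.\<close>

definition Dc :: "'a dual \<times> 'a \<Rightarrow> 'a dual \<times> 'a \<Rightarrow> 'a \<Rightarrow> real" where
  "Dc u w \<xi> = blinfun_apply (b u) (Ad G M (F u) (lie_bracket G M (\<alpha> u w) \<xi>))
      + blinfun_apply (Db u w) (Ad G M (F u) \<xi>)"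

lemma has_tangent_F: "u \<in> U \<Longrightarrow> has_tangent P M F u (tangent_map P M F u)"
  using smooth_map_has_tangent[OF charted_P charted_M smooth_F] by simp

lemma F_carrier [simp]: "u \<in> U \<Longrightarrow> F u \<in> carrier G"
  using has_tangent_topspace(2)[OF has_tangent_F] by simp

lemma has_tangent_F_translate: "u \<in> U \<Longrightarrow> has_tangent P M (\<lambda>x. inv (F u) \<otimes> F x) u (\<alpha> u)"
  using has_tangent_translate[OF charted_P has_tangent_F] by (simp add: left_triv_deriv_def[abs_def])

lemma linear_\<alpha>: "u \<in> U \<Longrightarrow> linear (\<alpha> u)"
  using has_tangent_linear[OF has_tangent_F_translate] by (rule bounded_linear.linear)

lemma has_tangent_\<Phi>_param:
  assumes g: "g \<in> carrier G" and u: "u \<in> U"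
  shows "has_tangent P C (\<lambda>u. (g \<otimes> inv (F u), b u)) u
    (\<lambda>w. tangent_map Y C \<Phi> (g, fst u, ad_\<mu> (snd u)) (0, fst w, ad_\<mu> (snd w)))"
proof -
  have y: "(g, fst u, ad_\<mu> (snd u)) \<in> slice_set G M \<mu> U" using g u by (cases u) auto
  have "has_tangent P C (\<lambda>u. \<Phi> ((\<lambda>(\<nu>, \<eta>). (g, \<nu>, ad_\<mu> \<eta>)) u)) u
      (\<lambda>w. tangent_map Y C \<Phi> (g, fst u, ad_\<mu> (snd u)) ((\<lambda>(\<nu>, \<zeta>). (0, \<nu>, ad_\<mu> \<zeta>)) w))"
    by (rule has_tangent_compose[OF charted_P charted_Y has_tangent_param_inclusion[OF g u]])
       (use has_tangent_\<Phi>[OF y] in \<open>simp add: case_prod_unfold\<close>)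
  then have "has_tangent P C (\<lambda>u. (g \<otimes> inv (F u), b u)) u
      (\<lambda>w. tangent_map Y C \<Phi> (g, fst u, ad_\<mu> (snd u)) ((\<lambda>(\<nu>, \<zeta>). (0, \<nu>, ad_\<mu> \<zeta>)) w))"
    by (rule has_tangent_cong[OF charted_P, rotated]) (use g \<Phi>_eq in auto)
  then show ?thesis by (simp add: case_prod_unfold)
qed

lemma has_tangent_b_aux:
  assumes g: "g \<in> carrier G" and u: "u \<in> U"
  shows "has_tangent P (vec_mfd UNIV) b u
    (\<lambda>w. snd (tangent_map Y C \<Phi> (g, fst u, ad_\<mu> (snd u)) (0, fst w, ad_\<mu> (snd w))))"
  using has_tangent_compose[OF charted_P charted_C has_tangent_\<Phi>_param[OF g u] has_tangent_C_snd] g u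
  by simp

lemma has_tangent_b: "u \<in> U \<Longrightarrow> has_tangent P (vec_mfd UNIV) b u (Db u)"
  using has_tangent_b_aux[OF one_closed] by (simp add: Db_def[abs_def])

lemma c_apply: "u \<in> U \<Longrightarrow> blinfun_apply (c u) \<xi> = blinfun_apply (b u) (Ad G M (F u) \<xi>)"
  by (simp add: c_def)

lemma has_tangent_c:
  assumes u: "u \<in> U"
  shows "has_tangent P (vec_mfd UNIV) (\<lambda>u. blinfun_apply (c u) \<xi>) u (\<lambda>w. Dc u w \<xi>)"
proof -
  have "has_tangent P (vec_mfd UNIV) (\<lambda>u. blinfun_apply (b u) (Ad G M (F u) \<xi>)) u (\<lambda>w. Dc u w \<xi>)"
    using has_tangent_bilinear[OF charted_P bounded_bilinear_blinfun_apply has_tangent_b[OF u]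
        has_tangent_Ad[OF charted_P has_tangent_F[OF u], of \<xi>]]
    by (simp add: Dc_def left_triv_deriv_def)
  then show ?thesis
    by (rule has_tangent_cong[OF charted_P, rotated]) (simp add: c_apply)
qed

text \<open>The tangent vector is split into a group and a parameter direction. In each, the image
  translated to the identity is a conjugate by F u of a map through the identity, whence the common
  factor Ad_F.\<close>

lemma tangent_\<Phi>:
  assumes g: "g \<in> carrier G" and u: "(\<nu>, \<eta>) \<in> U" and w: "\<nu>' \<in> \<gg>_dual" "\<zeta> \<in> \<gg>_perp"
  defines "y \<equiv> (g, \<nu>, ad_\<mu> \<eta>)" and "w \<equiv> (\<nu>', \<zeta>)"
  shows "left_triv G M (fst (\<Phi> y)) (fst (tangent_map Y C \<Phi> y (v, \<nu>', ad_\<mu> \<zeta>)))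
      = Ad G M (F (\<nu>, \<eta>)) (left_triv G M g v - \<alpha> (\<nu>, \<eta>) w)" (is ?A)
    and "snd (tangent_map Y C \<Phi> y (v, \<nu>', ad_\<mu> \<zeta>)) = Db (\<nu>, \<eta>) w" (is ?B)
proof -
  let ?u = "(\<nu>, \<eta>)" and ?T = "tangent_map Y C \<Phi> y" and ?q = "fst (\<Phi> y)"
  have y: "y \<in> slice_set G M \<mu> U" using g u by (auto simp: y_def)
  have Fu: "F ?u \<in> carrier G" using u by simp
  have q: "?q = g \<otimes> inv (F ?u)" and qc: "?q \<in> carrier G" using \<Phi>_eq[OF g u] g Fu by (auto simp: y_def)
  interpret T: bounded_linear ?T using has_tangent_\<Phi>[OF y] by (rule has_tangent_linear)
  interpret L: bounded_linear "left_triv G M ?q" using qc by (rule bounded_linear_left_triv)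
  interpret AdF: bounded_linear "Ad G M (F ?u)" using Fu by (rule bounded_linear_Ad)
  have split: "?T (v, \<nu>', ad_\<mu> \<zeta>) = ?T (v, 0) + ?T (0, \<nu>', ad_\<mu> \<zeta>)"
    using T.add[of "(v, 0)" "(0, \<nu>', ad_\<mu> \<zeta>)"] by simp
  have wm: "w \<in> model P" using w by (simp add: w_def)

  have G1: "has_tangent M C (\<lambda>h. (h \<otimes> inv (F ?u), b ?u)) g (\<lambda>v. ?T (v, 0))"
  proof -
    have "has_tangent M C (\<lambda>h. \<Phi> (h, \<nu>, ad_\<mu> \<eta>)) g (\<lambda>v. ?T (v, 0))"
      by (rule has_tangent_compose[OF charted_M charted_Y has_tangent_group_inclusion[OF g u]])
         (use has_tangent_\<Phi>[OF y] in \<open>simp add: y_def\<close>)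
    then show ?thesis
      by (rule has_tangent_cong[OF charted_M, rotated]) (use u \<Phi>_eq in simp)
  qed
  have gq: "(g \<otimes> inv (F ?u), b ?u) \<in> carrier G \<times> UNIV" using g Fu by simp
  have "has_tangent M (vec_mfd UNIV) (\<lambda>h. b ?u) g (\<lambda>v. snd (?T (v, 0)))"
    using has_tangent_compose[OF charted_M charted_C G1 has_tangent_C_snd[OF gq]] by simp
  from has_tangent_unique[OF charted_M this has_tangent_const] g
  have snd0: "snd (?T (v, 0)) = 0" by simp
  have "has_tangent M M (\<lambda>h. h \<otimes> inv (F ?u)) g (\<lambda>v. fst (?T (v, 0)))"
    using has_tangent_compose[OF charted_M charted_C G1 has_tangent_C_fst[OF gq]] by simp
  from has_tangent_translate[OF charted_M this]
  have 1: "has_tangent M M (\<lambda>h. inv ?q \<otimes> (h \<otimes> inv (F ?u))) g (\<lambda>v. left_triv G M ?q (fst (?T (v, 0))))"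
    by (simp add: q)
  have gg: "has_tangent M M (\<lambda>h. inv g \<otimes> h) g (left_triv G M g)"
    using has_tangent_translate[OF charted_M has_tangent_id[OF charted_M, of g]] g by simp
  \<comment> \<open>Because \<open>inv ?q\<close> is \<open>F ?u \<otimes> inv g\<close>, the
    translated map is the conjugate by \<open>F ?u\<close> of
    \<open>inv g \<otimes> h\<close>.\<close>
  have "has_tangent M M (\<lambda>h. F ?u \<otimes> (inv g \<otimes> h) \<otimes> inv (F ?u)) g (\<lambda>v. Ad G M (F ?u) (left_triv G M g v))"
    by (rule has_tangent_compose[OF charted_M charted_M gg]) (use has_tangent_conj[OF Fu] g in simp)
  then have 2: "has_tangent M M (\<lambda>h. inv ?q \<otimes> (h \<otimes> inv (F ?u))) g (\<lambda>v. Ad G M (F ?u) (left_triv G M g v))"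
    by (rule has_tangent_cong[OF charted_M, rotated]) (use g Fu in \<open>simp add: q inv_mult_group m_assoc\<close>)
  have fst0: "left_triv G M ?q (fst (?T (v, 0))) = Ad G M (F ?u) (left_triv G M g v)"
    using has_tangent_unique[OF charted_M 1 2] by simp

  have P1: "has_tangent P C (\<lambda>u. (g \<otimes> inv (F u), b u)) ?u (\<lambda>w. ?T (0, fst w, ad_\<mu> (snd w)))"
    using has_tangent_\<Phi>_param[OF g u] by (simp add: y_def)
  have snd1: "snd (?T (0, \<nu>', ad_\<mu> \<zeta>)) = Db ?u w"
    using has_tangent_unique[OF charted_P has_tangent_b_aux[OF g u] has_tangent_b[OF u] wm]
    by (simp add: y_def w_def)
  have "has_tangent P M (\<lambda>u. g \<otimes> inv (F u)) ?u (\<lambda>w. fst (?T (0, fst w, ad_\<mu> (snd w))))"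
    using has_tangent_compose[OF charted_P charted_C P1 has_tangent_C_fst[OF gq]] by simp
  from has_tangent_translate[OF charted_P this]
  have 3: "has_tangent P M (\<lambda>u. inv ?q \<otimes> (g \<otimes> inv (F u))) ?u
      (\<lambda>w. left_triv G M ?q (fst (?T (0, fst w, ad_\<mu> (snd w)))))"
    by (simp add: q)
  \<comment> \<open>Here the translated map is \<open>F ?u \<otimes> inv (F x)\<close>, rewritten as
    a conjugate of the inverse of \<open>inv (F ?u) \<otimes> F x\<close>; inversion is thus
    differentiated at the identity, giving the minus sign.\<close>
  have "has_tangent P M (\<lambda>x. inv (inv (F ?u) \<otimes> F x)) ?u (\<lambda>w. - \<alpha> ?u w)"
    by (rule has_tangent_inv_one[OF charted_P has_tangent_F_translate[OF u]]) (use Fu in simp)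
  then have "has_tangent P M (\<lambda>x. F ?u \<otimes> inv (inv (F ?u) \<otimes> F x) \<otimes> inv (F ?u)) ?u (\<lambda>w. Ad G M (F ?u) (- \<alpha> ?u w))"
    by (rule has_tangent_compose[OF charted_P charted_M]) (use has_tangent_conj[OF Fu] Fu in simp)
  then have 4: "has_tangent P M (\<lambda>u. inv ?q \<otimes> (g \<otimes> inv (F u))) ?u (\<lambda>w. Ad G M (F ?u) (- \<alpha> ?u w))"
  proof (rule has_tangent_cong[OF charted_P, rotated])
    fix x assume "x \<in> topspace (mtop P)"
    then have x: "F x \<in> carrier G" by simp
    have "inv g \<otimes> (g \<otimes> inv (F x)) = inv (F x)" using g x by (simp flip: m_assoc)
    then have "inv ?q \<otimes> (g \<otimes> inv (F x)) = F ?u \<otimes> inv (F x)"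
      using g Fu x by (simp add: q inv_mult_group m_assoc)
    also have "\<dots> = F ?u \<otimes> inv (F x) \<otimes> (F ?u \<otimes> inv (F ?u))" using Fu x by simp
    also have "\<dots> = F ?u \<otimes> inv (inv (F ?u) \<otimes> F x) \<otimes> inv (F ?u)"
      using Fu x by (simp add: inv_mult_group m_assoc del: r_inv)
    finally show "F ?u \<otimes> inv (inv (F ?u) \<otimes> F x) \<otimes> inv (F ?u) = inv ?q \<otimes> (g \<otimes> inv (F x))" ..
  qed
  have fst1: "left_triv G M ?q (fst (?T (0, \<nu>', ad_\<mu> \<zeta>))) = Ad G M (F ?u) (- \<alpha> ?u w)"
    using has_tangent_unique[OF charted_P 3 4 wm] by (simp add: w_def)
  show ?A unfolding split by (simp add: L.add fst0 fst1 AdF.diff AdF.neg)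
  show ?B unfolding split by (simp add: snd0 snd1)
qed

text \<open>Ad_F respects brackets and passes onto the momentum, turning b into c. Replacing the
  derivative of b by that of c costs brackets with \<alpha>, which cancel the mixed terms of the
  main bracket.\<close>

lemma pullback_Omega_c:
  fixes v\<^sub>1 v\<^sub>2 :: 'a
  assumes g: "g \<in> carrier G" and u: "(\<nu>, \<eta>) \<in> U"
    and w: "\<nu>\<^sub>1 \<in> \<gg>_dual" "\<zeta>\<^sub>1 \<in> \<gg>_perp" "\<nu>\<^sub>2 \<in> \<gg>_dual" "\<zeta>\<^sub>2 \<in> \<gg>_perp"
  defines "\<xi>\<^sub>1 \<equiv> left_triv G M g v\<^sub>1" and "\<xi>\<^sub>2 \<equiv> left_triv G M g v\<^sub>2"
    and "\<alpha>\<^sub>1 \<equiv> \<alpha> (\<nu>, \<eta>) (\<nu>\<^sub>1, \<zeta>\<^sub>1)" and "\<alpha>\<^sub>2 \<equiv> \<alpha> (\<nu>, \<eta>) (\<nu>\<^sub>2, \<zeta>\<^sub>2)"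
  shows "form_pullback Y C \<Phi> (Omega_c G M) (g, \<nu>, ad_\<mu> \<eta>) (v\<^sub>1, \<nu>\<^sub>1, ad_\<mu> \<zeta>\<^sub>1) (v\<^sub>2, \<nu>\<^sub>2, ad_\<mu> \<zeta>\<^sub>2)
    = blinfun_apply (c (\<nu>, \<eta>)) (lie_bracket G M \<xi>\<^sub>1 \<xi>\<^sub>2) - blinfun_apply (c (\<nu>, \<eta>)) (lie_bracket G M \<alpha>\<^sub>1 \<alpha>\<^sub>2)
      + Dc (\<nu>, \<eta>) (\<nu>\<^sub>2, \<zeta>\<^sub>2) (\<xi>\<^sub>1 - \<alpha>\<^sub>1) - Dc (\<nu>, \<eta>) (\<nu>\<^sub>1, \<zeta>\<^sub>1) (\<xi>\<^sub>2 - \<alpha>\<^sub>2)"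
proof -
  let ?u = "(\<nu>, \<eta>)" and ?T = "tangent_map Y C \<Phi> (g, \<nu>, ad_\<mu> \<eta>)"
  let ?A = "Ad G M (F ?u)"
  have F: "F ?u \<in> carrier G" using u by simp
  have b: "snd (\<Phi> (g, \<nu>, ad_\<mu> \<eta>)) = b ?u" using \<Phi>_eq[OF g u] by simp
  note T1 = tangent_\<Phi>[OF g u w(1,2), of v\<^sub>1] and T2 = tangent_\<Phi>[OF g u w(3,4), of v\<^sub>2]
  have "form_pullback Y C \<Phi> (Omega_c G M) (g, \<nu>, ad_\<mu> \<eta>) (v\<^sub>1, \<nu>\<^sub>1, ad_\<mu> \<zeta>\<^sub>1) (v\<^sub>2, \<nu>\<^sub>2, ad_\<mu> \<zeta>\<^sub>2)
    = blinfun_apply (b ?u) (lie_bracket G M (?A (\<xi>\<^sub>1 - \<alpha>\<^sub>1)) (?A (\<xi>\<^sub>2 - \<alpha>\<^sub>2)))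
      + blinfun_apply (Db ?u (\<nu>\<^sub>2, \<zeta>\<^sub>2)) (?A (\<xi>\<^sub>1 - \<alpha>\<^sub>1)) - blinfun_apply (Db ?u (\<nu>\<^sub>1, \<zeta>\<^sub>1)) (?A (\<xi>\<^sub>2 - \<alpha>\<^sub>2))"
    unfolding form_pullback_def Omega_c_def case_prod_unfold Let_def T1 T2 b
      \<xi>\<^sub>1_def \<xi>\<^sub>2_def \<alpha>\<^sub>1_def \<alpha>\<^sub>2_def ..
  \<comment> \<open>Each term with \<open>Db\<close> is the corresponding \<open>Dc\<close> minus
    the bracket contributed by the variation of Ad_F.\<close>
  also have "\<dots> = blinfun_apply (c ?u) (lie_bracket G M (\<xi>\<^sub>1 - \<alpha>\<^sub>1) (\<xi>\<^sub>2 - \<alpha>\<^sub>2))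
      + (Dc ?u (\<nu>\<^sub>2, \<zeta>\<^sub>2) (\<xi>\<^sub>1 - \<alpha>\<^sub>1) - blinfun_apply (c ?u) (lie_bracket G M \<alpha>\<^sub>2 (\<xi>\<^sub>1 - \<alpha>\<^sub>1)))
      - (Dc ?u (\<nu>\<^sub>1, \<zeta>\<^sub>1) (\<xi>\<^sub>2 - \<alpha>\<^sub>2) - blinfun_apply (c ?u) (lie_bracket G M \<alpha>\<^sub>1 (\<xi>\<^sub>2 - \<alpha>\<^sub>2)))"
    by (simp only: Ad_lie_bracket[OF F, symmetric] c_apply[OF u] Dc_def \<alpha>\<^sub>1_def \<alpha>\<^sub>2_def)
  also have "\<dots> = blinfun_apply (c ?u) (lie_bracket G M (\<xi>\<^sub>1 - \<alpha>\<^sub>1) (\<xi>\<^sub>2 - \<alpha>\<^sub>2)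
        - lie_bracket G M \<alpha>\<^sub>2 (\<xi>\<^sub>1 - \<alpha>\<^sub>1) + lie_bracket G M \<alpha>\<^sub>1 (\<xi>\<^sub>2 - \<alpha>\<^sub>2))
      + Dc ?u (\<nu>\<^sub>2, \<zeta>\<^sub>2) (\<xi>\<^sub>1 - \<alpha>\<^sub>1) - Dc ?u (\<nu>\<^sub>1, \<zeta>\<^sub>1) (\<xi>\<^sub>2 - \<alpha>\<^sub>2)"
    by (simp only: blinfun.add_right blinfun.diff_right)
  \<comment> \<open>Antisymmetry cancels the mixed brackets; of the three copies of the bracket of
    the two \<alpha>'s one remains, with a minus sign.\<close>
  also have "lie_bracket G M (\<xi>\<^sub>1 - \<alpha>\<^sub>1) (\<xi>\<^sub>2 - \<alpha>\<^sub>2) - lie_bracket G M \<alpha>\<^sub>2 (\<xi>\<^sub>1 - \<alpha>\<^sub>1) + lie_bracket G M \<alpha>\<^sub>1 (\<xi>\<^sub>2 - \<alpha>\<^sub>2)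
      = lie_bracket G M \<xi>\<^sub>1 \<xi>\<^sub>2 - lie_bracket G M \<alpha>\<^sub>1 \<alpha>\<^sub>2"
    by (simp add: lie_bracket_antisym[of \<alpha>\<^sub>2])
  finally show ?thesis by (simp add: blinfun.diff_right)
qed

lemma Omega_Y_eq:
  assumes w: "\<nu>\<^sub>1 \<in> \<gg>_dual" "\<zeta>\<^sub>1 \<in> \<gg>_perp" "\<nu>\<^sub>2 \<in> \<gg>_dual" "\<zeta>\<^sub>2 \<in> \<gg>_perp"
  shows "Omega_Y G M ip \<mu> (g, \<nu>, \<rho>) (v\<^sub>1, \<nu>\<^sub>1, ad_\<mu> \<zeta>\<^sub>1) (v\<^sub>2, \<nu>\<^sub>2, ad_\<mu> \<zeta>\<^sub>2)
    = blinfun_apply (\<mu> + \<nu>) (lie_bracket G M (left_triv G M g v\<^sub>1) (left_triv G M g v\<^sub>2))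
      + blinfun_apply \<nu>\<^sub>2 (left_triv G M g v\<^sub>1) - blinfun_apply \<nu>\<^sub>1 (left_triv G M g v\<^sub>2)
      - blinfun_apply \<mu> (lie_bracket G M \<zeta>\<^sub>1 \<zeta>\<^sub>2)"
  using w by (simp add: Omega_Y_def Let_def orbit_tangent_rep_ad_star isotropy_component_apply)

text \<open>Both sides are derivatives of the same affine function of the parameters, hence equal in
  directions of the model.\<close>

lemma Dc_eq:
  assumes c: "\<And>u. u \<in> U \<Longrightarrow> c u = \<mu> + fst u" and u: "u \<in> U" and w: "w \<in> \<gg>_dual \<times> \<gg>_perp"
  shows "Dc u w \<xi> = blinfun_apply (fst w) \<xi>"
proof -
  have "has_tangent P (vec_mfd UNIV) (\<lambda>u. blinfun_apply (\<mu> + fst u) \<xi>) u (\<lambda>w. Dc u w \<xi>)"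
    by (rule has_tangent_cong[OF charted_P _ has_tangent_c[OF u]]) (simp add: c)
  moreover have "has_tangent P (vec_mfd UNIV) (\<lambda>u. blinfun_apply (\<mu> + fst u) \<xi>) u (\<lambda>w. blinfun_apply (fst w) \<xi>)"
    by (rule has_tangent_params_affine[OF u])
  ultimately show ?thesis using has_tangent_unique[OF charted_P] w by simp
qed

text \<open>With \<open>c\<close> equal to \<mu> + \<nu>, the pullback minus \<open>Omega_Y\<close>
  is the negative of the defect in the equation for \<open>F\<close>: the element g and the group
  velocities drop out.\<close>

lemma pullback_eq_iff:
  assumes c: "\<And>u. u \<in> U \<Longrightarrow> c u = \<mu> + fst u"
  shows "(\<forall>y\<in>slice_set G M \<mu> U. \<forall>v\<in>model Y. \<forall>w\<in>model Y.
      form_pullback Y C \<Phi> (Omega_c G M) y v w = Omega_Y G M ip \<mu> y v w) \<longleftrightarrow>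
    (\<forall>(\<nu>, \<eta>)\<in>U. \<forall>\<nu>\<^sub>1\<in>\<gg>_dual. \<forall>\<nu>\<^sub>2\<in>\<gg>_dual. \<forall>\<zeta>\<^sub>1\<in>\<gg>_perp. \<forall>\<zeta>\<^sub>2\<in>\<gg>_perp.
      blinfun_apply (\<mu> + \<nu>) (lie_bracket G M (\<alpha> (\<nu>, \<eta>) (\<nu>\<^sub>1, \<zeta>\<^sub>1)) (\<alpha> (\<nu>, \<eta>) (\<nu>\<^sub>2, \<zeta>\<^sub>2)))
      + blinfun_apply \<nu>\<^sub>2 (\<alpha> (\<nu>, \<eta>) (\<nu>\<^sub>1, \<zeta>\<^sub>1)) - blinfun_apply \<nu>\<^sub>1 (\<alpha> (\<nu>, \<eta>) (\<nu>\<^sub>2, \<zeta>\<^sub>2))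
      = blinfun_apply \<mu> (lie_bracket G M \<zeta>\<^sub>1 \<zeta>\<^sub>2))"
    (is "?L \<longleftrightarrow> (\<forall>(\<nu>, \<eta>)\<in>U. \<forall>\<nu>\<^sub>1\<in>_. \<forall>\<nu>\<^sub>2\<in>_. \<forall>\<zeta>\<^sub>1\<in>_. \<forall>\<zeta>\<^sub>2\<in>_. ?E \<nu> \<eta> \<nu>\<^sub>1 \<nu>\<^sub>2 \<zeta>\<^sub>1 \<zeta>\<^sub>2)")
proof -
  have key: "form_pullback Y C \<Phi> (Omega_c G M) (g, \<nu>, ad_\<mu> \<eta>) (v\<^sub>1, \<nu>\<^sub>1, ad_\<mu> \<zeta>\<^sub>1) (v\<^sub>2, \<nu>\<^sub>2, ad_\<mu> \<zeta>\<^sub>2)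
      = Omega_Y G M ip \<mu> (g, \<nu>, ad_\<mu> \<eta>) (v\<^sub>1, \<nu>\<^sub>1, ad_\<mu> \<zeta>\<^sub>1) (v\<^sub>2, \<nu>\<^sub>2, ad_\<mu> \<zeta>\<^sub>2) \<longleftrightarrow> ?E \<nu> \<eta> \<nu>\<^sub>1 \<nu>\<^sub>2 \<zeta>\<^sub>1 \<zeta>\<^sub>2"
    if "g \<in> carrier G" "(\<nu>, \<eta>) \<in> U" "\<nu>\<^sub>1 \<in> \<gg>_dual" "\<zeta>\<^sub>1 \<in> \<gg>_perp" "\<nu>\<^sub>2 \<in> \<gg>_dual" "\<zeta>\<^sub>2 \<in> \<gg>_perp"
    for g \<nu> \<eta> \<nu>\<^sub>1 \<nu>\<^sub>2 \<zeta>\<^sub>1 \<zeta>\<^sub>2 v\<^sub>1 v\<^sub>2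
    unfolding pullback_Omega_c[OF that] Omega_Y_eq[OF that(3-6)]
    using that by (auto simp: c Dc_eq[OF c] blinfun.diff_right)
  have Y: "v \<in> model Y \<longleftrightarrow> (\<exists>v' \<nu> \<zeta>. v = (v', \<nu>, ad_\<mu> \<zeta>) \<and> \<nu> \<in> \<gg>_dual \<and> \<zeta> \<in> \<gg>_perp)" for v
    by (cases v) (auto simp: orbit_tangent_def)
  show ?thesis
  proof
    assume L: ?L
    show "\<forall>(\<nu>, \<eta>)\<in>U. \<forall>\<nu>\<^sub>1\<in>\<gg>_dual. \<forall>\<nu>\<^sub>2\<in>\<gg>_dual. \<forall>\<zeta>\<^sub>1\<in>\<gg>_perp. \<forall>\<zeta>\<^sub>2\<in>\<gg>_perp. ?E \<nu> \<eta> \<nu>\<^sub>1 \<nu>\<^sub>2 \<zeta>\<^sub>1 \<zeta>\<^sub>2"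
    proof (intro ballI, clarify)
      fix \<nu> \<eta> \<nu>\<^sub>1 \<nu>\<^sub>2 \<zeta>\<^sub>1 \<zeta>\<^sub>2
      assume h: "(\<nu>, \<eta>) \<in> U" "\<nu>\<^sub>1 \<in> \<gg>_dual" "\<nu>\<^sub>2 \<in> \<gg>_dual" "\<zeta>\<^sub>1 \<in> \<gg>_perp" "\<zeta>\<^sub>2 \<in> \<gg>_perp"
      have "(0, \<nu>\<^sub>1, ad_\<mu> \<zeta>\<^sub>1) \<in> model Y" "(0, \<nu>\<^sub>2, ad_\<mu> \<zeta>\<^sub>2) \<in> model Y"
        unfolding Y using h by blast+
      from L[rule_format, OF slice_setI[OF one_closed h(1)] this]
      show "?E \<nu> \<eta> \<nu>\<^sub>1 \<nu>\<^sub>2 \<zeta>\<^sub>1 \<zeta>\<^sub>2" unfolding key[OF one_closed h(1,2,4,3,5)] .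
    qed
  next
    assume R: "\<forall>(\<nu>, \<eta>)\<in>U. \<forall>\<nu>\<^sub>1\<in>\<gg>_dual. \<forall>\<nu>\<^sub>2\<in>\<gg>_dual. \<forall>\<zeta>\<^sub>1\<in>\<gg>_perp. \<forall>\<zeta>\<^sub>2\<in>\<gg>_perp. ?E \<nu> \<eta> \<nu>\<^sub>1 \<nu>\<^sub>2 \<zeta>\<^sub>1 \<zeta>\<^sub>2"
    show ?L
    proof (intro ballI)
      fix y v w assume "y \<in> slice_set G M \<mu> U" "v \<in> model Y" "w \<in> model Y"
      then obtain g \<nu> \<eta> v\<^sub>1 \<nu>\<^sub>1 \<zeta>\<^sub>1 v\<^sub>2 \<nu>\<^sub>2 \<zeta>\<^sub>2 where h: "g \<in> carrier G" "(\<nu>, \<eta>) \<in> U"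
        "\<nu>\<^sub>1 \<in> \<gg>_dual" "\<zeta>\<^sub>1 \<in> \<gg>_perp" "\<nu>\<^sub>2 \<in> \<gg>_dual" "\<zeta>\<^sub>2 \<in> \<gg>_perp"
        and e: "y = (g, \<nu>, ad_\<mu> \<eta>)" "v = (v\<^sub>1, \<nu>\<^sub>1, ad_\<mu> \<zeta>\<^sub>1)" "w = (v\<^sub>2, \<nu>\<^sub>2, ad_\<mu> \<zeta>\<^sub>2)"
        unfolding Y slice_set_def by blast
      have "?E \<nu> \<eta> \<nu>\<^sub>1 \<nu>\<^sub>2 \<zeta>\<^sub>1 \<zeta>\<^sub>2" using R h by blast
      then show "form_pullback Y C \<Phi> (Omega_c G M) y v w = Omega_Y G M ip \<mu> y v w"
        unfolding e key[OF h] .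
    qed
  qed
qed

text \<open>For fixed \<xi>, the pairing of \<open>c\<close> minus \<mu> + \<nu> with \<xi> has zero
  derivative, is constant on the connected set U and vanishes at the origin.\<close>

lemma momentum_eq:
  assumes con: "connected U" "(0, 0) \<in> U" and c0: "c (0, 0) = \<mu>"
    and eq: "\<And>y v w. y \<in> slice_set G M \<mu> U \<Longrightarrow> v \<in> model Y \<Longrightarrow> w \<in> model Y \<Longrightarrow>
      form_pullback Y C \<Phi> (Omega_c G M) y v w = Omega_Y G M ip \<mu> y v w"
    and u: "u \<in> U"
  shows "c u = \<mu> + fst u"
proof (rule blinfun_eqI)
  fix \<xi>
  have zero: "0 \<in> \<gg>_dual" "0 \<in> \<gg>_perp" "0 \<in> T_orbit"
    using subspace_isotropy_dual subspace_isotropy_perp subspace_orbit_tangent by (auto intro: subspace_0)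
  have ad0: "ad_\<mu> 0 = 0" using linear_0[OF linear_ad_star] .
  have Dc: "Dc u w \<xi> = blinfun_apply (fst w) \<xi>" if u: "u \<in> U" and w: "w \<in> \<gg>_dual \<times> \<gg>_perp" for u w
  proof -
    obtain \<nu> \<eta> \<nu>\<^sub>2 \<zeta>\<^sub>2 where e: "u = (\<nu>, \<eta>)" "w = (\<nu>\<^sub>2, \<zeta>\<^sub>2)" by fastforce
    have h: "(\<nu>, \<eta>) \<in> U" "\<nu>\<^sub>2 \<in> \<gg>_dual" "\<zeta>\<^sub>2 \<in> \<gg>_perp" using u w e by auto
    have \<alpha>0: "\<alpha> (\<nu>, \<eta>) (0, 0) = 0" using linear_0[OF linear_\<alpha>[OF h(1)]] by (simp add: zero_prod_def)
    have Dc0: "Dc (\<nu>, \<eta>) (0, 0) \<xi>' = 0" for \<xi>'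
      using linear_0[OF bounded_linear.linear[OF has_tangent_linear[OF has_tangent_c[OF h(1)]]]]
      by (simp add: zero_prod_def)
    \<comment> \<open>The identity element is chosen so that left-trivialisation is trivial and
      \<xi> itself is the group velocity. All brackets then have a zero entry, leaving
      \<open>Dc\<close> on one side and the pairing of \<nu>-dot with \<xi> on the other.\<close>
    have "form_pullback Y C \<Phi> (Omega_c G M) (\<one>, \<nu>, ad_\<mu> \<eta>) (\<xi>, 0, ad_\<mu> 0) (0, \<nu>\<^sub>2, ad_\<mu> \<zeta>\<^sub>2)
        = Omega_Y G M ip \<mu> (\<one>, \<nu>, ad_\<mu> \<eta>) (\<xi>, 0, ad_\<mu> 0) (0, \<nu>\<^sub>2, ad_\<mu> \<zeta>\<^sub>2)"
      using zero h ad0 by (intro eq) (auto simp: orbit_tangent_def)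
    then show ?thesis
      unfolding pullback_Omega_c[OF one_closed h(1) zero(1,2) h(2,3)] Omega_Y_eq[OF zero(1,2) h(2,3)] e
      by (simp add: \<alpha>0 Dc0)
  qed
  let ?f = "\<lambda>u. blinfun_apply (c u) \<xi> - blinfun_apply (\<mu> + fst u) \<xi>"
  have "?f u = ?f (0, 0)"
  proof (rule constant_on_params[OF con(1) _ _ u con(2)])
    fix u assume u: "u \<in> U"
    show "has_tangent P (vec_mfd UNIV) ?f u (\<lambda>w. Dc u w \<xi> - blinfun_apply (fst w) \<xi>)"
      by (rule has_tangent_diff[OF has_tangent_c[OF u] has_tangent_params_affine[OF u]])
    show "Dc u w \<xi> - blinfun_apply (fst w) \<xi> = 0" if "w \<in> \<gg>_dual \<times> \<gg>_perp" for w
      using Dc[OF u that] by simp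
  qed
  then show "blinfun_apply (c u) \<xi> = blinfun_apply (\<mu> + fst u) \<xi>" by (simp add: c0)
qed

end

section \<open>Equivalence of the symplectic condition and the equation for \<open>F\<close>\<close>

theorem proposition1:
  fixes G :: "('g, 'x) monoid_scheme"
    and M :: "('g, 'a::euclidean_space) mfd"
    and ip :: "'a \<Rightarrow> 'a \<Rightarrow> real"
    and \<mu> :: "'a dual"
    and U :: "('a dual \<times> 'a) set"
    and Y :: "('g \<times> 'a dual \<times> 'a dual, 'a \<times> 'a dual \<times> 'a dual) mfd"
    and P :: "('a dual \<times> 'a, 'a dual \<times> 'a) mfd"
    and \<Phi> :: "'g \<times> 'a dual \<times> 'a dual \<Rightarrow> 'g \<times> 'a dual"
  assumes "lie_group G M"
    and "invariant_inner_product G M ip"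
    and "\<mu> \<noteq> 0"
    and "openin (top_of_set (isotropy_dual G M ip \<mu> \<times> isotropy_perp G M ip \<mu>)) U"
    and "connected U"
    and "(0, 0) \<in> U"
    and Y: "Y = open_submfd (slice_model G M ip \<mu>) (slice_set G M \<mu> U)"
    and P: "P = open_submfd (slice_params G M ip \<mu>) U"
    and "smooth_map Y (cotangent_mfd M) \<Phi>"
    and equivariant:
      "\<And>h g \<nu> \<rho>. h \<in> carrier G \<Longrightarrow> (g, \<nu>, \<rho>) \<in> slice_set G M \<mu> U \<Longrightarrow>
         \<Phi> (h \<otimes>\<^bsub>G\<^esub> g, \<nu>, \<rho>) = (h \<otimes>\<^bsub>G\<^esub> fst (\<Phi> (g, \<nu>, \<rho>)), snd (\<Phi> (g, \<nu>, \<rho>)))"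
    and "local_diffeo Y (cotangent_mfd M) \<Phi>"
    and "\<Phi> (\<one>\<^bsub>G\<^esub>, 0, 0) = (\<one>\<^bsub>G\<^esub>, \<mu>)"
  shows
    "(\<forall>y\<in>slice_set G M \<mu> U. \<forall>v\<in>model Y. \<forall>w\<in>model Y.
        form_pullback Y (cotangent_mfd M) \<Phi> (Omega_c G M) y v w = Omega_Y G M ip \<mu> y v w)
     \<longleftrightarrow>
     (\<exists>F. smooth_map P M F \<and> F (0, 0) = \<one>\<^bsub>G\<^esub> \<and>
        (\<forall>g\<in>carrier G. \<forall>(\<nu>, \<eta>)\<in>U.
           \<Phi> (g, \<nu>, ad_star G M \<eta> \<mu>) =
             (g \<otimes>\<^bsub>G\<^esub> inv\<^bsub>G\<^esub> F (\<nu>, \<eta>), Ad_star G M (inv\<^bsub>G\<^esub> F (\<nu>, \<eta>)) (\<mu> + \<nu>))) \<and>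
        (\<forall>(\<nu>, \<eta>)\<in>U.
           \<forall>\<nu>\<^sub>1\<in>isotropy_dual G M ip \<mu>. \<forall>\<nu>\<^sub>2\<in>isotropy_dual G M ip \<mu>.
           \<forall>\<zeta>\<^sub>1\<in>isotropy_perp G M ip \<mu>. \<forall>\<zeta>\<^sub>2\<in>isotropy_perp G M ip \<mu>.
             blinfun_apply (\<mu> + \<nu>)
               (lie_bracket G M (left_triv_deriv G M P F (\<nu>, \<eta>) (\<nu>\<^sub>1, \<zeta>\<^sub>1))
                                (left_triv_deriv G M P F (\<nu>, \<eta>) (\<nu>\<^sub>2, \<zeta>\<^sub>2)))
             + blinfun_apply \<nu>\<^sub>2 (left_triv_deriv G M P F (\<nu>, \<eta>) (\<nu>\<^sub>1, \<zeta>\<^sub>1))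
             - blinfun_apply \<nu>\<^sub>1 (left_triv_deriv G M P F (\<nu>, \<eta>) (\<nu>\<^sub>2, \<zeta>\<^sub>2))
             = blinfun_apply \<mu> (lie_bracket G M \<zeta>\<^sub>1 \<zeta>\<^sub>2)))"
    (is "?pullback \<longleftrightarrow> (\<exists>F. ?smooth F \<and> ?base F \<and> ?\<Phi> F \<and> ?equation F)")
proof -
  interpret slice G M ip \<mu> U \<Phi> Y P "cotangent_mfd M"
    by unfold_locales (use assms in auto)
  show ?thesis
  proof
    assume eq: ?pullback
    define F where "F u = inv\<^bsub>G\<^esub> fst (\<Phi> (\<one>\<^bsub>G\<^esub>, fst u, ad_star G M (snd u) \<mu>))" for u
    define b where "b u = snd (\<Phi> (\<one>\<^bsub>G\<^esub>, fst u, ad_star G M (snd u) \<mu>))" for u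
    have smooth: "?smooth F"
      unfolding F_def by (rule smooth_map_inv[OF charted_P smooth_group_part])
    interpret slice_factor G M ip \<mu> U \<Phi> Y P "cotangent_mfd M" F b
    proof unfold_locales
      fix g \<nu> \<eta> assume g: "g \<in> carrier G" and u: "(\<nu>, \<eta>) \<in> U"
      have y: "(\<one>\<^bsub>G\<^esub>, \<nu>, ad_star G M \<eta> \<mu>) \<in> slice_set G M \<mu> U" using u by auto
      have "fst (\<Phi> (\<one>\<^bsub>G\<^esub>, \<nu>, ad_star G M \<eta> \<mu>)) \<in> carrier G" using \<Phi>_in_C[OF y] by auto
      then show "\<Phi> (g, \<nu>, ad_star G M \<eta> \<mu>) = (g \<otimes>\<^bsub>G\<^esub> inv\<^bsub>G\<^esub> F (\<nu>, \<eta>), b (\<nu>, \<eta>))"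
        using equivariant[OF g y] g by (simp add: F_def b_def)
    qed (rule smooth)
    \<comment> \<open>As ad* at 0 vanishes, the parameter origin corresponds to the point where the
      value of \<Phi> is prescribed.\<close>
    have base: "F (0, 0) = \<one>\<^bsub>G\<^esub>" "b (0, 0) = \<mu>"
      using assms(12) linear_0[OF linear_ad_star] by (simp_all add: F_def b_def)
    have "c (0, 0) = \<mu>" by (rule blinfun_eqI) (simp add: c_def base)
    then have c: "c u = \<mu> + fst u" if "u \<in> U" for u
      using eq that assms(5,6) by (intro momentum_eq) auto
    have "?\<Phi> F"
    proof (intro ballI, clarify)
      fix g \<nu> \<eta> assume g: "g \<in> carrier G" and u: "(\<nu>, \<eta>) \<in> U"
      have "b (\<nu>, \<eta>) = Ad_star G M (inv\<^bsub>G\<^esub> F (\<nu>, \<eta>)) (c (\<nu>, \<eta>))"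
        using u by (intro blinfun_eqI) (simp add: c_apply)
      then show "\<Phi> (g, \<nu>, ad_star G M \<eta> \<mu>) =
          (g \<otimes>\<^bsub>G\<^esub> inv\<^bsub>G\<^esub> F (\<nu>, \<eta>), Ad_star G M (inv\<^bsub>G\<^esub> F (\<nu>, \<eta>)) (\<mu> + \<nu>))"
        using \<Phi>_eq[OF g u] c[OF u] by simp
    qed
    moreover have "?equation F" using pullback_eq_iff[OF c] eq by blast
    ultimately show "\<exists>F. ?smooth F \<and> ?base F \<and> ?\<Phi> F \<and> ?equation F"
      using smooth base(1) by blast
  next
    assume "\<exists>F. ?smooth F \<and> ?base F \<and> ?\<Phi> F \<and> ?equation F"
    then obtain F where F: "?smooth F" "?\<Phi> F" "?equation F" by blast
    \<comment> \<open>This choice makes \<open>c\<close> equal to \<mu> + \<nu> by construction,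
      since the dual actions of F and of its inverse cancel.\<close>
    define b where "b u = Ad_star G M (inv\<^bsub>G\<^esub> F u) (\<mu> + fst u)" for u
    interpret slice_factor G M ip \<mu> U \<Phi> Y P "cotangent_mfd M" F b
      by unfold_locales (use F(1,2) in \<open>auto simp: b_def\<close>)
    have "c u = \<mu> + fst u" if "u \<in> U" for u
      using that by (intro blinfun_eqI) (simp add: c_apply b_def)
    from pullback_eq_iff[OF this] F(3) show ?pullback by blast
  qed
qed

end
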